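(* There exists an $\widetilde{O}(n^{2/3}+D)$-round randomized algorithm in the $\mathsf{CONGEST}$ model that solves the Replacement Paths (RPaths) problem in unweighted directed graphs with high probability.
   Context: Let $G=(V,E)$ be an unweighted directed graph with $n=|V|$. The communication network is $G$ itself, with communication over each edge in both directions regardless of its orientation; $D$ denotes the diameter of the underlying undirected unweighted graph. In the $\mathsf{CONGEST}$ model, computation proceeds in synchronous rounds; in each round every vertex may send a (possibly different) $O(\log n)$-bit message to each of its neighbours; vertices have unique $O(\log n)$-bit identifiers and unlimited local computation. "With high probability" means with probability $1-1/\operatorname{poly}(n)$; $\widetilde{O}$ hides polylogarithmic factors in $n$. Input: vertices $s,t$ and a shortest $s$-$t$ path $P=(s=v_0,v_1,\dots,v_{h_{st}}=t)$, where $h_{st}$ is the number of edges of $P$. Initially, both endpoints of each edge of $P$ know that this edge belongs to $P$, $s$ knows it is the source, and $t$ knows it is the target. For an edge $e$, $|st\diamond e|$ denotes the length (number of edges) of a shortest $s$-$t$ path in $G$ that does not use $e$ ($\infty$ if none exists). The RPaths problem asks that, for every $0\le i<h_{st}$, the vertex $v_i$ computes $|st\diamond (v_i,v_{i+1})|$. *)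

theory Defs
  imports "HOL-Probability.Probability"
begin

text \<open>Graphs: vertices are natural numbers (which double as the unique identifiers),
  a directed graph is a vertex set V with an edge set E \<subseteq> V \<times> V.\<close>

definition is_walk :: "(nat \<times> nat) set \<Rightarrow> nat \<Rightarrow> nat \<Rightarrow> nat list \<Rightarrow> bool" where
  "is_walk E u w p \<longleftrightarrow> p \<noteq> [] \<and> hd p = u \<and> last p = w \<and>
     (\<forall>i. Suc i < length p \<longrightarrow> (p ! i, p ! Suc i) \<in> E)"

definition gdist :: "(nat \<times> nat) set \<Rightarrow> nat \<Rightarrow> nat \<Rightarrow> enat" where
  "gdist E u w = (INF p \<in> {p. is_walk E u w p}. enat (length p - 1))"

definition path_edges :: "nat list \<Rightarrow> (nat \<times> nat) set" where
  "path_edges P = {(P ! i, P ! Suc i) | i. Suc i < length P}"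

definition is_shortest_path :: "(nat \<times> nat) set \<Rightarrow> nat \<Rightarrow> nat \<Rightarrow> nat list \<Rightarrow> bool" where
  "is_shortest_path E s t P \<longleftrightarrow> is_walk E s t P \<and> distinct P \<and> enat (length P - 1) = gdist E s t"

definition repl_dist :: "(nat \<times> nat) set \<Rightarrow> nat \<Rightarrow> nat \<Rightarrow> nat \<times> nat \<Rightarrow> enat" where
  "repl_dist E s t e = gdist (E - {e}) s t"

definition uedges :: "(nat \<times> nat) set \<Rightarrow> (nat \<times> nat) set" where
  "uedges E = E \<union> E\<inverse>"

definition nbrs :: "(nat \<times> nat) set \<Rightarrow> nat \<Rightarrow> nat set" where
  "nbrs E v = {u. (v, u) \<in> uedges E \<and> u \<noteq> v}"

definition uconnected :: "nat set \<Rightarrow> (nat \<times> nat) set \<Rightarrow> bool" where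
  "uconnected V E \<longleftrightarrow> (\<forall>u\<in>V. \<forall>w\<in>V. gdist (uedges E) u w < \<infinity>)"

definition udiam :: "nat set \<Rightarrow> (nat \<times> nat) set \<Rightarrow> nat" where
  "udiam V E = Max {the_enat (gdist (uedges E) u w) | u w. u \<in> V \<and> w \<in> V}"

text \<open>CONGEST model.  A message is a bit string; None = no message.
  The inbox of a round maps each neighbour identifier to the message received from it.
  The local input of vertex v: (own id, n, is_source, is_target, neighbour info), where the
  neighbour info for u is None if u is not a neighbour and otherwise
  Some (v\<rightarrow>u \<in> E, u\<rightarrow>v \<in> E, (v,u) is an edge of P, (u,v) is an edge of P).\<close>

type_synonym inbox = "nat \<Rightarrow> bool list option"
type_synonym linput = "nat \<times> nat \<times> bool \<times> bool \<times> (nat \<Rightarrow> (bool \<times> bool \<times> bool \<times> bool) option)"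
type_synonym tape = "nat \<Rightarrow> bool"

text \<open>Since local computation is unlimited, a vertex's behaviour is w.l.o.g. a function of
  its local input, its private random tape and the full history of received inboxes.\<close>
type_synonym send_fun = "linput \<Rightarrow> tape \<Rightarrow> inbox list \<Rightarrow> nat \<Rightarrow> bool list option"
type_synonym out_fun = "linput \<Rightarrow> tape \<Rightarrow> inbox list \<Rightarrow> enat option"

definition local_input :: "nat set \<Rightarrow> (nat \<times> nat) set \<Rightarrow> nat \<Rightarrow> nat \<Rightarrow> nat list \<Rightarrow> nat \<Rightarrow> linput" where
  "local_input V E s t P v =
     (v, card V, v = s, v = t,
      \<lambda>u. if u \<in> nbrs E v
          then Some ((v, u) \<in> E, (u, v) \<in> E, (v, u) \<in> path_edges P, (u, v) \<in> path_edges P)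
          else None)"

primrec hist :: "send_fun \<Rightarrow> (nat \<Rightarrow> linput) \<Rightarrow> (nat \<Rightarrow> nat set) \<Rightarrow> (nat \<Rightarrow> tape) \<Rightarrow> nat \<Rightarrow> nat \<Rightarrow> inbox list" where
  "hist sendf I N \<omega> 0 = (\<lambda>v. [])"
| "hist sendf I N \<omega> (Suc r) = (\<lambda>v. hist sendf I N \<omega> r v @
     [\<lambda>u. if u \<in> N v then sendf (I u) (\<omega> u) (hist sendf I N \<omega> r u) v else None])"

definition decides :: "send_fun \<Rightarrow> out_fun \<Rightarrow> (nat \<Rightarrow> linput) \<Rightarrow> (nat \<Rightarrow> nat set) \<Rightarrow> (nat \<Rightarrow> tape)
    \<Rightarrow> nat \<Rightarrow> nat \<Rightarrow> enat \<Rightarrow> bool" where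
  "decides sendf outp I N \<omega> v T x \<longleftrightarrow>
     (\<exists>r\<le>T. outp (I v) (\<omega> v) (hist sendf I N \<omega> r v) = Some x \<and>
        (\<forall>r'<r. outp (I v) (\<omega> v) (hist sendf I N \<omega> r' v) = None))"

definition coin_space :: "nat set \<Rightarrow> (nat \<Rightarrow> tape) measure" where
  "coin_space V = PiM V (\<lambda>_. PiM UNIV (\<lambda>_::nat. measure_pmf (bernoulli_pmf (1/2))))"

end

theory Submission
  imports Defs
begin

text \<open>
  Let v_0, ..., v_h be the given path P and G' the graph without the edges of P. The replacement distance
  for the edge (v_i, v_{i+1}) is the minimum of a + d(v_a, v_b) + (h - b) over all a \<le> i < b, where d is
  the distance in G'. Fix a window z of order n^{2/3} log n and sample every vertex as a landmark with
  probability about n^{-2/3}; with high probability there are about n^{1/3} landmarks and every shortest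
  path with z edges, in G' or on P, contains one.

  The landmarks on P let all vertices learn their positions. A detour of length at most z satisfies
  b - a \<le> z; such detours are found by a backward search in G' that keeps, for every length, only the
  farthest position on P, followed by a wave of length z along P. A longer detour decomposes into pieces of
  length at most z between landmarks. Pipelined searches give the distances to and from landmarks, waves
  along P combine them within a window, and the n^{2/3} values held by landmarks are broadcast to all
  vertices; the landmarks on P then cover the positions outside the window. A broadcast needs a bound on
  the diameter, which is obtained by computing the eccentricity of s.
\<close>

subsection \<open>Broadcast machines\<close>

text \<open>The exponent 2/3 balances two costs: searches over a window of z rounds, and the
  broadcast of one number per pair of landmarks, whose count m^2 is about n^(2/3) when m is about
  n^(1/3). The obstacle is congestion. For short detours it disappears because, among detours of
  equal length leaving the same vertex, the one that rejoins P farthest along bypasses every edge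
  that the others bypass and is cheapest, so one number per vertex and round is enough. For tables
  indexed by landmarks, a wave along P carries in each round the entry of a single landmark, chosen
  by a diagonal of the position-time grid; m landmarks then cost m additional rounds instead of a
  factor m. Chance enters only through the landmark set. Given a set that hits the long shortest
  walks and is not too large, every phase is deterministic and ends at all vertices in the same
  round, so phases are chained without synchronisation. If the sample is bad the answers may be
  wrong, but the bound on the message length still holds, since inadmissible messages are
  suppressed.\<close>

type_synonym msg = "nat list"

text \<open>One message goes to all neighbours, which suffices for every phase; direction and edge
  type are sorted out by the receiver. The input of type \<open>'k\<close> stays fixed during a run,
  and the output type of one machine can be the input type of the next.\<close>

record ('k, 's, 'o) machine =
  ini :: "'k \<Rightarrow> 's"
  bcast :: "'k \<Rightarrow> nat \<Rightarrow> 's \<Rightarrow> msg option"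
  step :: "'k \<Rightarrow> nat \<Rightarrow> 's \<Rightarrow> (nat \<Rightarrow> msg option) \<Rightarrow> 's"
  halt :: "'k \<Rightarrow> nat \<Rightarrow> 's \<Rightarrow> 'o option"

primrec run :: "('k, 's, 'o) machine \<Rightarrow> (nat \<Rightarrow> nat set) \<Rightarrow> (nat \<Rightarrow> 'k) \<Rightarrow> nat \<Rightarrow> nat \<Rightarrow> 's" where
  "run M N K 0 = (\<lambda>u. ini M (K u))"
| "run M N K (Suc r) = (\<lambda>u. step M (K u) r (run M N K r u)
     (\<lambda>w. if w \<in> N u then bcast M (K w) r (run M N K r w) else None))"

text \<open>Halting in the same round everywhere is what permits sequential composition without
  synchronisation. Messages are constrained only before round \<open>T\<close>, since a composed
  machine switches at that round.\<close>

definition computes :: "(nat \<Rightarrow> nat set) \<Rightarrow> nat set \<Rightarrow> msg set \<Rightarrow> ('k, 's, 'o) machine \<Rightarrow>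
    (nat \<Rightarrow> 'k) \<Rightarrow> nat \<Rightarrow> (nat \<Rightarrow> 'o) \<Rightarrow> bool" where
  "computes N V A M K T K' \<longleftrightarrow> (\<forall>u\<in>V.
     halt M (K u) T (run M N K T u) = Some (K' u) \<and>
     (\<forall>r<T. halt M (K u) r (run M N K r u) = None \<and>
       (\<forall>m. bcast M (K u) r (run M N K r u) = Some m \<longrightarrow> m \<in> A)))"

fun start_or_continue :: "('k, 's, 'o) machine \<Rightarrow> 'a \<Rightarrow> 'k option \<Rightarrow> 'a + 'k \<times> nat \<times> 's" where
  "start_or_continue M a None = Inl a"
| "start_or_continue M a (Some k) = Inr (k, 0, ini M k)"

text \<open>The right summand stores the output \<open>l\<close> of the first machine as the input
  of the second, together with a round counter of its own. The switch happens within the step in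
  which the first machine halts (or in \<open>ini\<close>, if it halts at once), so no round is lost
  and the times just add up.\<close>

definition seq_comp :: "('k, 's, 'l) machine \<Rightarrow> ('l, 't, 'o) machine \<Rightarrow>
    ('k, 's + 'l \<times> nat \<times> 't, 'o) machine" where
  "seq_comp M1 M2 = \<lparr>
     ini = (\<lambda>k. start_or_continue M2 (ini M1 k) (halt M1 k 0 (ini M1 k))),
     bcast = (\<lambda>k r st. case st of Inl a \<Rightarrow> bcast M1 k r a | Inr (l, q, b) \<Rightarrow> bcast M2 l q b),
     step = (\<lambda>k r st ib. case st of
         Inl a \<Rightarrow> start_or_continue M2 (step M1 k r a ib) (halt M1 k (Suc r) (step M1 k r a ib))
       | Inr (l, q, b) \<Rightarrow> Inr (l, Suc q, step M2 l q b ib)),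
     halt = (\<lambda>k r st. case st of Inl a \<Rightarrow> None | Inr (l, q, b) \<Rightarrow> halt M2 l q b)\<rparr>"

lemma seq_comp_simps [simp]:
  "ini (seq_comp M1 M2) k = start_or_continue M2 (ini M1 k) (halt M1 k 0 (ini M1 k))"
  "bcast (seq_comp M1 M2) k r (Inl a) = bcast M1 k r a"
  "bcast (seq_comp M1 M2) k r (Inr (l, q, b)) = bcast M2 l q b"
  "step (seq_comp M1 M2) k r (Inl a) ib =
     start_or_continue M2 (step M1 k r a ib) (halt M1 k (Suc r) (step M1 k r a ib))"
  "step (seq_comp M1 M2) k r (Inr (l, q, b)) ib = Inr (l, Suc q, step M2 l q b ib)"
  "halt (seq_comp M1 M2) k r (Inl a) = None"
  "halt (seq_comp M1 M2) k r (Inr (l, q, b)) = halt M2 l q b"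
  by (simp_all add: seq_comp_def)

lemma computes_halt: "computes N V A M K T K' \<Longrightarrow> u \<in> V \<Longrightarrow> halt M (K u) T (run M N K T u) = Some (K' u)"
  and computes_not_halt: "computes N V A M K T K' \<Longrightarrow> u \<in> V \<Longrightarrow> r < T \<Longrightarrow> halt M (K u) r (run M N K r u) = None"
  and computes_bcast: "computes N V A M K T K' \<Longrightarrow> u \<in> V \<Longrightarrow> r < T \<Longrightarrow>
    bcast M (K u) r (run M N K r u) = Some m \<Longrightarrow> m \<in> A"
  by (auto simp: computes_def)

lemma run_seq_comp_first:
  assumes NV: "\<forall>u\<in>V. N u \<subseteq> V" and M1: "computes N V A M1 K T1 K1"
    and "r < T1" "u \<in> V"
  shows "run (seq_comp M1 M2) N K r u = Inl (run M1 N K r u)"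
  using assms(3,4)
proof (induction r arbitrary: u)
  case 0
  then show ?case using computes_not_halt[OF M1, of u 0] by simp
next
  case (Suc r)
  have eq: "(\<lambda>w. if w \<in> N u then bcast (seq_comp M1 M2) (K w) r (run (seq_comp M1 M2) N K r w) else None)
     = (\<lambda>w. if w \<in> N u then bcast M1 (K w) r (run M1 N K r w) else None)"
    using Suc NV by (auto simp: fun_eq_iff dest!: subsetD)
  have "halt M1 (K u) (Suc r) (run M1 N K (Suc r) u) = None"
    using M1 Suc.prems by (auto simp: computes_def simp del: run.simps)
  then show ?case using Suc by (simp add: eq)
qed

lemma run_seq_comp_second:
  assumes NV: "\<forall>u\<in>V. N u \<subseteq> V" and M1: "computes N V A M1 K T1 K1"
    and "u \<in> V"
  shows "run (seq_comp M1 M2) N K (T1 + r) u = Inr (K1 u, r, run M2 N K1 r u)"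
  using assms(3)
proof (induction r arbitrary: u)
  case 0
  show ?case
  proof (cases T1)
    case 0
    then show ?thesis using computes_halt[OF M1 \<open>u \<in> V\<close>] by simp
  next
    case (Suc q)
    have first: "run (seq_comp M1 M2) N K q w = Inl (run M1 N K q w)" if "w \<in> V" for w
      using run_seq_comp_first[OF NV M1 _ that] Suc by auto
    have eq: "(\<lambda>w. if w \<in> N u then bcast (seq_comp M1 M2) (K w) q (run (seq_comp M1 M2) N K q w) else None)
     = (\<lambda>w. if w \<in> N u then bcast M1 (K w) q (run M1 N K q w) else None)"
      using first bspec[OF NV \<open>u \<in> V\<close>] by (auto simp: fun_eq_iff dest!: subsetD)
    have "halt M1 (K u) (Suc q) (run M1 N K (Suc q) u) = Some (K1 u)"
      using M1 \<open>u \<in> V\<close> Suc by (auto simp: computes_def simp del: run.simps)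
    then show ?thesis using Suc first[OF \<open>u \<in> V\<close>] by (simp add: eq)
  qed
next
  case (Suc r)
  have eq: "(\<lambda>w. if w \<in> N u then bcast (seq_comp M1 M2) (K w) (T1 + r) (run (seq_comp M1 M2) N K (T1 + r) w) else None)
     = (\<lambda>w. if w \<in> N u then bcast M2 (K1 w) r (run M2 N K1 r w) else None)"
    using Suc bspec[OF NV \<open>u \<in> V\<close>] by (auto simp: fun_eq_iff dest!: subsetD)
  show ?case using Suc by (simp add: eq)
qed

lemma computes_seq_comp:
  assumes NV: "\<forall>u\<in>V. N u \<subseteq> V"
    and M1: "computes N V A M1 K T1 K1" and M2: "computes N V A M2 K1 T2 K2"
  shows "computes N V A (seq_comp M1 M2) K (T1 + T2) K2"
  unfolding computes_def
proof (intro ballI conjI allI impI)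
  fix u assume u: "u \<in> V"
  show "halt (seq_comp M1 M2) (K u) (T1 + T2) (run (seq_comp M1 M2) N K (T1 + T2) u) = Some (K2 u)"
    unfolding run_seq_comp_second[OF NV M1 u] using M2 u by (simp add: computes_def)
next
  fix u r assume u: "u \<in> V" and r: "r < T1 + T2"
  have *: "halt (seq_comp M1 M2) (K u) r (run (seq_comp M1 M2) N K r u) = None \<and>
    (\<forall>m. bcast (seq_comp M1 M2) (K u) r (run (seq_comp M1 M2) N K r u) = Some m \<longrightarrow> m \<in> A)"
  proof (cases "r < T1")
    case True
    then show ?thesis unfolding run_seq_comp_first[OF NV M1 True u]
      using M1 u by (simp add: computes_def)
  next
    case False
    define q where "q = r - T1"
    have q: "r = T1 + q" "q < T2" using False r by (auto simp: q_def)
    then show ?thesis unfolding q(1) run_seq_comp_second[OF NV M1 u]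
      using M2 u by (simp add: computes_def)
  qed
  from * show "halt (seq_comp M1 M2) (K u) r (run (seq_comp M1 M2) N K r u) = None" by simp
  fix m assume "bcast (seq_comp M1 M2) (K u) r (run (seq_comp M1 M2) N K r u) = Some m"
  with * show "m \<in> A" by simp
qed

text \<open>Only the number of admissible messages matters for their length in bits.\<close>

definition bit_coding :: "msg set \<Rightarrow> nat \<Rightarrow> msg \<Rightarrow> bool list" where
  "bit_coding A b = (SOME f. inj_on f A \<and> f ` A \<subseteq> {bs. length bs = b})"

lemma bit_coding:
  assumes "finite A" "card A \<le> 2 ^ b"
  shows "inj_on (bit_coding A b) A" "m \<in> A \<Longrightarrow> length (bit_coding A b m) = b"
proof -
  have eq: "{bs::bool list. length bs = b} = {bs. set bs \<subseteq> UNIV \<and> length bs = b}" by simp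
  have "card {bs::bool list. length bs = b} = 2 ^ b" "finite {bs::bool list. length bs = b}"
    unfolding eq using card_lists_length_eq[of "UNIV::bool set" b] finite_lists_length_eq[of "UNIV::bool set" b]
    by simp_all
  then have "\<exists>f. inj_on f A \<and> f ` A \<subseteq> {bs::bool list. length bs = b}"
    using card_le_inj[of A "{bs::bool list. length bs = b}"] assms by auto
  then have "inj_on (bit_coding A b) A \<and> bit_coding A b ` A \<subseteq> {bs. length bs = b}"
    unfolding bit_coding_def by (rule someI_ex)
  then show "inj_on (bit_coding A b) A" "m \<in> A \<Longrightarrow> length (bit_coding A b m) = b" by auto
qed

section \<open>Simulating broadcast machines by history-based CONGEST algorithms\<close>

definition decode_inbox :: "msg set \<Rightarrow> nat \<Rightarrow> inbox \<Rightarrow> nat \<Rightarrow> msg option" where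
  "decode_inbox A b ib w = map_option (inv_into A (bit_coding A b)) (ib w)"

text \<open>Behaviours in the model are functions of the inbox history, so the round number and the
  state are recomputed from it.\<close>

definition replay :: "('k, 's, 'o) machine \<Rightarrow> msg set \<Rightarrow> nat \<Rightarrow> 'k \<Rightarrow> inbox list \<Rightarrow> nat \<times> 's" where
  "replay M A b k h = foldl (\<lambda>(r, st) ib. (Suc r, step M k r st (decode_inbox A b ib))) (0, ini M k) h"

text \<open>The membership test bounds the message length on every tape and history, also on those
  for which the computation goes wrong.\<close>

definition machine_send :: "('k, 's, 'o) machine \<Rightarrow> (linput \<Rightarrow> msg set) \<Rightarrow> (linput \<Rightarrow> nat) \<Rightarrow>
    (linput \<Rightarrow> tape \<Rightarrow> 'k) \<Rightarrow> send_fun" where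
  "machine_send M A b k0 = (\<lambda>i w h v. case replay M (A i) (b i) (k0 i w) h of (r, st) \<Rightarrow>
     (case bcast M (k0 i w) r st of None \<Rightarrow> None
      | Some m \<Rightarrow> if m \<in> A i then Some (bit_coding (A i) (b i) m) else None))"

definition machine_out :: "('k, 's, enat) machine \<Rightarrow> (linput \<Rightarrow> msg set) \<Rightarrow> (linput \<Rightarrow> nat) \<Rightarrow>
    (linput \<Rightarrow> tape \<Rightarrow> 'k) \<Rightarrow> out_fun" where
  "machine_out M A b k0 = (\<lambda>i w h. case replay M (A i) (b i) (k0 i w) h of (r, st) \<Rightarrow> halt M (k0 i w) r st)"

lemma machine_send_length:
  assumes "\<And>i. finite (A i)" "\<And>i. card (A i) \<le> 2 ^ b i" "machine_send M A b k0 i w h v = Some m"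
  shows "length m = b i"
  using assms(3) bit_coding(2)[OF assms(1)[of i] assms(2)[of i]]
  by (auto simp: machine_send_def split: prod.splits option.splits if_splits)

text \<open>Decoding inverts encoding because all vertices of \<open>V\<close> share the code given
  by \<open>A0\<close> and \<open>b0\<close>, and because \<open>computes\<close> puts every message
  of the first \<open>T\<close> rounds into \<open>A0\<close>.\<close>

lemma replay_hist:
  assumes A: "\<And>i. finite (A i)" "\<And>i. card (A i) \<le> 2 ^ b i"
    and I: "\<And>u. u \<in> V \<Longrightarrow> A (I u) = A0 \<and> b (I u) = b0"
    and NV: "\<forall>u\<in>V. N u \<subseteq> V"
    and M: "computes N V A0 M K T K'"
    and K: "\<And>u. u \<in> V \<Longrightarrow> K u = k0 (I u) (\<omega> u)"
    and "r \<le> T" "u \<in> V"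
  shows "replay M A0 b0 (K u) (hist (machine_send M A b k0) I N \<omega> r u) = (r, run M N K r u)"
  using assms(7,8)
proof (induction r arbitrary: u)
  case 0
  then show ?case by (simp add: replay_def)
next
  case (Suc r)
  let ?s = "machine_send M A b k0"
  have dec: "decode_inbox A0 b0 (\<lambda>w. if w \<in> N u then ?s (I w) (\<omega> w) (hist ?s I N \<omega> r w) u else None)
    = (\<lambda>w. if w \<in> N u then bcast M (K w) r (run M N K r w) else None)"
  proof
    fix w
    show "decode_inbox A0 b0 (\<lambda>w. if w \<in> N u then ?s (I w) (\<omega> w) (hist ?s I N \<omega> r w) u else None) w
      = (if w \<in> N u then bcast M (K w) r (run M N K r w) else None)"
    proof (cases "w \<in> N u")
      case True
      then have w: "w \<in> V" using NV Suc by auto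
      have rep: "replay M A0 b0 (K w) (hist ?s I N \<omega> r w) = (r, run M N K r w)"
        using Suc w by simp
      have ok: "m \<in> A0" if "bcast M (K w) r (run M N K r w) = Some m" for m
        using computes_bcast[OF M w _ that] Suc.prems by simp
      have inj: "inj_on (bit_coding A0 b0) A0"
        using bit_coding(1)[OF A(1)[of "I w"] A(2)[of "I w"]] I[OF w] by simp
      have "?s (I w) (\<omega> w) (hist ?s I N \<omega> r w) u
        = map_option (bit_coding A0 b0) (bcast M (K w) r (run M N K r w))"
        using rep ok I[OF w] K[OF w] by (auto simp: machine_send_def split: option.splits)
      then show ?thesis using True ok inj
        by (cases "bcast M (K w) r (run M N K r w)") (auto simp: decode_inbox_def)
    qed (simp add: decode_inbox_def)
  qed
  have IH: "replay M A0 b0 (K u) (hist ?s I N \<omega> r u) = (r, run M N K r u)"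
    using Suc by simp
  show ?case using IH dec by (simp add: replay_def)
qed

lemma decides_machine:
  assumes A: "\<And>i. finite (A i)" "\<And>i. card (A i) \<le> 2 ^ b i"
    and I: "\<And>u. u \<in> V \<Longrightarrow> A (I u) = A0 \<and> b (I u) = b0"
    and NV: "\<forall>u\<in>V. N u \<subseteq> V"
    and M: "computes N V A0 M K T K'"
    and K: "\<And>u. u \<in> V \<Longrightarrow> K u = k0 (I u) (\<omega> u)"
    and "T \<le> T'" "u \<in> V"
  shows "decides (machine_send M A b k0) (machine_out M A b k0) I N \<omega> u T' (K' u)"
proof -
  have out: "machine_out M A b k0 (I u) (\<omega> u) (hist (machine_send M A b k0) I N \<omega> r u)
     = halt M (K u) r (run M N K r u)" if "r \<le> T" for r
    using replay_hist[of A b V I A0 b0 N M K T K' k0 \<omega> r u, OF A I NV M K that] \<open>u \<in> V\<close> I[of u] K[of u]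
    by (simp add: machine_out_def)
  show ?thesis unfolding decides_def
    using M \<open>u \<in> V\<close> \<open>T \<le> T'\<close> out by (intro exI[of _ T]) (auto simp: computes_def)
qed

subsection \<open>Flooding and wavefronts\<close>

text \<open>A pair qualifies only by beating every distance already sent for its token; a token is
  sent again when a shorter walk is discovered late.\<close>

definition candidates :: "(nat \<times> nat) set \<times> (nat \<times> nat) set \<Rightarrow> (nat \<times> nat) set" where
  "candidates st = {(d, e). (d, e) \<in> fst st \<and> (\<forall>d'. (d', e) \<in> snd st \<longrightarrow> d < d')}"

definition lex_less :: "nat \<times> nat \<Rightarrow> nat \<times> nat \<Rightarrow> bool" where
  "lex_less p q \<longleftrightarrow> fst p < fst q \<or> fst p = fst q \<and> snd p < snd q"

definition lex_least :: "(nat \<times> nat) set \<Rightarrow> (nat \<times> nat) option" where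
  "lex_least C = (if C = {} then None
     else let d = LEAST d. \<exists>e. (d, e) \<in> C in Some (d, LEAST e. (d, e) \<in> C))"

lemma lex_least_SomeD:
  assumes "lex_least C = Some p"
  shows "p \<in> C" "q \<in> C \<Longrightarrow> \<not> lex_less q p"
proof -
  define d where "d = (LEAST d. \<exists>e. (d, e) \<in> C)"
  define e where "e = (LEAST e. (d, e) \<in> C)"
  have C: "C \<noteq> {}" and p: "p = (d, e)"
    using assms by (auto simp: lex_least_def d_def e_def Let_def split: if_splits)
  then have "\<exists>d e. (d, e) \<in> C" by auto
  then have "\<exists>e. (d, e) \<in> C" unfolding d_def by (rule LeastI_ex)
  then have "(d, e) \<in> C" unfolding e_def by (rule LeastI_ex)
  then show "p \<in> C" using p by simp
  assume q: "q \<in> C"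
  obtain d' e' where q': "q = (d', e')" by (cases q)
  have 1: "d \<le> d'" unfolding d_def using q q' by (auto intro: Least_le)
  have 2: "e \<le> e'" if "d' = d" unfolding e_def using q q' that by (auto intro: Least_le)
  show "\<not> lex_less q p" using 1 2 p q' by (auto simp: lex_less_def)
qed

lemma lex_least_eq_None [simp]: "lex_least C = None \<longleftrightarrow> C = {}"
  by (simp add: lex_least_def Let_def)

text \<open>Pipelined breadth-first search for many tokens at once. Always sending the lexicographically
  least improving pair (distance, token) guarantees that a token at distance d is delayed only by the
  tokens preceding it, so that it is sent on after at most d + K rounds, where K is the number of tokens.\<close>

definition flood :: "('k \<Rightarrow> nat) \<Rightarrow> ('k \<Rightarrow> nat \<Rightarrow> bool) \<Rightarrow> ('k \<Rightarrow> nat set) \<Rightarrow>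
    ('k \<Rightarrow> (nat \<times> nat) set \<Rightarrow> 'l) \<Rightarrow> ('k, (nat \<times> nat) set \<times> (nat \<times> nat) set, 'l) machine" where
  "flood R F S upd = \<lparr>
     ini = (\<lambda>k. (Pair 0 ` S k, {})),
     bcast = (\<lambda>k r st. map_option (\<lambda>(d, e). d # list_decode e) (lex_least (candidates st))),
     step = (\<lambda>k r st ib.
       (fst st \<union> {(Suc d, list_encode ts) | w d ts. F k w \<and> ib w = Some (d # ts)},
        snd st \<union> set_option (lex_least (candidates st)))),
     halt = (\<lambda>k r st. if r = R k then Some (upd k (fst st)) else None)\<rparr>"

lemma flood_simps [simp]:
  "ini (flood R F S upd) k = (Pair 0 ` S k, {})"
  "bcast (flood R F S upd) k r st = map_option (\<lambda>(d, e). d # list_decode e) (lex_least (candidates st))"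
  "step (flood R F S upd) k r st ib =
     (fst st \<union> {(Suc d, list_encode ts) | w d ts. F k w \<and> ib w = Some (d # ts)},
      snd st \<union> set_option (lex_least (candidates st)))"
  "halt (flood R F S upd) k r st = (if r = R k then Some (upd k (fst st)) else None)"
  by (simp_all add: flood_def)

definition reaches :: "nat set \<Rightarrow> (nat \<Rightarrow> nat set) \<Rightarrow> (nat \<times> nat) set \<Rightarrow> nat \<Rightarrow> nat \<Rightarrow> nat \<Rightarrow> bool" where
  "reaches V S H d u e \<longleftrightarrow> (\<exists>w\<in>V. e \<in> S w \<and> (w, u) \<in> H ^^ d)"

lemma relpow_subset: "R \<subseteq> V \<times> V \<Longrightarrow> (x, y) \<in> R ^^ k \<Longrightarrow> x \<in> V \<Longrightarrow> y \<in> V"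
  by (induction k arbitrary: y) auto

text \<open>Tokens are numbers so that pairs can be ordered lexicographically; in a message the
  token is decoded to a list, which keeps the entries small. The relation \<open>H\<close> consists
  of the edges that receivers accept.\<close>

locale flooding =
  fixes N :: "nat \<Rightarrow> nat set" and V :: "nat set" and A :: "msg set" and K :: "nat \<Rightarrow> 'k"
    and R :: "'k \<Rightarrow> nat" and F :: "'k \<Rightarrow> nat \<Rightarrow> bool" and S :: "'k \<Rightarrow> nat set"
    and upd :: "'k \<Rightarrow> (nat \<times> nat) set \<Rightarrow> 'l" and H :: "(nat \<times> nat) set" and T :: nat
  assumes NV: "\<forall>u\<in>V. N u \<subseteq> V"
    and H: "\<And>u w. (w, u) \<in> H \<longleftrightarrow> u \<in> V \<and> w \<in> N u \<and> F (K u) w"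
    and R: "\<And>u. u \<in> V \<Longrightarrow> R (K u) = T"
    and fin: "finite (\<Union>u\<in>V. S (K u))"
    and A: "\<And>u d e. u \<in> V \<Longrightarrow> e \<in> S (K u) \<Longrightarrow> d \<le> T \<Longrightarrow> d # list_decode e \<in> A"
begin

abbreviation "state \<equiv> run (flood R F S upd) N K"
abbreviation "known r u \<equiv> fst (state r u)"
abbreviation "sent r u \<equiv> snd (state r u)"
abbreviation "tokens \<equiv> \<Union>u\<in>V. S (K u)"
abbreviation "at_dist \<equiv> reaches V (\<lambda>u. S (K u)) H"

lemma known_0: "known 0 u = Pair 0 ` S (K u)" and sent_0: "sent 0 u = {}"
  by simp_all

lemma H_V: "H \<subseteq> V \<times> V"
proof
  fix x assume "x \<in> H"
  then obtain w u where "x = (w, u)" "u \<in> V" "w \<in> N u" using H by (cases x) blast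
  then show "x \<in> V \<times> V" using NV by blast
qed

lemma known_Suc:
  assumes "u \<in> V"
  shows "known (Suc r) u = known r u \<union>
    {(Suc d, e) | w d e. (w, u) \<in> H \<and> lex_least (candidates (state r w)) = Some (d, e)}"
proof -
  have "{(Suc d, list_encode ts) | w d ts. F (K u) w \<and>
      (if w \<in> N u then map_option (\<lambda>(d, e). d # list_decode e) (lex_least (candidates (state r w))) else None)
        = Some (d # ts)}
    = {(Suc d, e) | w d e. (w, u) \<in> H \<and> lex_least (candidates (state r w)) = Some (d, e)}" (is "?L = ?R")
  proof (intro equalityI subsetI)
    fix x assume "x \<in> ?L"
    then obtain w d ts where x: "x = (Suc d, list_encode ts)" "F (K u) w" "w \<in> N u"
      "map_option (\<lambda>(d, e). d # list_decode e) (lex_least (candidates (state r w))) = Some (d # ts)"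
      by (auto split: if_splits)
    then obtain e where "lex_least (candidates (state r w)) = Some (d, e)" "list_decode e = ts"
      by auto
    then show "x \<in> ?R" using x assms H by force
  next
    fix x assume "x \<in> ?R"
    then obtain w d e where x: "x = (Suc d, e)" "(w, u) \<in> H" "lex_least (candidates (state r w)) = Some (d, e)"
      by auto
    then have "F (K u) w" "w \<in> N u" using H by blast+
    then show "x \<in> ?L" using x
      by (intro CollectI exI[of _ w] exI[of _ d] exI[of _ "list_decode e"]) simp
  qed
  then show ?thesis by (simp only: run.simps flood_simps fst_conv)
qed

lemma sent_Suc: "sent (Suc r) u = sent r u \<union> set_option (lex_least (candidates (state r u)))"
  by simp

lemma known_mono: "u \<in> V \<Longrightarrow> r \<le> r' \<Longrightarrow> known r u \<subseteq> known r' u"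
  by (induction r') (auto simp: known_Suc le_Suc_eq simp del: run.simps)

lemma sent_known: "u \<in> V \<Longrightarrow> sent r u \<subseteq> known r u"
proof (induction r)
  case 0
  then show ?case by (simp add: sent_0 del: run.simps)
next
  case (Suc r)
  have "set_option (lex_least (candidates (state r u))) \<subseteq> known r u"
    using lex_least_SomeD(1) by (fastforce simp: candidates_def)
  then show ?case using Suc unfolding sent_Suc known_Suc[OF Suc.prems] by auto
qed

lemma sent_forward: "u \<in> V \<Longrightarrow> (w, u) \<in> H \<Longrightarrow> (d, e) \<in> sent r w \<Longrightarrow> (Suc d, e) \<in> known r u"
proof (induction r)
  case 0
  then show ?case by (simp add: sent_0 del: run.simps)
next
  case (Suc r)
  show ?case
  proof (cases "(d, e) \<in> sent r w")
    case True
    then show ?thesis using Suc unfolding known_Suc[OF Suc.prems(1)] by auto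
  next
    case False
    then have "lex_least (candidates (state r w)) = Some (d, e)"
      using Suc.prems(3) unfolding sent_Suc by auto
    then show ?thesis using Suc unfolding known_Suc[OF Suc.prems(1)] by auto
  qed
qed

lemma known_sound: "u \<in> V \<Longrightarrow> (d, e) \<in> known r u \<Longrightarrow> d \<le> r \<and> at_dist d u e"
proof (induction r arbitrary: u d)
  case 0
  then show ?case unfolding known_0 reaches_def by auto
next
  case (Suc r)
  show ?case
  proof (cases "(d, e) \<in> known r u")
    case True
    then show ?thesis using Suc.IH[OF Suc.prems(1) True] by auto
  next
    case False
    then obtain w d' where w: "d = Suc d'" "(w, u) \<in> H" "lex_least (candidates (state r w)) = Some (d', e)"
      using Suc.prems(2) unfolding known_Suc[OF Suc.prems(1)] by auto
    have wV: "w \<in> V" using w(2) H_V by auto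
    have "(d', e) \<in> known r w" using lex_least_SomeD(1)[OF w(3)] by (auto simp: candidates_def)
    then have "d' \<le> r \<and> at_dist d' w e" by (rule Suc.IH[OF wV])
    then show ?thesis using w(1,2) by (auto simp: reaches_def intro!: relpow_Suc_I)
  qed
qed

definition dist :: "nat \<Rightarrow> nat \<Rightarrow> nat" where
  "dist u e = (LEAST d. at_dist d u e)"

text \<open>The tokens that have precedence over \<open>e\<close> at \<open>u\<close> when ordered
  by true distance and then by token; their number bounds the delay of \<open>e\<close> at
  \<open>u\<close>.\<close>

definition closer :: "nat \<Rightarrow> nat \<Rightarrow> nat set" where
  "closer u e = {e'. (\<exists>d. at_dist d u e') \<and> lex_less (dist u e', e') (dist u e, e)}"

lemma dist_least: "at_dist d u e \<Longrightarrow> at_dist (dist u e) u e \<and> dist u e \<le> d"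
  unfolding dist_def by (auto intro: LeastI Least_le)

lemma closer_tokens: "closer u e \<subseteq> tokens"
  by (auto simp: closer_def reaches_def)

lemma card_closer: "at_dist d u e \<Longrightarrow> card (closer u e) < card tokens"
proof -
  assume "at_dist d u e"
  then have "e \<in> tokens" by (auto simp: reaches_def)
  moreover have "e \<notin> closer u e" by (auto simp: closer_def lex_less_def)
  ultimately have "closer u e \<subset> tokens" using closer_tokens by blast
  then show ?thesis using fin by (rule psubset_card_mono[rotated])
qed

text \<open>Strong induction on the round. Let \<open>w\<close> precede \<open>u\<close> on a
  shortest walk of \<open>e\<close>. Distances grow by at most one from \<open>w\<close> to
  \<open>u\<close>, so every token preceding \<open>e\<close> at \<open>w\<close> also precedes it
  at \<open>u\<close>; hence \<open>w\<close> has sent \<open>e\<close> in time. All tokens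
  preceding \<open>e\<close> at \<open>u\<close> have been sent before round \<open>m\<close>, so
  nothing can hold up \<open>e\<close> any longer.\<close>

lemma sent_by_rank:
  assumes "u \<in> V" "at_dist d u e" "dist u e + card (closer u e) \<le> m"
  shows "(dist u e, e) \<in> known m u \<and> (dist u e, e) \<in> sent (Suc m) u"
  using assms
proof (induction m arbitrary: u d e rule: less_induct)
  case (less m)
  define D where "D = dist u e"
  have D: "at_dist D u e" using dist_least[OF less.prems(2)] by (simp add: D_def)
  have known: "(D, e) \<in> known m u"
  proof (cases D)
    case 0
    then have "(D, e) \<in> known 0 u" unfolding known_0 using D by (auto simp: reaches_def)
    then show ?thesis using known_mono[OF less.prems(1), of 0 m] by auto
  next
    case (Suc D')
    then obtain x w where x: "x \<in> V" "e \<in> S (K x)" "(x, w) \<in> H ^^ D'" "(w, u) \<in> H"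
      using D by (auto simp: reaches_def)
    have w: "w \<in> V" using x(4) H_V by auto
    have aw: "at_dist D' w e" using x by (auto simp: reaches_def)
    have step: "at_dist (Suc k) u f" if "at_dist k w f" for k f
      using that x(4) by (auto simp: reaches_def)
    have dw: "dist w e = D'"
    proof (rule antisym)
      show "dist w e \<le> D'" using dist_least[OF aw] by simp
      have "at_dist (Suc (dist w e)) u e" using step dist_least[OF aw] by blast
      then have "D \<le> Suc (dist w e)" unfolding D_def using dist_least by blast
      then show "D' \<le> dist w e" using Suc by simp
    qed
    have "closer w e \<subseteq> closer u e"
    proof
      fix f assume f: "f \<in> closer w e"
      then obtain k where k: "at_dist k w f" by (auto simp: closer_def)
      have "at_dist (Suc (dist w f)) u f" using step dist_least[OF k] by blast
      then have "dist u f \<le> Suc (dist w f)" "\<exists>d. at_dist d u f" using dist_least by blast+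
      then show "f \<in> closer u e" using f Suc dw D_def by (auto simp: closer_def lex_less_def)
    qed
    then have "card (closer w e) \<le> card (closer u e)"
      using card_mono finite_subset[OF closer_tokens fin] by blast
    then have "dist w e + card (closer w e) \<le> m - 1" "m - 1 < m"
      using less.prems(3) dw Suc D_def by auto
    then have "(D', e) \<in> sent (Suc (m - 1)) w"
      using less.IH[of "m - 1" w D' e] w aw dw by simp
    then have "(D', e) \<in> sent m w" using \<open>m - 1 < m\<close> by simp
    then show ?thesis using sent_forward[OF less.prems(1) x(4)] Suc by simp
  qed
  have before: "(dist u f, f) \<in> sent m u" if f: "f \<in> closer u e" for f
  proof -
    obtain k where k: "at_dist k u f" using f by (auto simp: closer_def)
    have "closer u f \<subset> closer u e" using f by (auto simp: closer_def lex_less_def)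
    then have "card (closer u f) < card (closer u e)"
      using psubset_card_mono finite_subset[OF closer_tokens fin] by blast
    moreover have "dist u f \<le> dist u e" using f by (auto simp: closer_def lex_less_def)
    ultimately have "dist u f + card (closer u f) \<le> m - 1" "m - 1 < m" using less.prems(3) by auto
    then have "(dist u f, f) \<in> sent (Suc (m - 1)) u" using less.IH[of "m - 1" u k f] k less.prems(1) by simp
    then show ?thesis using \<open>m - 1 < m\<close> by simp
  qed
  have "(D, e) \<in> sent (Suc m) u"
  proof (cases "(D, e) \<in> sent m u")
    case True
    then show ?thesis unfolding sent_Suc by simp
  next
    case False
    have cand: "(D, e) \<in> candidates (state m u)"
    proof -
      have "D < d'" if "(d', e) \<in> sent m u" for d'
      proof -
        have "at_dist d' u e" using known_sound[OF less.prems(1)] sent_known[OF less.prems(1)] that by blast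
        then have "D \<le> d'" unfolding D_def using dist_least by blast
        moreover have "d' \<noteq> D" using that False by auto
        ultimately show ?thesis by simp
      qed
      then show ?thesis using known by (auto simp: candidates_def)
    qed
    then obtain p where p: "lex_least (candidates (state m u)) = Some p"
      by (cases "lex_least (candidates (state m u))") auto
    obtain k f where kf: "p = (k, f)" by (cases p)
    have pc: "(k, f) \<in> candidates (state m u)" using lex_least_SomeD(1)[OF p] kf by simp
    have nl: "\<not> lex_less (D, e) (k, f)" using lex_least_SomeD(2)[OF p cand] kf by simp
    have kn: "(k, f) \<in> known m u" using pc by (auto simp: candidates_def)
    have ak: "at_dist k u f" using known_sound[OF less.prems(1) kn] by simp
    have le: "dist u f \<le> k" using dist_least[OF ak] by simp
    \<comment> \<open>A smaller candidate would belong to a token with precedence. The true distance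
      of that token has been sent already, so the candidate is no improvement.\<close>
    have "(k, f) = (D, e)"
    proof (rule ccontr)
      assume ne: "(k, f) \<noteq> (D, e)"
      have "lex_less (k, f) (D, e)" using nl ne by (auto simp: lex_less_def)
      then have "lex_less (dist u f, f) (D, e)" using le by (auto simp: lex_less_def)
      then have "f \<in> closer u e" using ak D_def by (auto simp: closer_def)
      then have "(dist u f, f) \<in> sent m u" by (rule before)
      then show False using pc le by (auto simp: candidates_def)
    qed
    then show ?thesis unfolding sent_Suc p kf by simp
  qed
  then show ?case using known D_def by simp
qed

lemma known_complete:
  assumes "u \<in> V" "at_dist d u e" "d + card tokens \<le> r"
  shows "\<exists>d'\<le>d. (d', e) \<in> known r u"
proof -
  have "dist u e \<le> d" using dist_least[OF assms(2)] by simp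
  then have "dist u e + card (closer u e) \<le> r" using card_closer[OF assms(2)] assms(3) by simp
  then show ?thesis using sent_by_rank[OF assms(1,2)] \<open>dist u e \<le> d\<close> by blast
qed

lemma computes_known: "computes N V A (flood R F S upd) K T (\<lambda>u. upd (K u) (known T u))"
proof -
  have "m \<in> A" if *: "u \<in> V" "r < T" "bcast (flood R F S upd) (K u) r (state r u) = Some m" for u r m
  proof -
    obtain d e where de: "lex_least (candidates (state r u)) = Some (d, e)" "m = d # list_decode e"
      using *(3) by auto
    have "(d, e) \<in> known r u" using lex_least_SomeD(1)[OF de(1)] by (auto simp: candidates_def)
    then have "d \<le> r \<and> at_dist d u e" by (rule known_sound[OF *(1)])
    then show ?thesis using A de * by (auto simp: reaches_def)
  qed
  then show ?thesis using R unfolding computes_def by (auto simp del: run.simps)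
qed

lemma flood_correct:
  obtains Q where "computes N V A (flood R F S upd) K T (\<lambda>u. upd (K u) (Q u))"
    and "\<And>u d e. u \<in> V \<Longrightarrow> (d, e) \<in> Q u \<Longrightarrow> d \<le> T \<and> at_dist d u e"
    and "\<And>u d e. u \<in> V \<Longrightarrow> at_dist d u e \<Longrightarrow> d + card tokens \<le> T \<Longrightarrow> \<exists>d'\<le>d. (d', e) \<in> Q u"
  by (rule that[of "known T", OF computes_known known_sound known_complete])

end

section \<open>Waves: values that move one edge per round without queueing\<close>

text \<open>Values never wait: what arrives in a round is merged with the vertex's own value for
  that round by a minimum and passed on at once, with \<infinity> standing for silence. Entry
  \<open>r\<close> of the state is what arrived in round \<open>r\<close>; all entries are kept
  because the update may read the whole time series.\<close>

definition wave :: "('k \<Rightarrow> nat) \<Rightarrow> ('k \<Rightarrow> nat \<Rightarrow> bool) \<Rightarrow> ('k \<Rightarrow> nat \<Rightarrow> enat) \<Rightarrow>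
    ('k \<Rightarrow> (nat \<Rightarrow> enat) \<Rightarrow> 'l) \<Rightarrow> ('k, nat \<Rightarrow> enat, 'l) machine" where
  "wave R F own upd = \<lparr>
     ini = (\<lambda>k r. \<infinity>),
     bcast = (\<lambda>k r st. case min (own k r) (st r) of enat a \<Rightarrow> Some [a] | \<infinity> \<Rightarrow> None),
     step = (\<lambda>k r st ib. st(Suc r := (INF w\<in>{w. F k w}. case ib w of Some [a] \<Rightarrow> enat a | _ \<Rightarrow> \<infinity>))),
     halt = (\<lambda>k r st. if r = R k then Some (upd k st) else None)\<rparr>"

lemma wave_simps [simp]:
  "ini (wave R F own upd) k = (\<lambda>r. \<infinity>)"
  "bcast (wave R F own upd) k r st = (case min (own k r) (st r) of enat a \<Rightarrow> Some [a] | \<infinity> \<Rightarrow> None)"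
  "step (wave R F own upd) k r st ib =
     st(Suc r := (INF w\<in>{w. F k w}. case ib w of Some [a] \<Rightarrow> enat a | _ \<Rightarrow> \<infinity>))"
  "halt (wave R F own upd) k r st = (if r = R k then Some (upd k st) else None)"
  by (simp_all add: wave_def)

locale wavefront =
  fixes N :: "nat \<Rightarrow> nat set" and V :: "nat set" and A :: "msg set" and K :: "nat \<Rightarrow> 'k"
    and R :: "'k \<Rightarrow> nat" and F :: "'k \<Rightarrow> nat \<Rightarrow> bool" and own :: "'k \<Rightarrow> nat \<Rightarrow> enat"
    and upd :: "'k \<Rightarrow> (nat \<Rightarrow> enat) \<Rightarrow> 'l" and H :: "(nat \<times> nat) set" and T :: nat
  assumes NV: "\<forall>u\<in>V. N u \<subseteq> V"
    and H: "\<And>u w. (w, u) \<in> H \<longleftrightarrow> u \<in> V \<and> w \<in> N u \<and> F (K u) w"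
    and R: "\<And>u. u \<in> V \<Longrightarrow> R (K u) = T"
    and A: "\<And>u r a. u \<in> V \<Longrightarrow> r < T \<Longrightarrow> own (K u) r = enat a \<Longrightarrow> [a] \<in> A"
begin

abbreviation "state \<equiv> run (wave R F own upd) N K"

lemma H_V: "H \<subseteq> V \<times> V"
proof
  fix x assume "x \<in> H"
  then obtain w u where "x = (w, u)" "u \<in> V" "w \<in> N u" using H by (cases x) blast
  then show "x \<in> V \<times> V" using NV by blast
qed

lemma state_stable: "q \<le> r \<Longrightarrow> state r u q = state q u q"
  by (induction r) (auto simp: le_Suc_eq)

lemma state_Suc:
  assumes "u \<in> V"
  shows "state (Suc r) u (Suc r) = (INF w\<in>{w. (w, u) \<in> H}. min (own (K w) r) (state r w r))"
proof -
  have "state (Suc r) u (Suc r) = (INF w\<in>{w. F (K u) w}.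
     case (if w \<in> N u then bcast (wave R F own upd) (K w) r (state r w) else None) of
       Some [a] \<Rightarrow> enat a | _ \<Rightarrow> \<infinity>)"
    by (simp del: wave_simps(2))
  also have "\<dots> = (INF w\<in>{w. F (K u) w}. if w \<in> N u then min (own (K w) r) (state r w r) else \<infinity>)"
    by (rule INF_cong) (auto simp del: run.simps split: enat.splits)
  also have "\<dots> = (INF w\<in>{w. (w, u) \<in> H}. min (own (K w) r) (state r w r))"
  proof (rule antisym)
    show "(INF w\<in>{w. F (K u) w}. if w \<in> N u then min (own (K w) r) (state r w r) else \<infinity>)
      \<le> (INF w\<in>{w. (w, u) \<in> H}. min (own (K w) r) (state r w r))"
      using H by (intro INF_greatest INF_lower2) auto
    show "(INF w\<in>{w. (w, u) \<in> H}. min (own (K w) r) (state r w r))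
      \<le> (INF w\<in>{w. F (K u) w}. if w \<in> N u then min (own (K w) r) (state r w r) else \<infinity>)"
    proof (rule INF_greatest)
      fix w assume w: "w \<in> {w. F (K u) w}"
      show "(INF w\<in>{w. (w, u) \<in> H}. min (own (K w) r) (state r w r))
        \<le> (if w \<in> N u then min (own (K w) r) (state r w r) else \<infinity>)"
      proof (cases "w \<in> N u")
        case True
        then have "(w, u) \<in> H" using w H assms by blast
        then show ?thesis unfolding if_P[OF True] by (intro INF_lower) simp
      qed simp
    qed
  qed
  finally show ?thesis .
qed

text \<open>The value that \<open>w\<close> injects in round \<open>r - k\<close> has crossed
  \<open>k\<close> edges by round \<open>r\<close>, and minima met on the way can only lower
  it.\<close>

lemma state_upper: "u \<in> V \<Longrightarrow> (w, u) \<in> H ^^ k \<Longrightarrow> 0 < k \<Longrightarrow> k \<le> r \<Longrightarrow> state r u r \<le> own (K w) (r - k)"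
proof (induction r arbitrary: u k)
  case 0
  then show ?case by simp
next
  case (Suc r)
  obtain k' where k: "k = Suc k'" using Suc.prems(3) by (cases k) auto
  then obtain x where x: "(w, x) \<in> H ^^ k'" "(x, u) \<in> H" using Suc.prems(2) by auto
  have xV: "x \<in> V" using x H_V by auto
  have "min (own (K x) r) (state r x r) \<le> own (K w) (r - k')"
  proof (cases "k' = 0")
    case True
    then show ?thesis using x by simp
  next
    case False
    then have "state r x r \<le> own (K w) (r - k')" using Suc.IH[OF xV x(1)] Suc.prems(4) k by simp
    then show ?thesis by (simp add: min.coboundedI2)
  qed
  moreover have "state (Suc r) u (Suc r) \<le> min (own (K x) r) (state r x r)"
    unfolding state_Suc[OF Suc.prems(1)] using x(2) by (intro INF_lower) simp
  ultimately have "state (Suc r) u (Suc r) \<le> own (K w) (r - k')" by (rule order_trans[rotated])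
  then show ?case using k by (simp del: run.simps)
qed

text \<open>A finite value is traced back, along edges where the minimum is attained, to the vertex
  that injected it. At least one edge is crossed, since own values enter only on being sent.\<close>

lemma state_attained: "u \<in> V \<Longrightarrow> state r u r = enat a \<Longrightarrow>
   \<exists>w k. w \<in> V \<and> (w, u) \<in> H ^^ k \<and> 0 < k \<and> k \<le> r \<and> own (K w) (r - k) = enat a"
proof (induction r arbitrary: u)
  case 0
  then show ?case by simp
next
  case (Suc r)
  let ?f = "\<lambda>w. min (own (K w) r) (state r w r)"
  have "{w. (w, u) \<in> H} \<noteq> {}" 
  proof
    assume e: "{w. (w, u) \<in> H} = {}"
    show False using Suc.prems(2) unfolding state_Suc[OF Suc.prems(1)] e by (simp add: top_enat_def)
  qed
  then obtain x0 where "?f x0 \<in> ?f ` {w. (w, u) \<in> H}" by blast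
  then have "(INF w\<in>{w. (w, u) \<in> H}. ?f w) \<in> ?f ` {w. (w, u) \<in> H}"
    by (rule wellorder_InfI)
  then have "enat a \<in> ?f ` {w. (w, u) \<in> H}"
    using state_Suc[OF Suc.prems(1), of r] Suc.prems(2) by simp
  then obtain x where "enat a = ?f x" "x \<in> {w. (w, u) \<in> H}" by (rule imageE)
  then have x: "(x, u) \<in> H" "?f x = enat a" by (simp_all only: mem_Collect_eq)
  have xV: "x \<in> V" using x H_V by auto
  show ?case
  proof (cases "own (K x) r = enat a")
    case True
    then show ?thesis using x xV by (intro exI[of _ x] exI[of _ 1]) auto
  next
    case False
    then have "state r x r = enat a" using x(2) by (auto simp: min_def split: if_splits)
    then obtain w k where "w \<in> V" "(w, x) \<in> H ^^ k" "k \<le> r" "own (K w) (r - k) = enat a"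
      using Suc.IH[OF xV] by blast
    then show ?thesis using x by (intro exI[of _ w] exI[of _ "Suc k"]) auto
  qed
qed

lemma wave_correct:
  obtains Q where "computes N V A (wave R F own upd) K T (\<lambda>u. upd (K u) (Q u))"
    and "\<And>u w k r. u \<in> V \<Longrightarrow> (w, u) \<in> H ^^ k \<Longrightarrow> 0 < k \<Longrightarrow> k \<le> r \<Longrightarrow> r \<le> T \<Longrightarrow> Q u r \<le> own (K w) (r - k)"
    and "\<And>u r a. u \<in> V \<Longrightarrow> r \<le> T \<Longrightarrow> Q u r = enat a \<Longrightarrow>
      \<exists>w k. w \<in> V \<and> (w, u) \<in> H ^^ k \<and> 0 < k \<and> k \<le> r \<and> own (K w) (r - k) = enat a"
proof -
  have val: "[a] \<in> A" if *: "u \<in> V" "r < T" "min (own (K u) r) (state r u r) = enat a" for u r a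
  proof (cases "own (K u) r = enat a")
    case True
    then show ?thesis using A * by blast
  next
    case False
    then have "state r u r = enat a" using *(3) by (auto simp: min_def split: if_splits)
    then obtain w k where w: "w \<in> V" "k \<le> r" "own (K w) (r - k) = enat a"
      using state_attained[OF *(1)] by blast
    then show ?thesis using A[of w "r - k" a] *(2) by simp
  qed
  have "m \<in> A" if *: "u \<in> V" "r < T" "bcast (wave R F own upd) (K u) r (state r u) = Some m" for u r m
    using *(3) val[OF *(1,2)] by (auto simp del: run.simps split: enat.splits)
  then have "computes N V A (wave R F own upd) K T (\<lambda>u. upd (K u) (state T u))"
    using R unfolding computes_def by (auto simp del: run.simps)
  then show ?thesis
  proof (rule that[of "state T"])
    show "state T u r \<le> own (K w) (r - k)"
      if "u \<in> V" "(w, u) \<in> H ^^ k" "0 < k" "k \<le> r" "r \<le> T" for u w k r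
      unfolding state_stable[OF that(5)] using that by (intro state_upper)
    show "\<exists>w k. w \<in> V \<and> (w, u) \<in> H ^^ k \<and> 0 < k \<and> k \<le> r \<and> own (K w) (r - k) = enat a"
      if "u \<in> V" "r \<le> T" "state T u r = enat a" for u r a
      using that(3) unfolding state_stable[OF that(2)] by (rule state_attained[OF that(1)])
  qed
qed

end

subsection \<open>The eccentricity of the source\<close>

lemma sym_relpow: "sym R \<Longrightarrow> (x, y) \<in> R ^^ k \<Longrightarrow> (y, x) \<in> R ^^ k"
proof (induction k arbitrary: y)
  case (Suc k)
  then obtain z where "(x, z) \<in> R ^^ k" "(z, y) \<in> R" by auto
  then have "(y, z) \<in> R" "(z, x) \<in> R ^^ k" using Suc by (auto dest: symD)
  then show ?case by (rule relpow_Suc_I2)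
qed simp

text \<open>Computes the eccentricity e of the source.  All nodes flood the largest distance from the source
  they have heard of; as news of a node at distance q reaches the source after 2q rounds, the first
  q for which no such news has arrived by then is e + 1.\<close>

definition census :: "('k \<Rightarrow> bool) \<Rightarrow> ('k \<Rightarrow> nat \<Rightarrow> 'l) \<Rightarrow> ('k, bool \<times> nat \<times> nat option, 'l) machine" where
  "census is_src upd = \<lparr>
     ini = (\<lambda>k. (is_src k, 0, None)),
     bcast = (\<lambda>k r (b, m, a). if b then Some (m # (case a of None \<Rightarrow> [] | Some e \<Rightarrow> [e])) else None),
     step = (\<lambda>k r (b, m, a) ib.
       let m' = Max (insert (if b then m else Suc r) {x. \<exists>w xs. ib w = Some (x # xs)}) in
       (b \<or> (\<exists>w. ib w \<noteq> None), m',
        case a of Some e \<Rightarrow> Some e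
        | None \<Rightarrow> if \<exists>w x e. ib w = Some [x, e] then Some (SOME e. \<exists>w x. ib w = Some [x, e])
            else if is_src k \<and> even (Suc r) \<and> m' < Suc r div 2 then Some (Suc r div 2 - 1) else None)),
     halt = (\<lambda>k r (b, m, a). case a of None \<Rightarrow> None | Some e \<Rightarrow> if r = 4 * e + 4 then Some (upd k e) else None)\<rparr>"

lemma census_simps [simp]:
  "ini (census is_src upd) k = (is_src k, 0, None)"
  "bcast (census is_src upd) k r (b, m, a) =
     (if b then Some (m # (case a of None \<Rightarrow> [] | Some e \<Rightarrow> [e])) else None)"
  "halt (census is_src upd) k r (b, m, a) =
     (case a of None \<Rightarrow> None | Some e \<Rightarrow> if r = 4 * e + 4 then Some (upd k e) else None)"
  "step (census is_src upd) k r (b, m, a) ib =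
     (let m' = Max (insert (if b then m else Suc r) {x. \<exists>w xs. ib w = Some (x # xs)}) in
       (b \<or> (\<exists>w. ib w \<noteq> None), m',
        case a of Some e \<Rightarrow> Some e
        | None \<Rightarrow> if \<exists>w x e. ib w = Some [x, e] then Some (SOME e. \<exists>w x. ib w = Some [x, e])
            else if is_src k \<and> even (Suc r) \<and> m' < Suc r div 2 then Some (Suc r div 2 - 1) else None))"
  by (simp_all add: census_def)

locale census_run =
  fixes N :: "nat \<Rightarrow> nat set" and V :: "nat set" and A :: "msg set" and K :: "nat \<Rightarrow> 'k"
    and is_src :: "'k \<Rightarrow> bool" and upd :: "'k \<Rightarrow> nat \<Rightarrow> 'l" and U :: "(nat \<times> nat) set" and s :: nat
  assumes NV: "\<forall>u\<in>V. N u \<subseteq> V" and finV: "finite V" and sV: "s \<in> V"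
    and U: "\<And>u w. (w, u) \<in> U \<longleftrightarrow> u \<in> V \<and> w \<in> N u"
    and symU: "sym U"
    and src: "\<And>u. u \<in> V \<Longrightarrow> is_src (K u) \<longleftrightarrow> u = s"
    and conn: "\<And>u. u \<in> V \<Longrightarrow> \<exists>k. (s, u) \<in> U ^^ k"
    and A: "\<And>x y. x < card V \<Longrightarrow> y < card V \<Longrightarrow> [x] \<in> A \<and> [x, y] \<in> A"
begin

definition depth :: "nat \<Rightarrow> nat" where
  "depth u = (LEAST k. (s, u) \<in> U ^^ k)"

definition height :: nat where
  "height = Max (depth ` V)"

lemma U_V: "U \<subseteq> V \<times> V"
proof
  fix x assume "x \<in> U"
  then obtain w u where "x = (w, u)" "u \<in> V" "w \<in> N u" using U by (cases x) blast
  then show "x \<in> V \<times> V" using NV by blast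
qed

lemma depth_walk: "u \<in> V \<Longrightarrow> (s, u) \<in> U ^^ depth u"
  unfolding depth_def by (rule LeastI_ex) (rule conn)

lemma depth_le: "(s, u) \<in> U ^^ k \<Longrightarrow> depth u \<le> k"
  unfolding depth_def by (rule Least_le)

lemma depth_s: "depth s = 0"
  using depth_le[of s 0] by simp

lemma depth_edge: "w \<in> V \<Longrightarrow> (w, u) \<in> U \<Longrightarrow> depth u \<le> Suc (depth w)"
  by (rule depth_le, rule relpow_Suc_I[OF depth_walk])

lemma depth_walk_le: "w \<in> V \<Longrightarrow> (w, u) \<in> U ^^ k \<Longrightarrow> depth u \<le> depth w + k"
  by (rule depth_le, unfold relpow_add, rule relcompI[OF depth_walk])

lemma depth_pred:
  assumes "u \<in> V" "depth u = Suc d"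
  obtains w where "w \<in> V" "(w, u) \<in> U" "depth w = d"
proof -
  obtain w where w: "(s, w) \<in> U ^^ d" "(w, u) \<in> U" using depth_walk[OF assms(1)] assms(2) by auto
  have wV: "w \<in> V" using w U_V by auto
  have "depth w = d" using depth_le[OF w(1)] depth_edge[OF wV w(2)] assms(2) by simp
  then show ?thesis using that wV w by blast
qed

lemma depth_height: "u \<in> V \<Longrightarrow> depth u \<le> height"
  unfolding height_def using finV by (intro Max_ge) auto

text \<open>Each vertex other than the source has a predecessor one level lower, so no level up to
  \<open>height\<close> is empty. Hence the first level of which the source hears nothing is the one
  after \<open>height\<close>.\<close>

lemma ex_depth: "q \<le> height \<Longrightarrow> \<exists>u\<in>V. depth u = q"
proof -
  have "\<exists>u\<in>V. depth u = height"
    unfolding height_def using Max_in[of "depth ` V"] finV sV by fastforce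
  moreover have "\<exists>u\<in>V. depth u = d" if "\<exists>u\<in>V. depth u = Suc d" for d
    using that depth_pred by metis
  ultimately have "\<exists>u\<in>V. depth u = height - k" if "k \<le> height" for k
    using that by (induction k) (auto simp: Suc_diff_Suc[symmetric])
  from this[of "height - q"] show "q \<le> height \<Longrightarrow> ?thesis" by simp
qed

lemma height_less: "height < card V"
proof -
  have "{0..height} \<subseteq> depth ` V"
  proof
    fix q assume "q \<in> {0..height}"
    then obtain u where "u \<in> V" "depth u = q" using ex_depth by auto
    then show "q \<in> depth ` V" by blast
  qed
  then have "card {0..height} \<le> card (depth ` V)" using finV by (intro card_mono) auto
  also have "\<dots> \<le> card V" using finV by (rule card_image_le)
  finally show ?thesis by simp
qed

abbreviation "state \<equiv> run (census is_src upd) N K"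
abbreviation "reached r u \<equiv> fst (state r u)"
abbreviation "deepest r u \<equiv> fst (snd (state r u))"
abbreviation "verdict r u \<equiv> snd (snd (state r u))"
abbreviation "message r w \<equiv> (if reached r w
  then Some (deepest r w # (case verdict r w of None \<Rightarrow> [] | Some e \<Rightarrow> [e])) else None)"

lemma bcast_message: "bcast (census is_src upd) (K w) r (state r w) = message r w"
  by (cases "state r w") simp

declare run.simps [simp del]

abbreviation "inbox_at r u \<equiv> (\<lambda>w. if w \<in> N u then message r w else None)"

lemma state_Suc:
  "state (Suc r) u = (reached r u \<or> (\<exists>w. inbox_at r u w \<noteq> None),
     Max (insert (if reached r u then deepest r u else Suc r) {x. \<exists>w xs. inbox_at r u w = Some (x # xs)}),
     case verdict r u of Some e \<Rightarrow> Some e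
     | None \<Rightarrow> if \<exists>w x e. inbox_at r u w = Some [x, e] then Some (SOME e. \<exists>w x. inbox_at r u w = Some [x, e])
         else if is_src (K u) \<and> even (Suc r) \<and>
           Max (insert (if reached r u then deepest r u else Suc r) {x. \<exists>w xs. inbox_at r u w = Some (x # xs)})
             < Suc r div 2
         then Some (Suc r div 2 - 1) else None)"
proof -
  obtain b m a where st: "state r u = (b, m, a)" by (metis prod_cases3)
  show ?thesis by (simp only: run.simps(2) bcast_message st census_simps Let_def fst_conv snd_conv)
qed

lemma reached_Suc: "reached (Suc r) u \<longleftrightarrow> reached r u \<or> (\<exists>w\<in>N u. reached r w)"
proof -
  have "(\<exists>w. inbox_at r u w \<noteq> None) \<longleftrightarrow> (\<exists>w\<in>N u. reached r w)" by (auto split: if_splits)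
  then show ?thesis unfolding state_Suc fst_conv by (simp only:)
qed

lemma deepest_Suc:
  "deepest (Suc r) u = Max (insert (if reached r u then deepest r u else Suc r)
     {deepest r w | w. w \<in> N u \<and> reached r w})"
proof -
  have "{x. \<exists>w xs. inbox_at r u w = Some (x # xs)} = {deepest r w | w. w \<in> N u \<and> reached r w}"
    by (auto split: if_splits)
  then show ?thesis unfolding state_Suc fst_conv snd_conv by (simp only:)
qed

lemma verdict_Suc:
  "verdict (Suc r) u = (case verdict r u of Some e \<Rightarrow> Some e
     | None \<Rightarrow> if \<exists>w\<in>N u. reached r w \<and> verdict r w \<noteq> None
         then Some (SOME e. \<exists>w\<in>N u. reached r w \<and> verdict r w = Some e)
       else if is_src (K u) \<and> even (Suc r) \<and> deepest (Suc r) u < Suc r div 2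
         then Some (Suc r div 2 - 1) else None)"
proof -
  have *: "(\<exists>w x. inbox_at r u w = Some [x, e]) \<longleftrightarrow> (\<exists>w\<in>N u. reached r w \<and> verdict r w = Some e)" for e
    by (auto split: option.splits if_splits)
  have "(\<exists>w x e. inbox_at r u w = Some [x, e]) \<longleftrightarrow> (\<exists>e w x. inbox_at r u w = Some [x, e])"
    by blast
  also have "\<dots> \<longleftrightarrow> (\<exists>w\<in>N u. reached r w \<and> verdict r w \<noteq> None)"
    unfolding * by auto
  finally show ?thesis unfolding state_Suc fst_conv snd_conv * by (simp only:)
qed

lemma case_verdict:
  "(case v of Some e \<Rightarrow> Some e | None \<Rightarrow> if p then Some x else if q then Some y else None) = Some a \<Longrightarrow>
     v = Some a \<or> p \<and> a = x \<or> v = None \<and> q \<and> a = y"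
  by (auto split: option.splits if_splits)

lemma state_0: "reached 0 u = is_src (K u)" "deepest 0 u = 0" "verdict 0 u = None"
  by (simp_all add: run.simps)

lemma reached_iff: "u \<in> V \<Longrightarrow> reached r u \<longleftrightarrow> depth u \<le> r"
proof (induction r arbitrary: u)
  case 0
  then show ?case using src[of u] depth_s depth_walk[of u] by (auto simp: state_0)
next
  case (Suc r)
  have IH: "reached r w \<longleftrightarrow> depth w \<le> r" if "w \<in> N u" for w
    using that Suc NV by blast
  have "reached (Suc r) u \<longleftrightarrow> depth u \<le> r \<or> (\<exists>w\<in>N u. depth w \<le> r)"
    using reached_Suc IH Suc by auto
  also have "\<dots> \<longleftrightarrow> depth u \<le> Suc r"
  proof
    assume "depth u \<le> r \<or> (\<exists>w\<in>N u. depth w \<le> r)"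
    then show "depth u \<le> Suc r"
    proof
      assume "\<exists>w\<in>N u. depth w \<le> r"
      then obtain w where w: "w \<in> N u" "depth w \<le> r" by blast
      then have "w \<in> V" "(w, u) \<in> U" using NV U Suc.prems by blast+
      then show ?thesis using depth_edge w(2) by fastforce
    qed simp
  next
    assume le: "depth u \<le> Suc r"
    show "depth u \<le> r \<or> (\<exists>w\<in>N u. depth w \<le> r)"
    proof (cases "depth u \<le> r")
      case False
      then have "depth u = Suc r" using le by simp
      then obtain w where "w \<in> V" "(w, u) \<in> U" "depth w = r" using depth_pred Suc.prems by metis
      then show ?thesis using U by auto
    qed simp
  qed
  finally show ?case .
qed

lemma heard_finite: "u \<in> V \<Longrightarrow> finite {deepest r w | w. w \<in> N u \<and> reached r w}"
proof -
  assume "u \<in> V"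
  then have "N u \<subseteq> V" using NV by blast
  then have "{deepest r w | w. w \<in> N u \<and> reached r w} \<subseteq> deepest r ` V" by blast
  then show ?thesis using finite_imageI[OF finV] by (rule finite_subset)
qed

lemma deepest_le: "u \<in> V \<Longrightarrow> reached r u \<Longrightarrow> deepest r u \<le> height"
proof (induction r arbitrary: u)
  case 0
  then show ?case by (simp add: state_0)
next
  case (Suc r)
  have "(if reached r u then deepest r u else Suc r) \<le> height"
  proof (cases "reached r u")
    case False
    then have "depth u = Suc r" using reached_iff Suc.prems by (metis le_SucE)
    then show ?thesis using False depth_height[OF Suc.prems(1)] by simp
  qed (use Suc in simp)
  moreover have "x \<le> height" if "x \<in> {deepest r w | w. w \<in> N u \<and> reached r w}" for x
    using that Suc NV by blast
  ultimately show ?case unfolding deepest_Suc using heard_finite[OF Suc.prems(1)] by auto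
qed

text \<open>The vertex \<open>x\<close> learns its depth in round \<open>depth x\<close>, and the
  news crosses one edge per round. For the source and a shortest walk back this gives round
  \<open>2 * depth x\<close>.\<close>

lemma deepest_ge: "u \<in> V \<Longrightarrow> x \<in> V \<Longrightarrow> (x, u) \<in> U ^^ k \<Longrightarrow> depth x + k \<le> r \<Longrightarrow> depth x \<le> deepest r u"
proof (induction r arbitrary: u k)
  case 0
  then show ?case by simp
next
  case (Suc r)
  have ub: "y \<le> deepest (Suc r) u" if "y = (if reached r u then deepest r u else Suc r) \<or>
      (\<exists>w. w \<in> N u \<and> reached r w \<and> y = deepest r w)" for y
    unfolding deepest_Suc using heard_finite[OF Suc.prems(1), of r] that by (intro Max_ge) auto
  show ?case
  proof (cases "depth x + k \<le> r")
    case True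
    then have "depth x \<le> deepest r u" using Suc by blast
    moreover have "depth u \<le> r" using depth_walk_le[OF Suc.prems(2,3)] True by simp
    then have "deepest r u \<le> deepest (Suc r) u" using ub reached_iff Suc.prems(1) by auto
    ultimately show ?thesis by simp
  next
    case False
    then have eq: "depth x + k = Suc r" using Suc.prems(4) by simp
    show ?thesis
    proof (cases k)
      case 0
      then have "x = u" "depth u = Suc r" using Suc.prems(3) eq by auto
      then have "\<not> reached r u" using reached_iff Suc.prems(1) by simp
      then show ?thesis using ub[of "Suc r"] \<open>x = u\<close> \<open>depth u = Suc r\<close> by simp
    next
      case (Suc k')
      then obtain w where w: "(x, w) \<in> U ^^ k'" "(w, u) \<in> U" using Suc.prems(3) by auto
      have wV: "w \<in> V" "w \<in> N u" using w U U_V by auto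
      have "depth x \<le> deepest r w" using Suc.IH[OF wV(1) Suc.prems(2) w(1)] eq Suc by simp
      moreover have "reached r w" using depth_walk_le[OF Suc.prems(2) w(1)] eq Suc reached_iff wV by simp
      ultimately show ?thesis using ub[of "deepest r w"] wV by fastforce
    qed
  qed
qed

lemma verdict_keep: "verdict r u = Some a \<Longrightarrow> verdict (Suc r) u = Some a"
  by (simp add: verdict_Suc)

lemma verdict_mono: "verdict r u = Some a \<Longrightarrow> r \<le> r' \<Longrightarrow> verdict r' u = Some a"
proof (induction r')
  case (Suc r')
  then show ?case by (cases "r = Suc r'") (auto intro: verdict_keep)
qed simp

lemma verdict_source: "2 * height + 2 \<le> r \<Longrightarrow> verdict r s \<noteq> None"
proof -
  assume r: "2 * height + 2 \<le> r"
  have "reached (2 * height + 2) s" using reached_iff sV depth_s by simp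
  then have "deepest (2 * height + 2) s \<le> height" using deepest_le sV by blast
  then have "verdict (Suc (2 * height + 1)) s \<noteq> None"
    unfolding verdict_Suc using src[OF sV] by (auto split: option.splits)
  then show ?thesis using verdict_mono[OF _ r] by fastforce
qed

lemma verdict_correct: "u \<in> V \<Longrightarrow> verdict r u = Some a \<Longrightarrow> a = height"
proof (induction r arbitrary: u a)
  case 0
  then show ?case by (simp add: state_0)
next
  case (Suc r)
  from case_verdict[OF Suc.prems(2)[unfolded verdict_Suc]] show ?case
  proof (elim disjE conjE)
    assume "verdict r u = Some a"
    then show ?thesis using Suc by blast
  next
    assume heard: "\<exists>w\<in>N u. reached r w \<and> verdict r w \<noteq> None"
      "a = (SOME e. \<exists>w\<in>N u. reached r w \<and> verdict r w = Some e)"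
    then have "\<exists>e. \<exists>w\<in>N u. reached r w \<and> verdict r w = Some e" by auto
    then have "\<exists>w\<in>N u. reached r w \<and> verdict r w = Some a" unfolding heard(2) by (rule someI_ex)
    then show ?thesis using Suc NV by blast
  next
    assume new: "verdict r u = None" "is_src (K u)" "even (Suc r)" "deepest (Suc r) u < Suc r div 2"
      "a = Suc r div 2 - 1"
    define q where "q = Suc r div 2"
    have q: "Suc r = 2 * q" using new(3) by (auto simp: q_def)
    have us: "u = s" using new src Suc.prems by blast
    \<comment> \<open>A vertex at depth \<open>q\<close> would have been heard of by round
      \<open>2 * q\<close>.\<close>
    have "\<not> q \<le> height"
    proof
      assume "q \<le> height"
      then obtain x where x: "x \<in> V" "depth x = q" using ex_depth by blast
      then have "(x, s) \<in> U ^^ q" using depth_walk sym_relpow[OF symU] by blast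
      then have "q \<le> deepest (Suc r) s" using deepest_ge[OF sV x(1), of q "Suc r"] x q by simp
      then show False using new us q_def by simp
    qed
    \<comment> \<open>From round \<open>2 * height + 2\<close> on the source has a verdict, so a new
      one is not made after that round.\<close>
    moreover have "r < 2 * height + 2" using verdict_source[of r] new(1) us by (metis not_less)
    ultimately have "q = Suc height" using q by linarith
    then show ?thesis using new(5) unfolding q_def[symmetric] by simp
  qed
qed

lemma verdict_spread: "u \<in> V \<Longrightarrow> (s, u) \<in> U ^^ k \<Longrightarrow> 2 * height + 2 + k \<le> r \<Longrightarrow> verdict r u \<noteq> None"
proof (induction k arbitrary: u r)
  case 0
  then show ?case using verdict_source by simp
next
  case (Suc k)
  then obtain w where w: "(s, w) \<in> U ^^ k" "(w, u) \<in> U" by auto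
  have wV: "w \<in> V" "w \<in> N u" using w U U_V by auto
  obtain r' where r': "r = Suc r'" using Suc.prems(3) by (cases r) auto
  have "verdict r' w \<noteq> None" using Suc.IH[OF wV(1) w(1)] Suc.prems(3) r' by simp
  moreover have "reached r' w" using depth_le[OF w(1)] Suc.prems(3) r' reached_iff wV by simp
  ultimately show ?case unfolding r' verdict_Suc using wV by (auto split: option.splits)
qed

lemma computes_census: "computes N V A (census is_src upd) K (4 * height + 4) (\<lambda>u. upd (K u) height)"
proof -
  have h: "halt (census is_src upd) (K u) r (state r u) =
    (case verdict r u of None \<Rightarrow> None | Some e \<Rightarrow> if r = 4 * e + 4 then Some (upd (K u) e) else None)" for r u
    by (cases "state r u") simp
  have final: "verdict (4 * height + 4) u = Some height" if u: "u \<in> V" for u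
  proof -
    \<comment> \<open>The source decides by round \<open>2 * height + 2\<close> and its verdict
      spreads within \<open>height\<close> further rounds.\<close>
    have "verdict (4 * height + 4) u \<noteq> None"
      using verdict_spread[OF u depth_walk[OF u]] depth_height[OF u] by simp
    then show ?thesis using verdict_correct[OF u] by auto
  qed
  have early: "halt (census is_src upd) (K u) r (state r u) = None" if "u \<in> V" "r < 4 * height + 4" for u r
    unfolding h using verdict_correct[OF that(1), of r] that(2) by (auto split: option.splits)
  have msg: "m \<in> A" if u: "u \<in> V" and b: "message r u = Some m" for u r m
  proof -
    have "deepest r u < card V" using deepest_le[OF u] b height_less by (force split: if_splits)
    then show ?thesis using b verdict_correct[OF u, of r] height_less A
      by (auto split: if_splits option.splits)
  qed
  show ?thesis unfolding computes_def bcast_message using h final early msg by auto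
qed

end

subsection \<open>Distances, hitting sets and detours\<close>

lemma walk_iff_relpow: "(\<exists>p. is_walk R x y p \<and> length p = Suc k) \<longleftrightarrow> (x, y) \<in> R ^^ k"
proof
  assume "\<exists>p. is_walk R x y p \<and> length p = Suc k"
  then obtain p where p: "is_walk R x y p" "length p = Suc k" by blast
  then show "(x, y) \<in> R ^^ k"
    unfolding relpow_fun_conv
    by (intro exI[of _ "\<lambda>i. p ! i"]) (auto simp: is_walk_def hd_conv_nth last_conv_nth)
next
  assume "(x, y) \<in> R ^^ k"
  then obtain f where f: "f 0 = x" "f k = y" "\<And>i. i < k \<Longrightarrow> (f i, f (Suc i)) \<in> R"
    unfolding relpow_fun_conv by blast
  have nth: "map f [0..<Suc k] ! i = f i" if "i \<le> k" for i
    using that nth_map_upt[of i "Suc k" 0 f] by simp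
  have "is_walk R x y (map f [0..<Suc k])"
    unfolding is_walk_def
  proof (intro conjI allI impI)
    show "hd (map f [0..<Suc k]) = x" using nth[of 0] f by (subst hd_conv_nth) simp_all
    show "last (map f [0..<Suc k]) = y" using f by simp
    fix i assume "Suc i < length (map f [0..<Suc k])"
    then show "(map f [0..<Suc k] ! i, map f [0..<Suc k] ! Suc i) \<in> R"
      using nth[of i] nth[of "Suc i"] f(3)[of i] by (simp del: upt_Suc)
  qed simp
  then show "\<exists>p. is_walk R x y p \<and> length p = Suc k" by (intro exI[of _ "map f [0..<Suc k]"]) simp
qed

lemma gdist_eq_INF: "gdist R x y = (INF k\<in>{k. (x, y) \<in> R ^^ k}. enat k)"
proof -
  have "{enat (length p - 1) | p. is_walk R x y p} = enat ` {k. (x, y) \<in> R ^^ k}"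
  proof (intro equalityI subsetI)
    fix z assume "z \<in> {enat (length p - 1) | p. is_walk R x y p}"
    then obtain p where p: "z = enat (length p - 1)" "is_walk R x y p" by blast
    then have "length p = Suc (length p - 1)" by (auto simp: is_walk_def)
    then have "(x, y) \<in> R ^^ (length p - 1)" using p(2) walk_iff_relpow by blast
    then show "z \<in> enat ` {k. (x, y) \<in> R ^^ k}" using p(1) by blast
  next
    fix z assume "z \<in> enat ` {k. (x, y) \<in> R ^^ k}"
    then obtain k where k: "z = enat k" "(x, y) \<in> R ^^ k" by blast
    then obtain p where "is_walk R x y p" "length p = Suc k" using walk_iff_relpow by blast
    then show "z \<in> {enat (length p - 1) | p. is_walk R x y p}" using k by (intro CollectI exI[of _ p]) simp
  qed
  moreover have "{enat (length p - 1) | p. is_walk R x y p} = (\<lambda>p. enat (length p - 1)) ` {p. is_walk R x y p}"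
    by blast
  ultimately show ?thesis unfolding gdist_def by simp
qed

lemma gdist_le: "(x, y) \<in> R ^^ k \<Longrightarrow> gdist R x y \<le> enat k"
  unfolding gdist_eq_INF by (intro INF_lower) simp

lemma gdist_attained: "gdist R x y < \<infinity> \<Longrightarrow> \<exists>k. gdist R x y = enat k \<and> (x, y) \<in> R ^^ k"
proof -
  assume fin: "gdist R x y < \<infinity>"
  then have "{k. (x, y) \<in> R ^^ k} \<noteq> {}" unfolding gdist_eq_INF by (metis image_empty Inf_empty top_enat_def less_irrefl)
  then obtain k where "enat k \<in> enat ` {k. (x, y) \<in> R ^^ k}" by blast
  then have "Inf (enat ` {k. (x, y) \<in> R ^^ k}) \<in> enat ` {k. (x, y) \<in> R ^^ k}"
    by (rule wellorder_InfI)
  then show ?thesis unfolding gdist_eq_INF by auto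
qed

text \<open>Self-loops are not links of the network, so searches use loop-free relations; dropping
  loops from a walk never lengthens it.\<close>

lemma relpow_without_loops: "(x, y) \<in> R ^^ k \<Longrightarrow> \<exists>j\<le>k. (x, y) \<in> (R - Id) ^^ j"
proof (induction k arbitrary: y)
  case 0
  then show ?case by (intro exI[of _ 0]) simp
next
  case (Suc k)
  then obtain z where z: "(x, z) \<in> R ^^ k" "(z, y) \<in> R" by auto
  then obtain j where j: "j \<le> k" "(x, z) \<in> (R - Id) ^^ j" using Suc by blast
  show ?case
  proof (cases "z = y")
    case True
    then show ?thesis using j by (intro exI[of _ j]) simp
  next
    case False
    then have "(x, y) \<in> (R - Id) ^^ Suc j" using j z by (intro relpow_Suc_I) auto
    then show ?thesis using j by (intro exI[of _ "Suc j"]) simp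
  qed
qed

lemma relpow_mono_rel: "(R :: ('a \<times> 'a) set) \<subseteq> S \<Longrightarrow> (x, y) \<in> R ^^ k \<Longrightarrow> (x, y) \<in> S ^^ k"
  by (induction k arbitrary: y) auto

lemma relpow_trans': "(x, y) \<in> R ^^ j \<Longrightarrow> (y, z) \<in> R ^^ k \<Longrightarrow> (x, z) \<in> R ^^ (j + k)"
  unfolding relpow_add by (rule relcompI)

lemma relpow_segment:
  assumes "\<And>i. i < k \<Longrightarrow> (f i, f (Suc i)) \<in> R" "a \<le> b" "b \<le> k"
  shows "(f a, f b) \<in> R ^^ (b - a)"
  unfolding relpow_fun_conv using assms by (intro exI[of _ "\<lambda>i. f (a + i)"]) auto

section \<open>Shortest walks through landmarks\<close>

definition at_distance :: "('a \<times> 'a) set \<Rightarrow> 'a \<Rightarrow> 'a \<Rightarrow> nat \<Rightarrow> bool" where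
  "at_distance H x y d \<longleftrightarrow> (x, y) \<in> H ^^ d \<and> (\<forall>j<d. (x, y) \<notin> H ^^ j)"

lemma at_distanceD: "at_distance H x y d \<Longrightarrow> (x, y) \<in> H ^^ d"
  by (simp add: at_distance_def)

lemma at_distance_le: "at_distance H x y d \<Longrightarrow> (x, y) \<in> H ^^ k \<Longrightarrow> d \<le> k"
  unfolding at_distance_def by (metis not_less)

lemma ex_at_distance: "(x, y) \<in> H ^^ k \<Longrightarrow> \<exists>d\<le>k. at_distance H x y d"
  unfolding at_distance_def
  by (intro exI[of _ "LEAST k. (x, y) \<in> H ^^ k"] conjI Least_le) (auto intro: LeastI dest: not_less_Least)

lemma at_distance_split:
  assumes "at_distance H x y (i + j)" "(x, z) \<in> H ^^ i" "(z, y) \<in> H ^^ j"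
  shows "at_distance H x z i" "at_distance H z y j"
proof -
  have "(x, z) \<notin> H ^^ k" if "k < i" for k
    using relpow_trans'[OF _ assms(3), of x k] at_distance_le[OF assms(1), of "k + j"] that by force
  then show "at_distance H x z i" using assms(2) by (simp add: at_distance_def)
  have "(z, y) \<notin> H ^^ k" if "k < j" for k
    using relpow_trans'[OF assms(2), of y k] at_distance_le[OF assms(1), of "i + k"] that by force
  then show "at_distance H z y j" using assms(3) by (simp add: at_distance_def)
qed

text \<open>The landmark lies on some shortest walk, among the first \<open>z\<close> vertices after
  the start. Excluding the start by \<open>1 \<le> j\<close> guarantees progress when the property
  is applied repeatedly.\<close>

definition hitting :: "('a \<times> 'a) set \<Rightarrow> 'a set \<Rightarrow> nat \<Rightarrow> bool" where
  "hitting H L z \<longleftrightarrow> (\<forall>x y d. at_distance H x y d \<and> z \<le> d \<longrightarrow>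
     (\<exists>l\<in>L. \<exists>j. 1 \<le> j \<and> j \<le> z \<and> at_distance H x l j \<and> at_distance H l y (d - j)))"

text \<open>It suffices to hit one shortest path for each pair of nodes at distance exactly z.\<close>

lemma hitting_family:
  fixes H :: "('a \<times> 'a) set"
  assumes "H \<subseteq> V \<times> V" "0 < z"
  obtains C :: "'a \<Rightarrow> 'a \<Rightarrow> 'a set" where
    "\<And>x y. at_distance H x y z \<Longrightarrow> C x y \<subseteq> V \<and> card (C x y) = z"
    "\<And>L. (\<And>x y. x \<in> V \<Longrightarrow> y \<in> V \<Longrightarrow> at_distance H x y z \<Longrightarrow> C x y \<inter> L \<noteq> {}) \<Longrightarrow> hitting H L z"
proof -
  define f where "f x y = (SOME f. f 0 = x \<and> f z = y \<and> (\<forall>i<z. (f i, f (Suc i)) \<in> H))" for x y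
  have f: "f x y 0 = x" "f x y z = y" "\<And>i. i < z \<Longrightarrow> (f x y i, f x y (Suc i)) \<in> H"
    if "at_distance H x y z" for x y
  proof -
    have "\<exists>f. f 0 = x \<and> f z = y \<and> (\<forall>i<z. (f i, f (Suc i)) \<in> H)"
      using at_distanceD[OF that] unfolding relpow_fun_conv .
    then have "f x y 0 = x \<and> f x y z = y \<and> (\<forall>i<z. (f x y i, f x y (Suc i)) \<in> H)"
      unfolding f_def by (rule someI_ex)
    then show "f x y 0 = x" "f x y z = y" "\<And>i. i < z \<Longrightarrow> (f x y i, f x y (Suc i)) \<in> H" by auto
  qed
  have seg: "(f x y a, f x y b) \<in> H ^^ (b - a)" if "at_distance H x y z" "a \<le> b" "b \<le> z" for x y a b
    using relpow_segment[of z "f x y" H a b] f(3)[OF that(1)] that by blast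
  have sub: "f x y ` {1..z} \<subseteq> V" if "at_distance H x y z" for x y
  proof
    fix w assume "w \<in> f x y ` {1..z}"
    then obtain i where "w = f x y (Suc i)" "i < z" by (auto simp: Suc_le_eq gr0_conv_Suc)
    then show "w \<in> V" using f(3)[OF that] assms(1) by blast
  qed
  \<comment> \<open>A repeated vertex would give a shortcut. So each set has exactly
    \<open>z\<close> elements, which fixes the probability that a sample misses it.\<close>
  have inj: "inj_on (f x y) {1..z}" if d: "at_distance H x y z" for x y
  proof (rule linorder_inj_onI)
    fix i j assume ij: "i < j" "i \<in> {1..z}" "j \<in> {1..z}"
    show "f x y i \<noteq> f x y j"
    proof
      assume eq: "f x y i = f x y j"
      have "(x, f x y i) \<in> H ^^ i" using seg[OF d, of 0 i] f(1)[OF d] ij by simp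
      moreover have "(f x y i, y) \<in> H ^^ (z - j)" using seg[OF d, of j z] f(2)[OF d] ij eq by simp
      ultimately have "(x, y) \<in> H ^^ (i + (z - j))" by (rule relpow_trans')
      then show False using at_distance_le[OF d] ij by fastforce
    qed
  qed auto
  show thesis
  proof (rule that[of "\<lambda>x y. f x y ` {1..z}"])
    show "f x y ` {1..z} \<subseteq> V \<and> card (f x y ` {1..z}) = z" if "at_distance H x y z" for x y
      using sub[OF that] card_image[OF inj[OF that]] by simp
    fix L assume L: "\<And>x y. x \<in> V \<Longrightarrow> y \<in> V \<Longrightarrow> at_distance H x y z \<Longrightarrow> f x y ` {1..z} \<inter> L \<noteq> {}"
    show "hitting H L z" unfolding hitting_def
    proof (intro allI impI)
      fix x y d assume "at_distance H x y d \<and> z \<le> d"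
      then have d: "at_distance H x y d" "z \<le> d" by auto
      \<comment> \<open>Only pairs at distance exactly \<open>z\<close> are covered. The walk chosen
        for \<open>x\<close> and \<open>w\<close> may differ from the given one, but followed by the
        rest it is again shortest.\<close>
      then obtain w where w: "(x, w) \<in> H ^^ z" "(w, y) \<in> H ^^ (d - z)"
        using at_distanceD[OF d(1)] relpow_add[of z "d - z" H] by auto
      have xw: "at_distance H x w z" using at_distance_split(1)[OF _ w] d by simp
      have V: "x \<in> V" "w \<in> V"
        using f(3)[OF xw, of 0] f(3)[OF xw, of "z - 1"] f(1,2)[OF xw] assms by auto
      obtain i where i: "1 \<le> i" "i \<le> z" "f x w i \<in> L" using L[OF V xw] by auto
      have 1: "(x, f x w i) \<in> H ^^ i" using seg[OF xw, of 0 i] f(1)[OF xw] i by simp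
      have "(f x w i, w) \<in> H ^^ (z - i)" using seg[OF xw, of i z] f(2)[OF xw] i by simp
      then have "(f x w i, y) \<in> H ^^ ((z - i) + (d - z))" using w(2) by (rule relpow_trans')
      then have 2: "(f x w i, y) \<in> H ^^ (d - i)" using i d by simp
      have 3: "at_distance H x y (i + (d - i))" using d i by simp
      from at_distance_split[OF 3 1 2] show "\<exists>l\<in>L. \<exists>j. 1 \<le> j \<and> j \<le> z \<and> at_distance H x l j \<and> at_distance H l y (d - j)"
        using i by blast
    qed
  qed
qed

text \<open>Walks and their total weight in the graph with weighted edges \<open>W\<close>; the
  edges will stand for walks between landmarks.\<close>

inductive overlay :: "('a \<times> 'a \<times> nat) set \<Rightarrow> 'a \<Rightarrow> 'a \<Rightarrow> nat \<Rightarrow> bool" for W where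
  overlay_refl: "overlay W x x 0"
| overlay_step: "overlay W x y d \<Longrightarrow> (y, w, j) \<in> W \<Longrightarrow> overlay W x w (d + j)"

lemma overlay_trans: "overlay W y w j \<Longrightarrow> overlay W x y d \<Longrightarrow> overlay W x w (d + j)"
proof (induction rule: overlay.induct)
  case (overlay_step y y' d' w j)
  then show ?case using overlay.overlay_step[of W x y' "d + d'" w j] by (simp add: add.assoc)
qed simp

lemma overlay_sound:
  "overlay W x y d \<Longrightarrow> (\<And>a b j. (a, b, j) \<in> W \<Longrightarrow> (a, b) \<in> H ^^ j) \<Longrightarrow> (x, y) \<in> H ^^ d"
  by (induction rule: overlay.induct) (auto intro: relpow_trans')

text \<open>While more than \<open>z\<close> steps remain, \<open>hitting\<close> supplies the next
  landmark, at most \<open>z\<close> steps ahead on a shortest walk; the jump is an edge of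
  \<open>W\<close>. The end \<open>y\<close> may lie off the landmarks, hence the last
  piece.\<close>

lemma overlay_complete:
  assumes hit: "hitting H L z"
    and W: "\<And>a b j. a \<in> L \<Longrightarrow> b \<in> L \<Longrightarrow> at_distance H a b j \<Longrightarrow> j \<le> z \<Longrightarrow> (a, b, j) \<in> W"
    and "x \<in> L" "at_distance H x y d"
  shows "\<exists>l\<in>L. \<exists>i j. overlay W x l i \<and> at_distance H l y j \<and> j \<le> z \<and> d = i + j"
  using assms(3,4)
proof (induction d arbitrary: x rule: less_induct)
  case (less d)
  show ?case
  proof (cases "d \<le> z")
    case True
    then show ?thesis using less.prems overlay_refl by (metis add_0)
  next
    case False
    then obtain l j where l: "l \<in> L" "1 \<le> j" "j \<le> z" "at_distance H x l j" "at_distance H l y (d - j)"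
      using hit less.prems(2) unfolding hitting_def by (metis nat_le_linear)
    have "d - j < d" using l False by auto
    from less.IH[OF this l(1,5)] obtain l' i k where
      l': "l' \<in> L" "overlay W l l' i" "at_distance H l' y k" "k \<le> z" "d - j = i + k" by blast
    have "overlay W x l (0 + j)" by (rule overlay_step[OF overlay_refl W]) (use less.prems l in auto)
    then have "overlay W x l' (j + i)" using overlay_trans[OF l'(2), of x j] by simp
    moreover have "d = (j + i) + k" using l'(5) l(3) False by simp
    ultimately show ?thesis using l' by blast
  qed
qed

section \<open>Replacement paths as single detours\<close>

locale rpaths_instance =
  fixes V :: "nat set" and E :: "(nat \<times> nat) set" and s t :: nat and P :: "nat list"
  assumes finV: "finite V" and E_V: "E \<subseteq> V \<times> V" and conn: "uconnected V E"
    and sV: "s \<in> V" and tV: "t \<in> V" and P_shortest: "is_shortest_path E s t P"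
begin

lemma nbrs_V: "\<forall>u\<in>V. nbrs E u \<subseteq> V"
  using E_V by (auto simp: nbrs_def uedges_def)

definition len :: nat where "len = length P - 1"
definition Ep :: "(nat \<times> nat) set" where "Ep = path_edges P"
definition Eo :: "(nat \<times> nat) set" where "Eo = E - Ep - Id"

lemma P_distinct: "distinct P" and P_0: "P ! 0 = s" and P_len: "P ! len = t"
  and length_P: "length P = Suc len"
  using P_shortest by (auto simp: is_shortest_path_def is_walk_def hd_conv_nth last_conv_nth len_def)

lemma P_edge: "i < len \<Longrightarrow> (P ! i, P ! Suc i) \<in> E"
  using P_shortest length_P by (auto simp: is_shortest_path_def is_walk_def)

lemma P_inj: "i \<le> len \<Longrightarrow> j \<le> len \<Longrightarrow> P ! i = P ! j \<longleftrightarrow> i = j"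
  using P_distinct length_P by (simp add: nth_eq_iff_index_eq)

lemma P_walk: "a \<le> b \<Longrightarrow> b \<le> len \<Longrightarrow> (P ! a, P ! b) \<in> Ep ^^ (b - a)"
  using relpow_segment[of len "\<lambda>i. P ! i" Ep a b] length_P by (auto simp: Ep_def path_edges_def)

lemma Ep_E: "Ep \<subseteq> E"
  using P_edge length_P by (auto simp: Ep_def path_edges_def)

lemma Ep_no_loop: "(x, x) \<notin> Ep"
proof
  assume "(x, x) \<in> Ep"
  then obtain i where "i < len" "P ! i = P ! Suc i" using length_P by (auto simp: Ep_def path_edges_def)
  then show False using P_inj[of i "Suc i"] by simp
qed

lemma P_V: "i \<le> len \<Longrightarrow> P ! i \<in> V"
  using relpow_subset[OF E_V _ sV, of "P ! i" i] relpow_mono_rel[OF Ep_E P_walk[of 0 i]] P_0 by simp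

lemma len_less: "len < card V"
proof -
  have "set P \<subseteq> V" using P_V length_P by (auto simp: in_set_conv_nth)
  then have "card (set P) \<le> card V" using finV by (rule card_mono[rotated])
  then show ?thesis using distinct_card[OF P_distinct] length_P by simp
qed

lemma Ep_edge_from: "i \<le> len \<Longrightarrow> (P ! i, y) \<in> Ep \<longleftrightarrow> i < len \<and> y = P ! Suc i"
proof
  assume i: "i \<le> len" and "(P ! i, y) \<in> Ep"
  then obtain j where "P ! i = P ! j" "y = P ! Suc j" "j < len" using length_P by (auto simp: Ep_def path_edges_def)
  then show "i < len \<and> y = P ! Suc i" using P_inj[OF i, of j] by auto
qed (use length_P in \<open>auto simp: Ep_def path_edges_def\<close>)

lemma Ep_walk_from: "i \<le> len \<Longrightarrow> (P ! i, y) \<in> Ep ^^ k \<Longrightarrow> i + k \<le> len \<and> y = P ! (i + k)"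
proof (induction k arbitrary: y)
  case (Suc k)
  then obtain z where "(P ! i, z) \<in> Ep ^^ k" "(z, y) \<in> Ep" by auto
  then show ?case using Suc Ep_edge_from[of "i + k" y] by auto
qed simp

text \<open>Otherwise the walk could be spliced into \<open>P\<close> to shorten it. In particular a
  detour of length d bypasses at most d edges of \<open>P\<close>, so short detours stay within a
  short window.\<close>

lemma P_geodesic:
  assumes "(P ! a, P ! b) \<in> E ^^ d" "a \<le> len" "b \<le> len"
  shows "b \<le> a + d"
proof -
  have 1: "(s, P ! a) \<in> E ^^ a" using relpow_mono_rel[OF Ep_E P_walk[of 0 a]] assms P_0 by simp
  have 2: "(P ! b, t) \<in> E ^^ (len - b)" using relpow_mono_rel[OF Ep_E P_walk[of b len]] assms P_len by simp
  have "(s, t) \<in> E ^^ (a + d + (len - b))" by (rule relpow_trans'[OF relpow_trans'[OF 1 assms(1)] 2])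
  then have "gdist E s t \<le> enat (a + d + (len - b))" by (rule gdist_le)
  moreover have "gdist E s t = enat len" using P_shortest by (simp add: is_shortest_path_def len_def)
  ultimately show ?thesis using assms by simp
qed

definition detours :: "nat \<Rightarrow> (nat \<times> nat \<times> nat) set" where
  "detours i = {(a, b, d). a \<le> i \<and> i < b \<and> b \<le> len \<and> (P ! a, P ! b) \<in> Eo ^^ d}"

text \<open>Cut the walk at its last visit to a position at most \<open>i\<close> and at its next
  visit to a later position. The part between meets \<open>P\<close> only in its ends, and by
  \<open>P_geodesic\<close> the rest is no shorter than the two pieces of \<open>P\<close> that
  replace it.\<close>

lemma replacement_walk_to_detour:
  assumes i: "i < len" and k: "(s, t) \<in> (E - {(P ! i, P ! Suc i)}) ^^ k"
  shows "\<exists>(a, b, d)\<in>detours i. a + d + (len - b) \<le> k"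
proof -
  let ?E = "E - {(P ! i, P ! Suc i)}"
  obtain f where f: "f 0 = s" "f k = t" "\<And>j. j < k \<Longrightarrow> (f j, f (Suc j)) \<in> ?E"
    using k unfolding relpow_fun_conv by blast
  define A where "A = {j. j \<le> k \<and> (\<exists>a\<le>i. f j = P ! a)}"
  define p where "p = Max A"
  have A: "finite A" "0 \<in> A" using f(1) P_0 by (auto simp: A_def)
  then have pA: "p \<in> A" unfolding p_def by (intro Max_in) auto
  then obtain a where a: "p \<le> k" "a \<le> i" "f p = P ! a" by (auto simp: A_def)
  have pmax: "j \<le> p" if "j \<in> A" for j unfolding p_def using A that by simp
  have "p \<noteq> k" using P_inj[of a len] a f(2) P_len i by auto
  define B where "B j \<longleftrightarrow> p < j \<and> j \<le> k \<and> (\<exists>b. i < b \<and> b \<le> len \<and> f j = P ! b)" for j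
  define q where "q = (LEAST j. B j)"
  have "B k" using \<open>p \<noteq> k\<close> a i f(2) P_len by (auto simp: B_def)
  then have qB: "B q" unfolding q_def by (rule LeastI)
  have qmin: "\<not> B j" if "j < q" for j using not_less_Least[of j B] that by (auto simp: q_def)
  obtain b where b: "p < q" "q \<le> k" "i < b" "b \<le> len" "f q = P ! b" using qB by (auto simp: B_def)
  have off: "f j \<noteq> P ! c" if "p < j" "j < q" "c \<le> len" for j c
  proof
    assume c: "f j = P ! c"
    have jk: "j \<le> k" using that b by simp
    show False
    proof (cases "c \<le> i")
      case True
      then have "j \<in> A" using c jk by (auto simp: A_def)
      then show False using pmax that by fastforce
    next
      case False
      then have "i < c" by simp
      then have "B j" unfolding B_def using c jk that by blast
      then show False using qmin that by blast
    qed
  qed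
  have step: "(f j, f (Suc j)) \<in> E - Ep" if "p \<le> j" "j < q" for j
  proof -
    have E: "(f j, f (Suc j)) \<in> ?E" using f(3) that b by simp
    \<comment> \<open>A path edge has both ends on \<open>P\<close>, so it would be the whole part
      between the cuts and lead from a position at most \<open>i\<close> to a later one: the deleted
      edge.\<close>
    have "(f j, f (Suc j)) \<notin> Ep"
    proof
      assume "(f j, f (Suc j)) \<in> Ep"
      then obtain c where c: "c < len" "f j = P ! c" "f (Suc j) = P ! Suc c"
        using length_P by (auto simp: Ep_def path_edges_def)
      have "j = p" using off[of j c] that c by fastforce
      moreover have "Suc j = q" using off[of "Suc j" "Suc c"] that c by fastforce
      ultimately have "P ! c = P ! a" "P ! Suc c = P ! b" using c a b by auto
      then have "c = a" "Suc c = b" using P_inj c a b i by auto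
      then have "c = i" using a b by simp
      then show False using E c by simp
    qed
    then show ?thesis using E by simp
  qed
  have "(P ! a, P ! b) \<in> (E - Ep) ^^ (q - p)"
    unfolding relpow_fun_conv using step a b by (intro exI[of _ "\<lambda>j. f (p + j)"]) auto
  from relpow_without_loops[OF this] obtain d where d: "d \<le> q - p" "(P ! a, P ! b) \<in> Eo ^^ d"
    unfolding Eo_def by blast
  have sub: "?E \<subseteq> E" by blast
  have "(s, P ! a) \<in> E ^^ p" using relpow_mono_rel[OF sub relpow_segment[of k f ?E 0 p]] f a by simp
  then have "a \<le> p" using P_geodesic[of 0 a p] P_0 a i by simp
  moreover have "(P ! b, t) \<in> E ^^ (k - q)" using relpow_mono_rel[OF sub relpow_segment[of k f ?E q k]] f b by simp
  then have "len \<le> b + (k - q)" using P_geodesic[of b len "k - q"] P_len b by simp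
  ultimately have "a + d + (len - b) \<le> k" using d b by linarith
  then show ?thesis using a b d by (intro bexI[of _ "(a, b, d)"]) (auto simp: detours_def)
qed

lemma detour_to_replacement_walk:
  assumes i: "i < len" and d: "(a, b, d) \<in> detours i"
  shows "(s, t) \<in> (E - {(P ! i, P ! Suc i)}) ^^ (a + d + (len - b))"
proof -
  let ?E = "E - {(P ! i, P ! Suc i)}"
  have ab: "a \<le> i" "i < b" "b \<le> len" "(P ! a, P ! b) \<in> Eo ^^ d" using d by (auto simp: detours_def)
  have e: "(P ! j, P ! Suc j) \<in> ?E" if "j < len" "j \<noteq> i" for j
    using P_edge[OF that(1)] P_inj[of j i] that i by auto
  have 1: "(s, P ! a) \<in> ?E ^^ a" unfolding relpow_fun_conv
    using e ab i P_0 by (intro exI[of _ "\<lambda>j. P ! j"]) auto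
  have "Eo \<subseteq> ?E" using length_P i by (auto simp: Eo_def Ep_def path_edges_def)
  then have 2: "(P ! a, P ! b) \<in> ?E ^^ d" using ab(4) by (rule relpow_mono_rel)
  have 3: "(P ! b, t) \<in> ?E ^^ (len - b)" unfolding relpow_fun_conv
    using e ab i P_len by (intro exI[of _ "\<lambda>j. P ! (b + j)"]) auto
  show ?thesis by (rule relpow_trans'[OF relpow_trans'[OF 1 2] 3])
qed

theorem repl_dist_eq_detours:
  assumes "i < len"
  shows "repl_dist E s t (P ! i, P ! Suc i) = (INF (a, b, d)\<in>detours i. enat (a + d + (len - b)))"
proof (rule antisym)
  show "repl_dist E s t (P ! i, P ! Suc i) \<le> (INF (a, b, d)\<in>detours i. enat (a + d + (len - b)))"
    unfolding repl_dist_def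
    by (rule INF_greatest) (auto dest: detour_to_replacement_walk[OF assms] intro: gdist_le)
  show "(INF (a, b, d)\<in>detours i. enat (a + d + (len - b))) \<le> repl_dist E s t (P ! i, P ! Suc i)"
    unfolding repl_dist_def gdist_eq_INF
  proof (rule INF_greatest)
    fix k assume "k \<in> {k. (s, t) \<in> (E - {(P ! i, P ! Suc i)}) ^^ k}"
    then have "(s, t) \<in> (E - {(P ! i, P ! Suc i)}) ^^ k" by simp
    from replacement_walk_to_detour[OF assms this]
    obtain x where "x \<in> detours i" "case x of (a, b, d) \<Rightarrow> a + d + (len - b) \<le> k" by (rule bexE)
    then show "(INF (a, b, d)\<in>detours i. enat (a + d + (len - b))) \<le> enat k"
      by (intro INF_lower2[of x]) (auto split: prod.splits)
  qed
qed

end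

subsection \<open>The algorithm\<close>

text \<open>Write h for the length of the path and G' for the graph without the path edges. The field
  \<open>to_end\<close> maps d to the least h - j such that some walk of length d in G' leads to position j of the
  path; \<open>leave\<close> and \<open>rejoin\<close> map a landmark l to the length of a shortest known walk from s to l, or
  from l to t, that follows the path up to (or from) a position not after (or not before) the node
  and uses G' otherwise.\<close>

record know =
  me :: nat
  is_s :: bool
  is_t :: bool
  info :: "nat \<Rightarrow> (bool \<times> bool \<times> bool \<times> bool) option"
  mark :: bool
  win :: nat
  cap :: nat
  ecc :: nat
  near :: "(nat \<times> nat) set"
  index :: "nat option"
  plen :: nat
  lms :: "nat list"
  pos :: "nat \<Rightarrow> nat \<Rightarrow> bool"
  to_end :: "nat \<Rightarrow> enat"
  short :: enat
  from_lm :: "(nat \<times> nat) set"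
  to_lm :: "(nat \<times> nat) set"
  leave :: "nat \<Rightarrow> enat"
  rejoin :: "nat \<Rightarrow> enat"
  rejoin_after :: "nat \<Rightarrow> enat"

text \<open>The source and the target are always landmarks: positions are measured from the one, and
  the other reveals the length of \<open>P\<close>. The zeros and empty tables are placeholders,
  each overwritten by its phase before being read.\<close>

definition initial :: "nat \<Rightarrow> nat \<Rightarrow> bool \<Rightarrow> linput \<Rightarrow> know" where
  "initial z m b i = (case i of (v, n, src, tgt, nb) \<Rightarrow>
     \<lparr>me = v, is_s = src, is_t = tgt, info = nb, mark = (b \<or> src \<or> tgt), win = z, cap = m, ecc = 0,
      near = {}, index = None, plen = 0, lms = [], pos = (\<lambda>_ _. False), to_end = (\<lambda>_. 0), short = 0,
      from_lm = {}, to_lm = {}, leave = (\<lambda>_. 0), rejoin = (\<lambda>_. 0), rejoin_after = (\<lambda>_. 0)\<rparr>)"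

fun along_path against_path along_detour against_detour :: "know \<Rightarrow> nat \<Rightarrow> bool" where
  "along_path k w = (case info k w of None \<Rightarrow> False | Some (out, inn, pout, pin) \<Rightarrow> pin)"
| "against_path k w = (case info k w of None \<Rightarrow> False | Some (out, inn, pout, pin) \<Rightarrow> pout)"
| "along_detour k w = (case info k w of None \<Rightarrow> False | Some (out, inn, pout, pin) \<Rightarrow> inn \<and> \<not> pin)"
| "against_detour k w = (case info k w of None \<Rightarrow> False | Some (out, inn, pout, pin) \<Rightarrow> out \<and> \<not> pout)"

definition lm_token :: "know \<Rightarrow> nat set" where
  "lm_token k = (if mark k then {list_encode [me k]} else {})"

definition lm_dist :: "(nat \<times> nat) set \<Rightarrow> nat \<Rightarrow> enat" where
  "lm_dist A l = (INF d\<in>{d. (d, list_encode [l]) \<in> A}. enat d)"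

text \<open>The length of the list tells the three kinds apart: one entry names the source, two the
  target, and three give a distance along \<open>P\<close> between landmarks.\<close>

definition path_tokens :: "know \<Rightarrow> nat set" where
  "path_tokens k = (if mark k then {list_encode [l, me k, d] | l d. (d, list_encode [l]) \<in> near k} else {})
     \<union> (if is_s k then {list_encode [me k]} else {}) \<union> (if is_t k then {list_encode [me k, me k]} else {})"

text \<open>The broadcast distances form a weighted graph on the landmarks. Its walks from the
  source give the positions of the landmarks on \<open>P\<close>, and the entry for a landmark
  shortly before the vertex gives the vertex's own position. A landmark is recognised by its
  distance 0 to itself.\<close>

definition locate :: "know \<Rightarrow> nat set \<Rightarrow> know" where
  "locate k X =
     (let W = {(l, l', d). list_encode [l, l', d] \<in> X};
          src = (THE x. list_encode [x] \<in> X);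
          tgt = (THE x. list_encode [x, x] \<in> X);
          I = {i. \<exists>l d d'. overlay W src l d \<and> (d', list_encode [l]) \<in> near k \<and> i = d + d'}
      in k\<lparr>index := (if I = {} then None else Some (THE i. i \<in> I)),
           plen := (THE i. overlay W src tgt i),
           lms := sorted_list_of_set {l. list_encode [l, l, 0] \<in> X},
           pos := overlay W src\<rparr>)"

text \<open>Distances to the end of \<open>P\<close> rather than positions, so that the minimum
  taken by a wave selects the farthest position. The value is injected in round 0 only, so that the
  arrival round is the length of the walk.\<close>

definition end_offset :: "know \<Rightarrow> nat \<Rightarrow> enat" where
  "end_offset k r = (case index k of None \<Rightarrow> \<infinity> | Some i \<Rightarrow> if r = 0 then enat (plen k - i) else \<infinity>)"

text \<open>The result is read at time z - 1, where z is the window; a value injected at position i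
  in round \<open>r\<close> has then moved on to position i + z - 1 - r. The bound on
  \<open>i + win k\<close> says that this position lies before \<open>plen k - x\<close>, where the
  detour rejoins, so a detour is counted only at edges that it bypasses.\<close>

definition short_detour :: "know \<Rightarrow> nat \<Rightarrow> enat" where
  "short_detour k r = (case index k of None \<Rightarrow> \<infinity> | Some i \<Rightarrow>
     (INF d\<in>{d. d \<le> win k \<and> (\<exists>x. to_end k d = enat x \<and> i + win k \<le> plen k - x + r)}. enat (i + d) + to_end k d))"

text \<open>Long enough for a flood of at most m tokens over distance z, and for waves in which each
  of m landmarks gets a round of its own and may travel z edges.\<close>

definition horizon :: "know \<Rightarrow> nat" where
  "horizon k = win k + cap k"

text \<open>In the waves along the path, messages that travel together keep the value of i - r (or i + r), where
  i is the position on the path and r the time; this value selects the landmark they are about.\<close>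

definition leave_lm :: "know \<Rightarrow> nat \<Rightarrow> nat \<Rightarrow> nat" where
  "leave_lm k i r = lms k ! ((i + horizon k - r) mod length (lms k))"

definition rejoin_lm :: "know \<Rightarrow> nat \<Rightarrow> nat \<Rightarrow> nat" where
  "rejoin_lm k i r = lms k ! ((i + r) mod length (lms k))"

definition leave_value :: "know \<Rightarrow> nat \<Rightarrow> enat" where
  "leave_value k r = (case index k of None \<Rightarrow> \<infinity> | Some i \<Rightarrow> enat i + lm_dist (to_lm k) (leave_lm k i r))"

definition rejoin_value :: "know \<Rightarrow> nat \<Rightarrow> enat" where
  "rejoin_value k r = (case index k of None \<Rightarrow> \<infinity> | Some i \<Rightarrow>
     lm_dist (from_lm k) (rejoin_lm k i r) + enat (plen k - i))"

definition collect :: "know \<Rightarrow> (know \<Rightarrow> nat \<Rightarrow> nat \<Rightarrow> nat) \<Rightarrow> (nat \<Rightarrow> enat) \<Rightarrow> nat \<Rightarrow> enat" where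
  "collect k sel Q l = (case index k of None \<Rightarrow> \<infinity> | Some i \<Rightarrow> (INF r\<in>{r. r \<le> horizon k \<and> sel k i r = l}. Q r))"

definition detour_tokens :: "know \<Rightarrow> nat set" where
  "detour_tokens k = (if mark k then
     {list_encode [0, l, me k, d] | l d. lm_dist (from_lm k) l = enat d} \<union>
     {list_encode [1, l, me k, x] | l x. l \<in> set (lms k) \<and> leave k l = enat x} \<union>
     {list_encode [2, l, me k, x] | l x. l \<in> set (lms k) \<and> rejoin k l = enat x} else {})"

text \<open>The table of a landmark at position \<open>j \<le> i\<close> is usable since leaving at
  or before \<open>j\<close> also means leaving before the edge; symmetrically for
  \<open>i < j\<close>. At its own position the vertex takes \<open>rejoin_after\<close>: rejoining
  at \<open>i\<close> itself would not bypass the edge from \<open>i\<close> to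
  \<open>i + 1\<close>.\<close>

definition answer :: "know \<Rightarrow> nat set \<Rightarrow> enat" where
  "answer k X =
     (let W = {(l, l', d). list_encode [0, l, l', d] \<in> X}; i = the (index k) in
      min (short k) (INF (x, d, y)\<in>{(x, d, y). \<exists>l l'. overlay W l l' d \<and>
        (leave k l = enat x \<or> (\<exists>p j. list_encode [1, l, p, x] \<in> X \<and> pos k p j \<and> j \<le> i)) \<and>
        (rejoin_after k l' = enat y \<or> (\<exists>p j. list_encode [2, l', p, y] \<in> X \<and> pos k p j \<and> i < j))}.
        enat (x + d + y)))"

definition phase0 where "phase0 = census is_s (\<lambda>k e. k\<lparr>ecc := e\<rparr>)"
definition phase1 where "phase1 = flood horizon along_path lm_token (\<lambda>k A. k\<lparr>near := A\<rparr>)"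
text \<open>In both broadcasts \<open>2 * ecc k\<close> bounds the distance between any two
  vertices, by way of the source, and the other summand bounds the number of tokens: one per pair of
  landmarks and two for the ends of the path here, three per pair in the last phase.\<close>

definition phase2 where "phase2 = flood (\<lambda>k. 2 * ecc k + (cap k * cap k + 2)) (\<lambda>_ _. True) path_tokens
  (\<lambda>k A. locate k (snd ` A))"
definition phase3 where "phase3 = wave win against_detour end_offset
  (\<lambda>k Q. k\<lparr>to_end := (\<lambda>r. min (end_offset k r) (Q r))\<rparr>)"
definition phase4 where "phase4 = wave win along_path short_detour
  (\<lambda>k Q. k\<lparr>short := min (short_detour k (win k - 1)) (Q (win k - 1))\<rparr>)"
definition phase5 where "phase5 = flood horizon along_detour lm_token (\<lambda>k A. k\<lparr>from_lm := A\<rparr>)"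
definition phase6 where "phase6 = flood horizon against_detour lm_token (\<lambda>k A. k\<lparr>to_lm := A\<rparr>)"
definition phase7 where "phase7 = wave horizon along_path leave_value
  (\<lambda>k Q. k\<lparr>leave := collect k leave_lm (\<lambda>r. min (leave_value k r) (Q r))\<rparr>)"
definition phase8 where "phase8 = wave horizon against_path rejoin_value
  (\<lambda>k Q. k\<lparr>rejoin := collect k rejoin_lm (\<lambda>r. min (rejoin_value k r) (Q r)),
          rejoin_after := collect k rejoin_lm Q\<rparr>)"
definition phase9 where "phase9 = flood (\<lambda>k. 2 * ecc k + 3 * (cap k * cap k)) (\<lambda>_ _. True) detour_tokens
  (\<lambda>k A. answer k (snd ` A))"

definition rpaths_machine where
  "rpaths_machine = seq_comp phase0 (seq_comp phase1 (seq_comp phase2 (seq_comp phase3 (seq_comp phase4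
     (seq_comp phase5 (seq_comp phase6 (seq_comp phase7 (seq_comp phase8 phase9))))))))"

lemma lm_dist_le: "(d, list_encode [l]) \<in> A \<Longrightarrow> lm_dist A l \<le> enat d"
  unfolding lm_dist_def by (intro INF_lower) simp

lemma INF_enat_attained:
  assumes "(INF x\<in>X. f x) = enat a"
  shows "\<exists>x\<in>X. f x = enat a"
proof -
  have "X \<noteq> {}" using assms by (auto simp: top_enat_def)
  then obtain x where "f x \<in> f ` X" by blast
  then have "Inf (f ` X) \<in> f ` X" by (rule wellorder_InfI)
  then show ?thesis using assms by force
qed

lemma lm_dist_attained: "lm_dist A l = enat d \<Longrightarrow> (d, list_encode [l]) \<in> A"
  unfolding lm_dist_def by (drule INF_enat_attained) simp

lemma ex_mod_eq:
  assumes "\<kappa> < (K::nat)"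
  shows "\<exists>j<K. (c + j) mod K = \<kappa>"
proof -
  define j where "j = (\<kappa> + (K - c mod K)) mod K"
  have K: "0 < K" "c mod K \<le> K" using assms by (auto intro: less_imp_le)
  have "(c + j) mod K = (c mod K + (\<kappa> + (K - c mod K))) mod K"
    unfolding j_def by (metis mod_add_eq mod_add_left_eq mod_add_right_eq)
  also have "c mod K + (\<kappa> + (K - c mod K)) = \<kappa> + K" using K(2) by linarith
  finally have "(c + j) mod K = \<kappa>" using assms by simp
  moreover have "j < K" unfolding j_def using K by simp
  ultimately show ?thesis by blast
qed

text \<open>Five entries: a hop count followed by a token of at most four numbers.\<close>

definition msg_set :: "nat \<Rightarrow> msg set" where
  "msg_set B = {xs. length xs \<le> 5 \<and> set xs \<subseteq> {..<B}}"

text \<open>The deterministic core: \<open>L\<close> is a sample that turned out well, with the ends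
  of \<open>P\<close> added. The bound \<open>B\<close> exceeds every number that occurs in a
  message: identifiers, hop counts, and lengths carried by waves and tokens.\<close>

locale rpaths_run = rpaths_instance +
  fixes L :: "nat set" and z m B :: nat
  assumes L_V: "L \<subseteq> V" and sL: "s \<in> L" and tL: "t \<in> L" and card_L: "card L \<le> m" and z_pos: "0 < z"
    and hit_path: "hitting Ep L z" and hit_detour: "hitting Eo L z"
    and B_V: "\<And>v. v \<in> V \<Longrightarrow> v < B" and B_large: "3 * card V + z + m + 3 * (m * m) + 5 < B"
begin

definition U :: "(nat \<times> nat) set" where "U = uedges E - Id"

abbreviation "msgs \<equiv> msg_set B"

abbreviation "computes_here \<equiv> computes (nbrs E) V msgs"

definition base :: "(nat \<Rightarrow> know) \<Rightarrow> bool" where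
  "base K \<longleftrightarrow> (\<forall>u\<in>V. me (K u) = u \<and> is_s (K u) = (u = s) \<and> is_t (K u) = (u = t) \<and> mark (K u) = (u \<in> L) \<and>
     win (K u) = z \<and> cap (K u) = m \<and>
     info (K u) = (\<lambda>w. if w \<in> nbrs E u
       then Some ((u, w) \<in> E, (w, u) \<in> E, (u, w) \<in> path_edges P, (w, u) \<in> path_edges P) else None))"

lemma finL: "finite L" using L_V finV by (rule finite_subset)

lemma U_iff: "(w, u) \<in> U \<longleftrightarrow> u \<in> V \<and> w \<in> nbrs E u"
  using E_V by (auto simp: U_def nbrs_def uedges_def)

lemma sym_U: "sym U" by (auto simp: sym_def U_def uedges_def)

lemma filters:
  assumes "base K"
  shows "(w, u) \<in> Ep \<longleftrightarrow> u \<in> V \<and> w \<in> nbrs E u \<and> along_path (K u) w"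
    and "(w, u) \<in> Ep\<inverse> \<longleftrightarrow> u \<in> V \<and> w \<in> nbrs E u \<and> against_path (K u) w"
    and "(w, u) \<in> Eo \<longleftrightarrow> u \<in> V \<and> w \<in> nbrs E u \<and> along_detour (K u) w"
    and "(w, u) \<in> Eo\<inverse> \<longleftrightarrow> u \<in> V \<and> w \<in> nbrs E u \<and> against_detour (K u) w"
proof -
  have i: "info (K u) w = (if w \<in> nbrs E u
       then Some ((u, w) \<in> E, (w, u) \<in> E, (u, w) \<in> Ep, (w, u) \<in> Ep) else None)" if "u \<in> V"
    using assms that by (simp add: base_def Ep_def)
  have n: "w \<in> nbrs E u \<longleftrightarrow> ((u, w) \<in> E \<or> (w, u) \<in> E) \<and> w \<noteq> u" by (auto simp: nbrs_def uedges_def)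
  have E: "(x, y) \<in> E \<Longrightarrow> x \<in> V \<and> y \<in> V" for x y using E_V by auto
  have p: "(x, y) \<in> Ep \<Longrightarrow> (x, y) \<in> E \<and> x \<noteq> y" for x y using Ep_E Ep_no_loop by auto
  have o: "(x, y) \<in> Eo \<longleftrightarrow> (x, y) \<in> E \<and> (x, y) \<notin> Ep \<and> x \<noteq> y" for x y by (auto simp: Eo_def)
  show "(w, u) \<in> Ep \<longleftrightarrow> u \<in> V \<and> w \<in> nbrs E u \<and> along_path (K u) w" using i n E p by (cases "u \<in> V") auto
  show "(w, u) \<in> Ep\<inverse> \<longleftrightarrow> u \<in> V \<and> w \<in> nbrs E u \<and> against_path (K u) w" using i n E p by (cases "u \<in> V") auto
  show "(w, u) \<in> Eo \<longleftrightarrow> u \<in> V \<and> w \<in> nbrs E u \<and> along_detour (K u) w" using i n E o by (cases "u \<in> V") auto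
  show "(w, u) \<in> Eo\<inverse> \<longleftrightarrow> u \<in> V \<and> w \<in> nbrs E u \<and> against_detour (K u) w" using i n E o by (cases "u \<in> V") auto
qed

definition ecc_s :: nat where "ecc_s = Max ((\<lambda>u. LEAST k. (s, u) \<in> U ^^ k) ` V)"

lemma reach_U: "u \<in> V \<Longrightarrow> w \<in> V \<Longrightarrow> \<exists>k. gdist (uedges E) u w = enat k \<and> at_distance U u w k"
proof -
  assume "u \<in> V" "w \<in> V"
  then have "gdist (uedges E) u w < \<infinity>" using conn by (auto simp: uconnected_def)
  from gdist_attained[OF this] obtain k where k: "gdist (uedges E) u w = enat k" "(u, w) \<in> uedges E ^^ k" by blast
  from relpow_without_loops[OF k(2)] obtain j where j: "j \<le> k" "(u, w) \<in> U ^^ j" unfolding U_def by blast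
  have sub: "U \<subseteq> uedges E" by (auto simp: U_def)
  have le: "k \<le> i" if "(u, w) \<in> U ^^ i" for i
    using gdist_le[OF relpow_mono_rel[OF sub that]] k(1) by simp
  have "j = k" using le[OF j(2)] j(1) by simp
  then have "at_distance U u w k" using j(2) le unfolding at_distance_def by fastforce
  then show ?thesis using k by blast
qed

lemma least_at_distance: "at_distance H x y d \<Longrightarrow> (LEAST k. (x, y) \<in> H ^^ k) = d"
  by (rule Least_equality) (auto intro: at_distanceD at_distance_le)

lemma census_here:
  assumes "base K"
  shows "census_run (nbrs E) V msgs K is_s U s"
proof
  show "\<forall>u\<in>V. nbrs E u \<subseteq> V" by (rule nbrs_V)
  show "\<exists>k. (s, u) \<in> U ^^ k" if "u \<in> V" for u using reach_U[OF sV that] by (auto dest: at_distanceD)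
  show "[x] \<in> msgs \<and> [x, y] \<in> msgs" if "x < card V" "y < card V" for x y using that B_large by (simp add: msg_set_def)
  show "is_s (K u) \<longleftrightarrow> u = s" if "u \<in> V" for u using assms that by (simp add: base_def)
qed (rule finV sV U_iff sym_U)+

lemma ecc_s_height: "base K \<Longrightarrow> census_run.height V U s = ecc_s"
proof -
  assume "base K"
  then interpret C: census_run "nbrs E" V msgs K is_s "\<lambda>k _. k" U s by (rule census_here)
  show ?thesis unfolding C.height_def C.depth_def ecc_s_def ..
qed

lemma ecc_s_less: "base K \<Longrightarrow> ecc_s < card V"
proof -
  assume b: "base K"
  then interpret C: census_run "nbrs E" V msgs K is_s "\<lambda>k _. k" U s by (rule census_here)
  show ?thesis using C.height_less ecc_s_height[OF b] by simp
qed

lemma ecc_s_ge: "at_distance U s u d \<Longrightarrow> u \<in> V \<Longrightarrow> d \<le> ecc_s"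
  unfolding ecc_s_def using finV by (auto intro!: Max_ge image_eqI dest!: least_at_distance)

lemma ecc_s_le: "ecc_s \<le> udiam V E"
proof -
  let ?D = "{the_enat (gdist (uedges E) u w) | u w. u \<in> V \<and> w \<in> V}"
  have fin: "finite ?D"
  proof -
    have "?D = (\<lambda>(u, w). the_enat (gdist (uedges E) u w)) ` (V \<times> V)" by auto
    then show ?thesis using finV by simp
  qed
  have "ecc_s \<in> (\<lambda>u. LEAST k. (s, u) \<in> U ^^ k) ` V"
    unfolding ecc_s_def using finV sV by (intro Max_in) auto
  then obtain u where u: "u \<in> V" "ecc_s = (LEAST k. (s, u) \<in> U ^^ k)" by auto
  obtain k where k: "gdist (uedges E) s u = enat k" "at_distance U s u k" using reach_U[OF sV u(1)] by blast
  then have "ecc_s = k" using u least_at_distance by simp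
  then have "ecc_s \<in> ?D" using k u sV by force
  then show ?thesis unfolding udiam_def using fin by (intro Max_ge)
qed

lemma two_ecc: "u \<in> V \<Longrightarrow> w \<in> V \<Longrightarrow> \<exists>k\<le>2 * ecc_s. (u, w) \<in> U ^^ k"
proof -
  assume uw: "u \<in> V" "w \<in> V"
  obtain i j where i: "at_distance U s u i" and j: "at_distance U s w j" using reach_U sV uw by meson
  have "(u, w) \<in> U ^^ (i + j)"
    using relpow_trans'[OF sym_relpow[OF sym_U at_distanceD[OF i]] at_distanceD[OF j]] .
  moreover have "i + j \<le> 2 * ecc_s" using ecc_s_ge[OF i uw(1)] ecc_s_ge[OF j uw(2)] by simp
  ultimately show ?thesis by blast
qed

text \<open>Entries are lengths of walks, not always minimal ones. Completeness is limited to walks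
  of length \<open>z\<close>, since the remaining \<open>m\<close> rounds absorb the delay caused by
  other tokens.\<close>

definition lm_dists :: "(nat \<times> nat) set \<Rightarrow> nat \<Rightarrow> (nat \<times> nat) set \<Rightarrow> bool" where
  "lm_dists H u A \<longleftrightarrow>
     (\<forall>d l. (d, list_encode [l]) \<in> A \<longrightarrow> l \<in> L \<and> (l, u) \<in> H ^^ d \<and> d \<le> z + m) \<and>
     (\<forall>d l. l \<in> L \<and> (l, u) \<in> H ^^ d \<and> d \<le> z \<longrightarrow> (\<exists>d'\<le>d. (d', list_encode [l]) \<in> A))"

lemma list_encode_eq' [simp]: "list_encode xs = list_encode ys \<longleftrightarrow> xs = ys"
  by (metis list_encode_inverse)

lemma flood_landmarks:
  assumes K: "base K" and H: "\<And>u w. (w, u) \<in> H \<longleftrightarrow> u \<in> V \<and> w \<in> nbrs E u \<and> F (K u) w"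
  shows "\<exists>Q. computes_here (flood horizon F lm_token upd) K (z + m) (\<lambda>u. upd (K u) (Q u)) \<and> (\<forall>u\<in>V. lm_dists H u (Q u))"
proof -
  have tok: "lm_token (K u) = (if u \<in> L then {list_encode [u]} else {})" if "u \<in> V" for u
    using K that by (simp add: base_def lm_token_def)
  have toks: "(\<Union>u\<in>V. lm_token (K u)) = (\<lambda>l. list_encode [l]) ` L" using tok L_V by auto
  interpret F: flooding "nbrs E" V msgs K horizon F lm_token upd H "z + m"
  proof
    show "\<forall>u\<in>V. nbrs E u \<subseteq> V" by (rule nbrs_V)
    show "finite (\<Union>u\<in>V. lm_token (K u))" unfolding toks using finL by simp
    show "d # list_decode e \<in> msgs" if "u \<in> V" "e \<in> lm_token (K u)" "d \<le> z + m" for u d e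
      using that tok B_V[of u] B_large by (auto simp: msg_set_def split: if_splits)
  qed (use K H in \<open>auto simp: horizon_def base_def\<close>)
  have card: "card (\<Union>u\<in>V. lm_token (K u)) \<le> m"
    unfolding toks using card_image_le[OF finL, of "\<lambda>l. list_encode [l]"] card_L by simp
  have reach: "reaches V (\<lambda>u. lm_token (K u)) H d u (list_encode [l]) \<longleftrightarrow> l \<in> L \<and> (l, u) \<in> H ^^ d" for d u l
    using tok L_V by (auto simp: reaches_def split: if_splits)
  from F.flood_correct obtain Q where Q: "computes_here (flood horizon F lm_token upd) K (z + m) (\<lambda>u. upd (K u) (Q u))"
    "\<And>u d e. u \<in> V \<Longrightarrow> (d, e) \<in> Q u \<Longrightarrow> d \<le> z + m \<and> reaches V (\<lambda>u. lm_token (K u)) H d u e"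
    "\<And>u d e. u \<in> V \<Longrightarrow> reaches V (\<lambda>u. lm_token (K u)) H d u e \<Longrightarrow> d + card (\<Union>u\<in>V. lm_token (K u)) \<le> z + m
       \<Longrightarrow> \<exists>d'\<le>d. (d', e) \<in> Q u" by blast
  have "lm_dists H u (Q u)" if u: "u \<in> V" for u
    unfolding lm_dists_def
  proof (intro conjI allI impI)
    fix d l assume "(d, list_encode [l]) \<in> Q u"
    from Q(2)[OF u this] show "l \<in> L" "(l, u) \<in> H ^^ d" "d \<le> z + m" unfolding reach by auto
  next
    fix d l assume "l \<in> L \<and> (l, u) \<in> H ^^ d \<and> d \<le> z"
    then show "\<exists>d'\<le>d. (d', list_encode [l]) \<in> Q u" using Q(3)[OF u, of d "list_encode [l]"] reach card by auto
  qed
  then show ?thesis using Q(1) by blast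
qed

text \<open>Two vertices are at most \<open>2 * ecc_s\<close> apart, via \<open>s\<close>, and
  \<open>c\<close> rounds absorb the delays. Soundness and completeness meet, so all vertices end
  with exactly the same set of tokens.\<close>

lemma gossip:
  assumes K: "base K" "\<And>u. u \<in> V \<Longrightarrow> ecc (K u) = ecc_s"
    and S: "finite (\<Union>u\<in>V. S (K u))" "card (\<Union>u\<in>V. S (K u)) \<le> c"
    and R: "\<And>u. u \<in> V \<Longrightarrow> R (K u) = 2 * ecc_s + c"
    and msg: "\<And>u d e. u \<in> V \<Longrightarrow> e \<in> S (K u) \<Longrightarrow> d \<le> 2 * ecc_s + c \<Longrightarrow> d # list_decode e \<in> msgs"
  shows "computes_here (flood R (\<lambda>_ _. True) S (\<lambda>k A. f k (snd ` A))) K (2 * ecc_s + c)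
    (\<lambda>u. f (K u) (\<Union>u\<in>V. S (K u)))"
proof -
  interpret F: flooding "nbrs E" V msgs K R "\<lambda>_ _. True" S "\<lambda>k A. f k (snd ` A)" U "2 * ecc_s + c"
    using nbrs_V U_iff R S msg by unfold_locales auto
  from F.flood_correct obtain Q where Q: "computes_here (flood R (\<lambda>_ _. True) S (\<lambda>k A. f k (snd ` A))) K (2 * ecc_s + c)
     (\<lambda>u. f (K u) (snd ` Q u))"
    "\<And>u d e. u \<in> V \<Longrightarrow> (d, e) \<in> Q u \<Longrightarrow> d \<le> 2 * ecc_s + c \<and> reaches V (\<lambda>u. S (K u)) U d u e"
    "\<And>u d e. u \<in> V \<Longrightarrow> reaches V (\<lambda>u. S (K u)) U d u e \<Longrightarrow> d + card (\<Union>u\<in>V. S (K u)) \<le> 2 * ecc_s + c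
       \<Longrightarrow> \<exists>d'\<le>d. (d', e) \<in> Q u" by blast
  have eq: "snd ` Q u = (\<Union>u\<in>V. S (K u))" if u: "u \<in> V" for u
  proof (intro equalityI subsetI)
    fix e assume "e \<in> snd ` Q u"
    then obtain d where "(d, e) \<in> Q u" by auto
    then show "e \<in> (\<Union>u\<in>V. S (K u))" using Q(2)[OF u] by (auto simp: reaches_def)
  next
    fix e assume "e \<in> (\<Union>u\<in>V. S (K u))"
    then obtain w where w: "w \<in> V" "e \<in> S (K w)" by blast
    obtain k where k: "k \<le> 2 * ecc_s" "(w, u) \<in> U ^^ k" using two_ecc[OF w(1) u] by blast
    then have "\<exists>d'\<le>k. (d', e) \<in> Q u" using Q(3)[OF u, of k e] w S(2) by (auto simp: reaches_def)
    then show "e \<in> snd ` Q u" by force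
  qed
  show ?thesis using Q(1) eq unfolding computes_def by simp
qed

end

subsection \<open>Correctness of the phases\<close>

lemma relpow_converse_iff: "(x, y) \<in> ((R :: ('a \<times> 'a) set)\<inverse>) ^^ k \<longleftrightarrow> (y, x) \<in> R ^^ k"
proof (induction k arbitrary: y)
  case (Suc k)
  have "(x, y) \<in> (R\<inverse>) ^^ Suc k \<longleftrightarrow> (\<exists>w. (x, w) \<in> (R\<inverse>) ^^ k \<and> (y, w) \<in> R)" by auto
  also have "\<dots> \<longleftrightarrow> (\<exists>w. (y, w) \<in> R \<and> (w, x) \<in> R ^^ k)" using Suc by auto
  also have "\<dots> \<longleftrightarrow> (y, x) \<in> R ^^ Suc k" by (metis relpow_Suc_D2 relpow_Suc_I2)
  finally show ?case .
qed auto

declare list_encode.simps [simp del]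

context rpaths_run
begin

section \<open>Positions on the path and the invariants between phases\<close>

definition idx :: "nat \<Rightarrow> nat option" where
  "idx u = (if \<exists>i\<le>len. u = P ! i then Some (THE i. i \<le> len \<and> u = P ! i) else None)"

lemma the_index: "i \<le> len \<Longrightarrow> (THE j. j \<le> len \<and> P ! i = P ! j) = i"
  by (rule the_equality) (auto simp: P_inj)

lemma idx_P [simp]: "i \<le> len \<Longrightarrow> idx (P ! i) = Some i"
  unfolding idx_def using the_index by auto

lemma idx_SomeD: "idx u = Some i \<Longrightarrow> i \<le> len \<and> u = P ! i"
  unfolding idx_def using the_index by (auto split: if_splits)

text \<open>The invariants for tables have two halves: every finite entry is the length of an actual
  walk, and the walks within the window bound the entries from above. Minima of such entries are
  then never too small, and they are small enough as soon as one optimal detour is covered.\<close>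

definition inv1 where "inv1 K \<longleftrightarrow> base K \<and> (\<forall>u\<in>V. ecc (K u) = ecc_s)"
definition inv2 where "inv2 K \<longleftrightarrow> inv1 K \<and> (\<forall>u\<in>V. lm_dists Ep u (near (K u)))"
definition inv3 where "inv3 K \<longleftrightarrow> inv1 K \<and> (\<forall>u\<in>V. index (K u) = idx u \<and> plen (K u) = len \<and>
  lms (K u) = sorted_list_of_set L \<and> pos (K u) = (\<lambda>l i. l \<in> L \<and> i \<le> len \<and> l = P ! i))"
definition inv4 where "inv4 K \<longleftrightarrow> inv3 K \<and> (\<forall>u\<in>V.
  (\<forall>d b. d \<le> z \<and> b \<le> len \<and> (u, P ! b) \<in> Eo ^^ d \<longrightarrow> to_end (K u) d \<le> enat (len - b)) \<and>
  (\<forall>d x. d \<le> z \<and> to_end (K u) d = enat x \<longrightarrow> (\<exists>b\<le>len. x = len - b \<and> (u, P ! b) \<in> Eo ^^ d)))"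
definition inv5 where "inv5 K \<longleftrightarrow> inv3 K \<and> (\<forall>i<len.
  (\<forall>a b d. (a, b, d) \<in> detours i \<and> d \<le> z \<longrightarrow> short (K (P ! i)) \<le> enat (a + d + (len - b))) \<and>
  (\<forall>x. short (K (P ! i)) = enat x \<longrightarrow> (\<exists>a b d. (a, b, d) \<in> detours i \<and> x = a + d + (len - b))))"
definition inv6 where "inv6 K \<longleftrightarrow> inv5 K \<and> (\<forall>u\<in>V. lm_dists Eo u (from_lm (K u)))"
definition inv7 where "inv7 K \<longleftrightarrow> inv6 K \<and> (\<forall>u\<in>V. lm_dists (Eo\<inverse>) u (to_lm (K u)))"
definition inv8 where "inv8 K \<longleftrightarrow> inv7 K \<and>
  (\<forall>u\<in>V. \<forall>l x. leave (K u) l = enat x \<longrightarrow>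
     (\<exists>i a d. i \<le> len \<and> u = P ! i \<and> a \<le> i \<and> x = a + d \<and> (P ! a, l) \<in> Eo ^^ d \<and> d \<le> z + m)) \<and>
  (\<forall>i a l d. i \<le> len \<and> l \<in> L \<and> a \<le> i \<and> i \<le> a + z \<and> d \<le> z \<and> (P ! a, l) \<in> Eo ^^ d \<longrightarrow>
     leave (K (P ! i)) l \<le> enat (a + d))"
definition inv9 where "inv9 K \<longleftrightarrow> inv8 K \<and>
  (\<forall>u\<in>V. \<forall>l y. rejoin (K u) l = enat y \<longrightarrow>
     (\<exists>i b d. u = P ! i \<and> i \<le> b \<and> b \<le> len \<and> y = d + (len - b) \<and> (l, P ! b) \<in> Eo ^^ d \<and> d \<le> z + m)) \<and>
  (\<forall>i b l d. l \<in> L \<and> i \<le> b \<and> b \<le> i + z \<and> b \<le> len \<and> d \<le> z \<and> (l, P ! b) \<in> Eo ^^ d \<longrightarrow>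
     rejoin (K (P ! i)) l \<le> enat (d + (len - b))) \<and>
  (\<forall>i\<le>len. \<forall>l y. rejoin_after (K (P ! i)) l = enat y \<longrightarrow>
     (\<exists>b d. i < b \<and> b \<le> len \<and> y = d + (len - b) \<and> (l, P ! b) \<in> Eo ^^ d)) \<and>
  (\<forall>i b l d. l \<in> L \<and> i < b \<and> b \<le> i + z \<and> b \<le> len \<and> d \<le> z \<and> (l, P ! b) \<in> Eo ^^ d \<longrightarrow>
     rejoin_after (K (P ! i)) l \<le> enat (d + (len - b)))"

lemma phase0: "base K \<Longrightarrow> \<exists>K'. computes_here phase0 K (4 * ecc_s + 4) K' \<and> inv1 K'"
proof -
  assume b: "base K"
  then interpret C: census_run "nbrs E" V msgs K is_s "\<lambda>k e. k\<lparr>ecc := e\<rparr>" U s by (rule census_here)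
  have "inv1 (\<lambda>u. (K u)\<lparr>ecc := ecc_s\<rparr>)" using b by (simp add: inv1_def base_def)
  then show ?thesis using C.computes_census ecc_s_height[OF b] unfolding phase0_def by auto
qed

lemma phase1: "inv1 K \<Longrightarrow> \<exists>K'. computes_here phase1 K (z + m) K' \<and> inv2 K'"
proof -
  assume K: "inv1 K"
  then have b: "base K" by (simp add: inv1_def)
  from flood_landmarks[OF b filters(1)[OF b], of "\<lambda>k A. k\<lparr>near := A\<rparr>"] obtain Q where
    Q: "computes_here phase1 K (z + m) (\<lambda>u. (K u)\<lparr>near := Q u\<rparr>)" "\<forall>u\<in>V. lm_dists Ep u (Q u)"
    unfolding phase1_def by blast
  have "inv2 (\<lambda>u. (K u)\<lparr>near := Q u\<rparr>)" using K Q(2) by (simp add: inv1_def inv2_def base_def)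
  then show ?thesis using Q(1) by blast
qed

lemma Ep_length_unique:
  assumes "(x, y) \<in> Ep ^^ d" "(x, y) \<in> Ep ^^ d'"
  shows "d = d'"
proof (cases "\<exists>i\<le>len. x = P ! i")
  case True
  then obtain i where i: "i \<le> len" "x = P ! i" by blast
  then show ?thesis using Ep_walk_from[OF i(1)] assms P_inj[of "i + d" "i + d'"] by auto
next
  case False
  have zero: "k = 0" if xy: "(x, y) \<in> Ep ^^ k" for k
  proof (cases k)
    case (Suc k')
    then obtain w where "(x, w) \<in> Ep" using relpow_Suc_D2[of x y k' Ep] xy by auto
    then obtain i where "i < len" "x = P ! i" using length_P by (auto simp: Ep_def path_edges_def)
    then have "\<exists>i\<le>len. x = P ! i" by (intro exI[of _ i]) simp
    then show ?thesis using False by blast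
  qed
  show ?thesis using zero[OF assms(1)] zero[OF assms(2)] by simp
qed

lemma at_distance_Ep: "(x, y) \<in> Ep ^^ d \<Longrightarrow> at_distance Ep x y d"
  unfolding at_distance_def using Ep_length_unique by blast

lemma locate_correct:
  assumes K: "inv2 K" and u: "u \<in> V"
  shows "locate (K u) (\<Union>u\<in>V. path_tokens (K u)) = (K u)\<lparr>index := idx u, plen := len,
    lms := sorted_list_of_set L, pos := (\<lambda>l i. l \<in> L \<and> i \<le> len \<and> l = P ! i)\<rparr>"
proof -
  let ?X = "\<Union>u\<in>V. path_tokens (K u)"
  define W where "W = {(l, l', d). list_encode [l, l', d] \<in> ?X}"
  have b: "me (K u) = u" "mark (K u) = (u \<in> L)" "is_s (K u) = (u = s)" "is_t (K u) = (u = t)"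
    and near: "lm_dists Ep u (near (K u))" if "u \<in> V" for u
    using K that by (auto simp: inv2_def inv1_def base_def)
  have W: "(l, l', d) \<in> W \<longleftrightarrow> l' \<in> L \<and> (d, list_encode [l]) \<in> near (K l')" for l l' d
    using b L_V by (auto simp: W_def path_tokens_def split: if_splits)
  have src: "list_encode [x] \<in> ?X \<longleftrightarrow> x = s" for x
    using b sV by (auto simp: path_tokens_def split: if_splits)
  have tgt: "list_encode [x, x] \<in> ?X \<longleftrightarrow> x = t" for x
    using b tV by (auto simp: path_tokens_def split: if_splits)
  \<comment> \<open>Walks along \<open>P\<close> with the same ends have equal length, so a table
    entry is exact as soon as it exists.\<close>
  have near_iff: "(d, list_encode [l]) \<in> near (K u) \<longleftrightarrow> l \<in> L \<and> (l, u) \<in> Ep ^^ d"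
    if u: "u \<in> V" and d: "d \<le> z" for u l d
  proof
    assume "l \<in> L \<and> (l, u) \<in> Ep ^^ d"
    then obtain d' where "d' \<le> d" "(d', list_encode [l]) \<in> near (K u)"
      using near[OF u] d unfolding lm_dists_def by blast
    moreover then have "(l, u) \<in> Ep ^^ d'" using near[OF u] unfolding lm_dists_def by blast
    ultimately show "(d, list_encode [l]) \<in> near (K u)"
      using Ep_length_unique \<open>l \<in> L \<and> (l, u) \<in> Ep ^^ d\<close> by blast
  qed (use near[OF u] in \<open>auto simp: lm_dists_def\<close>)
  have Wsound: "l \<in> L \<and> l' \<in> L \<and> (l, l') \<in> Ep ^^ d" if "(l, l', d) \<in> W" for l l' d
    using that near L_V unfolding W lm_dists_def by blast
  have Wcomplete: "(l, l', j) \<in> W" if "l \<in> L" "l' \<in> L" "at_distance Ep l l' j" "j \<le> z" for l l' j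
    unfolding W using near_iff[of l' j l] that L_V at_distanceD[OF that(3)] by auto
  have sound: "(s, l) \<in> Ep ^^ d" if "overlay W s l d" for l d
    using overlay_sound[OF that] Wsound by blast
  have overlay_L: "l \<in> L" if "overlay W s l d" for l d
    using that by cases (use sL Wsound in auto)
  \<comment> \<open>From \<open>s\<close> one jumps along landmarks until position \<open>i\<close>
    is at most \<open>z\<close> steps ahead.\<close>
  have reach: "\<exists>l\<in>L. \<exists>d j. overlay W s l d \<and> (l, P ! i) \<in> Ep ^^ j \<and> j \<le> z \<and> i = d + j" if "i \<le> len" for i
    using overlay_complete[OF hit_path Wcomplete sL at_distance_Ep[of s "P ! i" i]] P_walk[of 0 i] P_0 that
      at_distanceD by fastforce
  have pos: "overlay W s l i \<longleftrightarrow> l \<in> L \<and> i \<le> len \<and> l = P ! i" for l i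
  proof
    assume o: "overlay W s l i"
    then show "l \<in> L \<and> i \<le> len \<and> l = P ! i" using overlay_L Ep_walk_from[of 0 l i] sound[OF o] P_0 by auto
  next
    assume l: "l \<in> L \<and> i \<le> len \<and> l = P ! i"
    then obtain l' d j where l': "l' \<in> L" "overlay W s l' d" "(l', l) \<in> Ep ^^ j" "j \<le> z" "i = d + j"
      using reach[of i] by blast
    then have "(l', l, j) \<in> W" using Wcomplete at_distance_Ep l by blast
    then show "overlay W s l i" using overlay_step[OF l'(2)] l'(5) by simp
  qed
  have pos_eq: "overlay W s = (\<lambda>l i. l \<in> L \<and> i \<le> len \<and> l = P ! i)" using pos by (intro ext) simp
  have I: "{i. \<exists>l d d'. overlay W s l d \<and> (d', list_encode [l]) \<in> near (K u) \<and> i = d + d'}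
     = {i. i \<le> len \<and> u = P ! i}" (is "?I = ?J")
  proof (intro equalityI subsetI)
    fix i assume "i \<in> ?I"
    then obtain l d d' where l: "overlay W s l d" "(d', list_encode [l]) \<in> near (K u)" "i = d + d'" by blast
    then have "(l, u) \<in> Ep ^^ d'" using near[OF u] by (auto simp: lm_dists_def)
    then have "(s, u) \<in> Ep ^^ i" using relpow_trans'[OF sound[OF l(1)]] l(3) by blast
    then show "i \<in> ?J" using Ep_walk_from[of 0 u i] P_0 by simp
  next
    fix i assume i: "i \<in> ?J"
    then obtain l d j where l: "l \<in> L" "overlay W s l d" "(l, u) \<in> Ep ^^ j" "j \<le> z" "i = d + j"
      using reach[of i] by blast
    then show "i \<in> ?I" using near_iff[OF u, of j l] by blast
  qed
  have "(THE x. list_encode [x] \<in> ?X) = s" "(THE x. list_encode [x, x] \<in> ?X) = t"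
    unfolding src tgt by (rule the_equality; simp)+
  moreover have "(THE i. overlay W s t i) = len"
    unfolding pos using tL P_len P_inj[of len] by (intro the_equality) auto
  moreover have "{l. list_encode [l, l, 0] \<in> ?X} = L"
  proof -
    have "list_encode [l, l, 0] \<in> ?X \<longleftrightarrow> (l, l, 0) \<in> W" for l by (simp add: W_def)
    moreover have "(l, l, 0) \<in> W \<longleftrightarrow> l \<in> L" for l
      using W[of l l 0] near_iff[of l 0 l] L_V by auto
    ultimately show ?thesis by simp
  qed
  moreover have "(if ?J = {} then None else Some (THE i. i \<in> ?J)) = idx u"
    by (auto simp: idx_def)
  ultimately show ?thesis
    unfolding locate_def Let_def W_def[symmetric] by (simp only: I[unfolded pos_eq] pos_eq)
qed

lemma phase2: "inv2 K \<Longrightarrow> \<exists>K'. computes_here phase2 K (2 * ecc_s + (m * m + 2)) K' \<and> inv3 K'"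
proof -
  assume K: "inv2 K"
  have b: "base K" "\<And>u. u \<in> V \<Longrightarrow> ecc (K u) = ecc_s" using K by (auto simp: inv2_def inv1_def)
  have kb: "me (K u) = u" "mark (K u) = (u \<in> L)" "is_s (K u) = (u = s)" "is_t (K u) = (u = t)" "cap (K u) = m"
    and near: "lm_dists Ep u (near (K u))" if "u \<in> V" for u
    using K that by (auto simp: inv2_def inv1_def base_def)
  \<comment> \<open>The distance in a token is determined by the pair of landmarks, so there are at
    most \<open>m * m\<close> tokens besides the two for the ends of \<open>P\<close>.\<close>
  let ?f = "\<lambda>(l, u). list_encode [l, u, THE d. (l, u) \<in> Ep ^^ d]"
  have sub: "(\<Union>u\<in>V. path_tokens (K u)) \<subseteq> ?f ` (L \<times> L) \<union> {list_encode [s], list_encode [t, t]}"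
  proof
    fix e assume "e \<in> (\<Union>u\<in>V. path_tokens (K u))"
    then obtain u where u: "u \<in> V" "e \<in> path_tokens (K u)" by blast
    then consider "e = list_encode [s]" | "e = list_encode [t, t]"
      | l d where "u \<in> L" "e = list_encode [l, u, d]" "(d, list_encode [l]) \<in> near (K u)"
      using kb[OF u(1)] by (auto simp: path_tokens_def split: if_splits)
    then show "e \<in> ?f ` (L \<times> L) \<union> {list_encode [s], list_encode [t, t]}"
    proof cases
      case (3 l d)
      then have l: "l \<in> L" "(l, u) \<in> Ep ^^ d" using near[OF u(1)] by (auto simp: lm_dists_def)
      then have "(THE d. (l, u) \<in> Ep ^^ d) = d" using Ep_length_unique by blast
      then have "e = ?f (l, u)" using 3 by simp
      then show ?thesis using l 3 by blast
    qed auto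
  qed
  have fin: "finite (?f ` (L \<times> L) \<union> {list_encode [s], list_encode [t, t]})" using finL by simp
  have "card (?f ` (L \<times> L) \<union> {list_encode [s], list_encode [t, t]})
      \<le> card (?f ` (L \<times> L)) + card {list_encode [s], list_encode [t, t]}" by (rule card_Un_le)
  also have "\<dots> \<le> card (L \<times> L) + 2"
    using card_image_le[of "L \<times> L" ?f] finL by (intro add_mono) (auto simp: card_insert_if)
  also have "\<dots> \<le> m * m + 2" using card_L by (simp add: card_cartesian_product mult_le_mono)
  finally have card: "card (\<Union>u\<in>V. path_tokens (K u)) \<le> m * m + 2"
    using card_mono[OF fin sub] by simp
  have msg: "d # list_decode e \<in> msgs" if "u \<in> V" "e \<in> path_tokens (K u)" "d \<le> 2 * ecc_s + (m * m + 2)" for u d e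
  proof -
    have d: "d < B" using that(3) ecc_s_less[OF b(1)] B_large by simp
    have "d' < B \<and> l < B" if "(d', list_encode [l]) \<in> near (K u)" for d' l
    proof -
      have "l \<in> L" "d' \<le> z + m" using that near[OF \<open>u \<in> V\<close>] by (auto simp: lm_dists_def)
      then show ?thesis using B_large B_V[of l] L_V by auto
    qed
    then show ?thesis using that(2) kb[OF that(1)] d B_V[OF that(1)]
      by (auto simp: path_tokens_def msg_set_def split: if_splits)
  qed
  have "computes_here phase2 K (2 * ecc_s + (m * m + 2)) (\<lambda>u. locate (K u) (\<Union>u\<in>V. path_tokens (K u)))"
    unfolding phase2_def
    by (rule gossip[OF b finite_subset[OF sub fin] card _ msg]) (auto simp: kb b)
  moreover have "inv3 (\<lambda>u. locate (K u) (\<Union>u\<in>V. path_tokens (K u)))"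
    using K by (simp add: inv3_def inv2_def inv1_def base_def locate_correct[OF K])
  ultimately show ?thesis by blast
qed

lemma phase3: "inv3 K \<Longrightarrow> \<exists>K'. computes_here phase3 K z K' \<and> inv4 K'"
proof -
  assume K: "inv3 K"
  have b: "base K" using K by (simp add: inv3_def inv1_def)
  have k: "index (K u) = idx u" "plen (K u) = len" "win (K u) = z" if "u \<in> V" for u
    using K that by (auto simp: inv3_def inv1_def base_def)
  have own: "end_offset (K u) r = enat x \<longleftrightarrow> (\<exists>b\<le>len. u = P ! b \<and> r = 0 \<and> x = len - b)" if "u \<in> V" for u r x
    using k[OF that] by (auto simp: end_offset_def split: option.splits dest: idx_SomeD)
  interpret F: wavefront "nbrs E" V msgs K win against_detour end_offset
    "\<lambda>k Q. k\<lparr>to_end := (\<lambda>r. min (end_offset k r) (Q r))\<rparr>" "Eo\<inverse>" z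
  proof
    show "[a] \<in> msgs" if "u \<in> V" "r < z" "end_offset (K u) r = enat a" for u r a
      using that own len_less B_large by (auto simp: msg_set_def)
  qed (use nbrs_V filters(4)[OF b] k in auto)
  from F.wave_correct obtain Q where Q:
    "computes_here phase3 K z (\<lambda>u. (K u)\<lparr>to_end := (\<lambda>r. min (end_offset (K u) r) (Q u r))\<rparr>)"
    "\<And>u w k r. u \<in> V \<Longrightarrow> (w, u) \<in> (Eo\<inverse>) ^^ k \<Longrightarrow> 0 < k \<Longrightarrow> k \<le> r \<Longrightarrow> r \<le> z \<Longrightarrow> Q u r \<le> end_offset (K w) (r - k)"
    "\<And>u r a. u \<in> V \<Longrightarrow> r \<le> z \<Longrightarrow> Q u r = enat a \<Longrightarrow>
      \<exists>w k. w \<in> V \<and> (w, u) \<in> (Eo\<inverse>) ^^ k \<and> 0 < k \<and> k \<le> r \<and> end_offset (K w) (r - k) = enat a"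
    unfolding phase3_def by blast
  have complete: "min (end_offset (K u) d) (Q u d) \<le> enat (len - b)"
    if "u \<in> V" "d \<le> z" "b \<le> len" "(u, P ! b) \<in> Eo ^^ d" for u d b
  proof (cases "d = 0")
    case True
    then have "end_offset (K u) d = enat (len - b)" using own that by auto
    then show ?thesis by simp
  next
    case False
    have "Q u d \<le> end_offset (K (P ! b)) (d - d)" using Q(2)[OF that(1), of "P ! b" d d] that False by (simp add: relpow_converse_iff)
    also have "end_offset (K (P ! b)) (d - d) = enat (len - b)" using own P_V that by auto
    finally show ?thesis by (simp add: min.coboundedI2)
  qed
  have sound: "\<exists>b\<le>len. x = len - b \<and> (u, P ! b) \<in> Eo ^^ d"
    if u: "u \<in> V" and d: "d \<le> z" and x: "min (end_offset (K u) d) (Q u d) = enat x" for u d x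
  proof (cases "end_offset (K u) d = enat x")
    case True
    then show ?thesis using own[OF u] by auto
  next
    case False
    then have "Q u d = enat x" using x by (auto simp: min_def split: if_splits)
    then obtain w k where w: "w \<in> V" "(w, u) \<in> (Eo\<inverse>) ^^ k" "k \<le> d" "end_offset (K w) (d - k) = enat x"
      using Q(3)[OF u d] by blast
    \<comment> \<open>\<open>end_offset\<close> is finite in round 0 only, so the walk has length
      exactly \<open>d\<close>.\<close>
    then obtain b where b: "b \<le> len" "w = P ! b" "d = k" "x = len - b" using own by auto
    have "(u, P ! b) \<in> Eo ^^ d" using w(2) unfolding relpow_converse_iff b(2,3) .
    then show ?thesis using b by blast
  qed
  have "inv4 (\<lambda>u. (K u)\<lparr>to_end := (\<lambda>r. min (end_offset (K u) r) (Q u r))\<rparr>)"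
    using K complete sound by (simp add: inv4_def inv3_def inv1_def base_def)
  then show ?thesis using Q(1) by blast
qed

lemma short_detour_sound:
  assumes K: "inv4 K" and u: "u \<in> V" and x: "short_detour (K u) r = enat x"
  shows "\<exists>l b d. l \<le> len \<and> u = P ! l \<and> b \<le> len \<and> d \<le> z \<and> (P ! l, P ! b) \<in> Eo ^^ d \<and> l + z \<le> b + r \<and> x = l + d + (len - b)"
proof -
  have k: "index (K u) = idx u" "plen (K u) = len" "win (K u) = z"
    using K u by (auto simp: inv4_def inv3_def inv1_def base_def)
  obtain l where l: "idx u = Some l" using x k by (cases "idx u") (auto simp: short_detour_def)
  have l': "l \<le> len" "u = P ! l" using idx_SomeD[OF l] by auto
  from x l k have "(INF d\<in>{d. d \<le> z \<and> (\<exists>y. to_end (K u) d = enat y \<and> l + z \<le> len - y + r)}. enat (l + d) + to_end (K u) d) = enat x"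
    by (simp add: short_detour_def)
  from INF_enat_attained[OF this] obtain d y where d: "d \<le> z" "to_end (K u) d = enat y" "l + z \<le> len - y + r"
      "enat (l + d) + to_end (K u) d = enat x" by blast
  obtain b where b: "b \<le> len" "y = len - b" "(u, P ! b) \<in> Eo ^^ d"
    using K u d(1,2) unfolding inv4_def by blast
  have "x = l + d + y" using d(2,4) by simp
  then show ?thesis using l' b d(1,3) by (intro exI[of _ l] exI[of _ b] exI[of _ d]) auto
qed

lemma short_detour_complete:
  assumes K: "inv4 K" and l: "l \<le> len" "b \<le> len" "d \<le> z" "(P ! l, P ! b) \<in> Eo ^^ d" "l + z \<le> b + r"
  shows "short_detour (K (P ! l)) r \<le> enat (l + d + (len - b))"
proof -
  let ?k = "K (P ! l)"
  have k: "index ?k = Some l" "plen ?k = len" "win ?k = z"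
    using K P_V l by (auto simp: inv4_def inv3_def inv1_def base_def)
  have "to_end ?k d \<le> enat (len - b)" using K l P_V unfolding inv4_def by blast
  then obtain x where x: "to_end ?k d = enat x" "x \<le> len - b" by (cases "to_end ?k d") auto
  have "short_detour ?k r \<le> enat (l + d) + to_end ?k d"
    unfolding short_detour_def k option.case using l x by (intro INF_lower) auto
  also have "\<dots> \<le> enat (l + d + (len - b))" using x by simp
  finally show ?thesis .
qed

lemma phase4: "inv4 K \<Longrightarrow> \<exists>K'. computes_here phase4 K z K' \<and> inv5 K'"
proof -
  assume K: "inv4 K"
  have b: "base K" using K by (simp add: inv4_def inv3_def inv1_def)
  have k: "win (K u) = z" if "u \<in> V" for u
    using K that by (auto simp: inv4_def inv3_def inv1_def base_def)
  interpret F: wavefront "nbrs E" V msgs K win along_path short_detour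
    "\<lambda>k Q. k\<lparr>short := min (short_detour k (win k - 1)) (Q (win k - 1))\<rparr>" Ep z
  proof
    show "[a] \<in> msgs" if "u \<in> V" "r < z" "short_detour (K u) r = enat a" for u r a
    proof -
      have "a < B" using short_detour_sound[OF K that(1,3)] len_less B_large by auto
      then show ?thesis by (simp add: msg_set_def)
    qed
  qed (use nbrs_V filters(1)[OF b] k in auto)
  from F.wave_correct obtain Q where Q:
    "computes_here phase4 K z (\<lambda>u. (K u)\<lparr>short := min (short_detour (K u) (win (K u) - 1)) (Q u (win (K u) - 1))\<rparr>)"
    "\<And>u w k r. u \<in> V \<Longrightarrow> (w, u) \<in> Ep ^^ k \<Longrightarrow> 0 < k \<Longrightarrow> k \<le> r \<Longrightarrow> r \<le> z \<Longrightarrow> Q u r \<le> short_detour (K w) (r - k)"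
    "\<And>u r a. u \<in> V \<Longrightarrow> r \<le> z \<Longrightarrow> Q u r = enat a \<Longrightarrow>
      \<exists>w k. w \<in> V \<and> (w, u) \<in> Ep ^^ k \<and> 0 < k \<and> k \<le> r \<and> short_detour (K w) (r - k) = enat a"
    unfolding phase4_def by blast
  have complete: "min (short_detour (K (P ! i)) (z - 1)) (Q (P ! i) (z - 1)) \<le> enat (a + d + (len - b))"
    if i: "i < len" and det: "(a, b, d) \<in> detours i" and d: "d \<le> z" for i a b d
  proof -
    have ab: "a \<le> i" "i < b" "b \<le> len" "(P ! a, P ! b) \<in> Eo ^^ d" using det by (auto simp: detours_def)
    have "Eo \<subseteq> E" by (auto simp: Eo_def)
    \<comment> \<open>A detour of length at most \<open>z\<close> bypasses at most \<open>z\<close>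
      edges, so its value reaches position \<open>i\<close> within the window.\<close>
    then have "b \<le> a + d" using P_geodesic[OF relpow_mono_rel[OF _ ab(4)]] ab i by simp
    then have near: "i < a + z" using ab d by simp
    show ?thesis
    proof (cases "a = i")
      case True
      then have "short_detour (K (P ! i)) (z - 1) \<le> enat (a + d + (len - b))"
        using short_detour_complete[OF K, of i b d "z - 1"] ab i d z_pos by simp
      then show ?thesis by (simp add: min.coboundedI1)
    next
      case False
      have "(P ! a, P ! i) \<in> Ep ^^ (i - a)" using P_walk ab i by simp
      \<comment> \<open>Among the rounds in which the value is injected at \<open>a\<close>, this is
        the one from which it reaches \<open>i\<close> at the reading time
        \<open>z - 1\<close>.\<close>
      then have "Q (P ! i) (z - 1) \<le> short_detour (K (P ! a)) (z - 1 - (i - a))"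
        using Q(2)[of "P ! i" "P ! a" "i - a" "z - 1"] P_V i ab near False by simp
      also have "\<dots> \<le> enat (a + d + (len - b))"
        using short_detour_complete[OF K, of a b d "z - 1 - (i - a)"] ab i d near by simp
      finally show ?thesis by (simp add: min.coboundedI2)
    qed
  qed
  have sound: "\<exists>a b d. (a, b, d) \<in> detours i \<and> x = a + d + (len - b)"
    if i: "i < len" and x: "min (short_detour (K (P ! i)) (z - 1)) (Q (P ! i) (z - 1)) = enat x" for i x
  proof (cases "short_detour (K (P ! i)) (z - 1) = enat x")
    case True
    obtain l b d where l: "l \<le> len" "P ! i = P ! l" "b \<le> len" "(P ! l, P ! b) \<in> Eo ^^ d" "l + z \<le> b + (z - 1)"
        "x = l + d + (len - b)"
      using short_detour_sound[OF K P_V[OF less_imp_le[OF i]] True] by blast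
    have "l = i" using P_inj[of i l] l i by simp
    then have "(l, b, d) \<in> detours i" using l z_pos by (auto simp: detours_def)
    then show ?thesis using l by blast
  next
    case False
    then have "Q (P ! i) (z - 1) = enat x" using x by (auto simp: min_def split: if_splits)
    then obtain w k where w: "w \<in> V" "(w, P ! i) \<in> Ep ^^ k" "0 < k" "k \<le> z - 1" "short_detour (K w) (z - 1 - k) = enat x"
      using Q(3)[of "P ! i" "z - 1" x] P_V i by auto
    obtain l b d where l: "l \<le> len" "w = P ! l" "b \<le> len" "(P ! l, P ! b) \<in> Eo ^^ d" "l + z \<le> b + (z - 1 - k)"
        "x = l + d + (len - b)"
      using short_detour_sound[OF K w(1,5)] by blast
    \<comment> \<open>The value moved \<open>k\<close> edges onward from \<open>l\<close>, so the
      injection condition turns into \<open>i < b\<close>.\<close>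
    have "l + k = i" using Ep_walk_from[OF l(1), of "P ! i" k] w(2) l(2) P_inj[of i "l + k"] i by simp
    then have "(l, b, d) \<in> detours i" using l w(3,4) by (auto simp: detours_def)
    then show ?thesis using l by blast
  qed
  have "inv5 (\<lambda>u. (K u)\<lparr>short := min (short_detour (K u) (win (K u) - 1)) (Q u (win (K u) - 1))\<rparr>)"
    using K complete sound k P_V by (simp add: inv5_def inv4_def inv3_def inv1_def base_def)
  then show ?thesis using Q(1) by blast
qed

lemma phase5: "inv5 K \<Longrightarrow> \<exists>K'. computes_here phase5 K (z + m) K' \<and> inv6 K'"
proof -
  assume K: "inv5 K"
  then have b: "base K" by (simp add: inv5_def inv3_def inv1_def)
  from flood_landmarks[OF b filters(3)[OF b], of "\<lambda>k A. k\<lparr>from_lm := A\<rparr>"] obtain Q where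
    Q: "computes_here phase5 K (z + m) (\<lambda>u. (K u)\<lparr>from_lm := Q u\<rparr>)" "\<forall>u\<in>V. lm_dists Eo u (Q u)"
    unfolding phase5_def by blast
  have "inv6 (\<lambda>u. (K u)\<lparr>from_lm := Q u\<rparr>)" using K Q(2) by (simp add: inv6_def inv5_def inv3_def inv1_def base_def)
  then show ?thesis using Q(1) by blast
qed

lemma phase6: "inv6 K \<Longrightarrow> \<exists>K'. computes_here phase6 K (z + m) K' \<and> inv7 K'"
proof -
  assume K: "inv6 K"
  then have b: "base K" by (simp add: inv6_def inv5_def inv3_def inv1_def)
  from flood_landmarks[OF b filters(4)[OF b], of "\<lambda>k A. k\<lparr>to_lm := A\<rparr>"] obtain Q where
    Q: "computes_here phase6 K (z + m) (\<lambda>u. (K u)\<lparr>to_lm := Q u\<rparr>)" "\<forall>u\<in>V. lm_dists (Eo\<inverse>) u (Q u)"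
    unfolding phase6_def by blast
  have "inv7 (\<lambda>u. (K u)\<lparr>to_lm := Q u\<rparr>)" using K Q(2) by (simp add: inv7_def inv6_def inv5_def inv3_def inv1_def base_def)
  then show ?thesis using Q(1) by blast
qed

end

context rpaths_run
begin

section \<open>Tables for leaving and rejoining the path, and their combination\<close>

abbreviation "lm_list \<equiv> sorted_list_of_set L"

lemma length_lm_list: "length lm_list = card L" "0 < card L"
  using finL sL by (auto simp: card_gt_0_iff)

text \<open>\<open>card L\<close> consecutive numbers run through all residues, so that many
  consecutive rounds give every landmark its turn.\<close>

lemma lm_list_nth:
  assumes "l \<in> L"
  shows "\<exists>j<card L. lm_list ! ((c + j) mod card L) = l"
proof -
  have "l \<in> set lm_list" using finL assms by simp
  then obtain \<kappa> where \<kappa>: "\<kappa> < card L" "lm_list ! \<kappa> = l"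
    using length_lm_list by (auto simp: in_set_conv_nth)
  obtain j where "j < card L" "(c + j) mod card L = \<kappa>" using ex_mod_eq[OF \<kappa>(1)] by blast
  then show ?thesis using \<kappa> by auto
qed

lemma fields:
  assumes "inv3 K" "u \<in> V"
  shows "index (K u) = idx u" "plen (K u) = len" "lms (K u) = lm_list" "win (K u) = z" "cap (K u) = m"
    "horizon (K u) = z + m" "me (K u) = u" "mark (K u) = (u \<in> L)" "ecc (K u) = ecc_s"
    "pos (K u) l j \<longleftrightarrow> l \<in> L \<and> j \<le> len \<and> l = P ! j"
  using assms by (auto simp: inv3_def inv1_def base_def horizon_def)

lemma lm_dists_sound: "lm_dists H u A \<Longrightarrow> lm_dist A l = enat d \<Longrightarrow> l \<in> L \<and> (l, u) \<in> H ^^ d \<and> d \<le> z + m"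
  unfolding lm_dists_def by (drule lm_dist_attained) blast

lemma lm_dists_complete: "lm_dists H u A \<Longrightarrow> l \<in> L \<Longrightarrow> (l, u) \<in> H ^^ d \<Longrightarrow> d \<le> z \<Longrightarrow> lm_dist A l \<le> enat d"
proof -
  assume "lm_dists H u A" "l \<in> L" "(l, u) \<in> H ^^ d" "d \<le> z"
  then obtain d' where d': "d' \<le> d" "(d', list_encode [l]) \<in> A" unfolding lm_dists_def by blast
  then show ?thesis using order_trans[OF lm_dist_le[OF d'(2)]] by simp
qed

lemma collect_attained:
  assumes "collect k sel Q l = enat x"
  shows "\<exists>i r. index k = Some i \<and> r \<le> horizon k \<and> sel k i r = l \<and> Q r = enat x"
proof -
  obtain i where i: "index k = Some i" using assms by (cases "index k") (auto simp: collect_def)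
  then have "(INF r\<in>{r. r \<le> horizon k \<and> sel k i r = l}. Q r) = enat x" using assms by (simp add: collect_def)
  from INF_enat_attained[OF this] show ?thesis using i by blast
qed

lemma collect_le: "index k = Some i \<Longrightarrow> r \<le> horizon k \<Longrightarrow> sel k i r = l \<Longrightarrow> collect k sel Q l \<le> Q r"
  unfolding collect_def by (auto intro!: INF_lower)

lemma min_eq_enat: "min a b = enat x \<Longrightarrow> a = enat x \<or> b = enat x"
  by (auto simp: min_def split: if_splits)

lemma phase7: "inv7 K \<Longrightarrow> \<exists>K'. computes_here phase7 K (z + m) K' \<and> inv8 K'"
proof -
  assume K: "inv7 K"
  have K3: "inv3 K" and b: "base K" using K by (simp_all add: inv7_def inv6_def inv5_def inv3_def inv1_def)
  have dists: "lm_dists (Eo\<inverse>) u (to_lm (K u))" if "u \<in> V" for u using K that by (simp add: inv7_def)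
  have sel: "leave_lm (K u) i r = lm_list ! ((i + (z + m) - r) mod card L)" if "u \<in> V" for u i r
    using fields[OF K3 that] length_lm_list by (simp add: leave_lm_def)
  have own_sound: "\<exists>i d. i \<le> len \<and> u = P ! i \<and> x = i + d \<and> (u, leave_lm (K u) i r) \<in> Eo ^^ d \<and> d \<le> z + m"
    if u: "u \<in> V" and x: "leave_value (K u) r = enat x" for u r x
  proof -
    obtain i where i: "idx u = Some i" "enat i + lm_dist (to_lm (K u)) (leave_lm (K u) i r) = enat x"
      using x fields(1)[OF K3 u] by (cases "idx u") (auto simp: leave_value_def)
    then obtain d where d: "lm_dist (to_lm (K u)) (leave_lm (K u) i r) = enat d" "x = i + d"
      by (cases "lm_dist (to_lm (K u)) (leave_lm (K u) i r)") auto
    show ?thesis using idx_SomeD[OF i(1)] d(2) lm_dists_sound[OF dists[OF u] d(1)] unfolding relpow_converse_iff by blast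
  qed
  have own_complete: "leave_value (K (P ! a)) r \<le> enat (a + d)"
    if "a \<le> len" "l \<in> L" "leave_lm (K (P ! a)) a r = l" "(P ! a, l) \<in> Eo ^^ d" "d \<le> z" for a r d l
  proof -
    have "lm_dist (to_lm (K (P ! a))) l \<le> enat d"
      using lm_dists_complete[OF dists[OF P_V[OF that(1)]] that(2)] that(4,5) unfolding relpow_converse_iff by blast
    then have "enat a + lm_dist (to_lm (K (P ! a))) l \<le> enat a + enat d" by (rule add_left_mono)
    then show ?thesis using fields(1)[OF K3 P_V[OF that(1)]] that(1,3) by (simp add: leave_value_def)
  qed
  interpret F: wavefront "nbrs E" V msgs K horizon along_path leave_value
    "\<lambda>k Q. k\<lparr>leave := collect k leave_lm (\<lambda>r. min (leave_value k r) (Q r))\<rparr>" Ep "z + m"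
  proof
    show "[a] \<in> msgs" if "u \<in> V" "r < z + m" "leave_value (K u) r = enat a" for u r a
    proof -
      have "a < B" using own_sound[OF that(1,3)] len_less B_large by auto
      then show ?thesis by (simp add: msg_set_def)
    qed
  qed (use nbrs_V filters(1)[OF b] fields(6)[OF K3] in auto)
  from F.wave_correct obtain Q where Q:
    "computes_here phase7 K (z + m) (\<lambda>u. (K u)\<lparr>leave := collect (K u) leave_lm (\<lambda>r. min (leave_value (K u) r) (Q u r))\<rparr>)"
    "\<And>u w k r. u \<in> V \<Longrightarrow> (w, u) \<in> Ep ^^ k \<Longrightarrow> 0 < k \<Longrightarrow> k \<le> r \<Longrightarrow> r \<le> z + m \<Longrightarrow> Q u r \<le> leave_value (K w) (r - k)"
    "\<And>u r a. u \<in> V \<Longrightarrow> r \<le> z + m \<Longrightarrow> Q u r = enat a \<Longrightarrow>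
      \<exists>w k. w \<in> V \<and> (w, u) \<in> Ep ^^ k \<and> 0 < k \<and> k \<le> r \<and> leave_value (K w) (r - k) = enat a"
    unfolding phase7_def by blast
  let ?leave = "\<lambda>u. collect (K u) leave_lm (\<lambda>r. min (leave_value (K u) r) (Q u r))"
  \<comment> \<open>The selector depends on \<open>i - r\<close> alone, so a message moving along
    \<open>P\<close> keeps its landmark; the summand \<open>z + m\<close> prevents truncated
    subtraction.\<close>
  have shift: "leave_lm (K w) (i - k) (r - k) = leave_lm (K u) i r"
    if "w \<in> V" "u \<in> V" "k \<le> i" "k \<le> r" "r \<le> z + m" for w u i k r
    using that by (simp add: sel)
  have sound: "\<exists>i a d. i \<le> len \<and> u = P ! i \<and> a \<le> i \<and> x = a + d \<and> (P ! a, l) \<in> Eo ^^ d \<and> d \<le> z + m"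
    if u: "u \<in> V" and x: "?leave u l = enat x" for u l x
  proof -
    from collect_attained[OF x] obtain i r where r: "idx u = Some i" "r \<le> z + m" "leave_lm (K u) i r = l"
        "min (leave_value (K u) r) (Q u r) = enat x"
      using fields(1,6)[OF K3 u] by auto
    have i: "i \<le> len" "u = P ! i" using idx_SomeD[OF r(1)] by auto
    from min_eq_enat[OF r(4)] show ?thesis
    proof
      assume "leave_value (K u) r = enat x"
      from own_sound[OF u this] obtain j d where "j \<le> len" "u = P ! j" "x = j + d"
        "(u, leave_lm (K u) j r) \<in> Eo ^^ d" "d \<le> z + m" by blast
      moreover have "j = i" using P_inj i calculation by blast
      ultimately show ?thesis using i r(3) by (intro exI[of _ i] exI[of _ d]) auto
    next
      assume "Q u r = enat x"
      from Q(3)[OF u r(2) this] obtain w k where w: "w \<in> V" "(w, u) \<in> Ep ^^ k" "k \<le> r" "leave_value (K w) (r - k) = enat x"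
        by blast
      from own_sound[OF w(1,4)] obtain j d where j: "j \<le> len" "w = P ! j" "x = j + d"
        "(w, leave_lm (K w) j (r - k)) \<in> Eo ^^ d" "d \<le> z + m" by blast
      have "j + k \<le> len \<and> u = P ! (j + k)" using Ep_walk_from[OF j(1), of u k] w(2) j(2) by blast
      then have ji: "j = i - k" "k \<le> i" using P_inj[of i "j + k"] i by auto
      have "leave_lm (K w) j (r - k) = l" using shift[OF w(1) u ji(2) w(3) r(2)] ji(1) r(3) by simp
      then show ?thesis using i j ji by (intro exI[of _ i] exI[of _ j] exI[of _ d]) auto
    qed
  qed
  have complete: "?leave (P ! i) l \<le> enat (a + d)"
    if i: "i \<le> len" and l: "l \<in> L" and a: "a \<le> i" "i \<le> a + z" and d: "d \<le> z" "(P ! a, l) \<in> Eo ^^ d" for i a l d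
  proof -
    \<comment> \<open>The rounds from \<open>z\<close> to \<open>z + card L - 1\<close> select every
      landmark. By a round \<open>r \<ge> z\<close> a message from any position within the window
      has had time to arrive, and \<open>card L \<le> m\<close> keeps \<open>r\<close> within the
      horizon.\<close>
    define c where "c = i + (z + m) - (z + card L - 1)"
    obtain j where j: "j < card L" "lm_list ! ((c + j) mod card L) = l" using lm_list_nth[OF l] by blast
    define r where "r = z + card L - 1 - j"
    have r: "z \<le> r" "r \<le> z + m" using j(1) card_L by (auto simp: r_def)
    have "i + (z + m) - r = c + j" using j(1) card_L by (auto simp: r_def c_def)
    then have rl: "leave_lm (K (P ! i)) i r = l" using sel P_V[OF i] j(2) by simp
    have V: "P ! i \<in> V" "P ! a \<in> V" using P_V i a by auto
    have "min (leave_value (K (P ! i)) r) (Q (P ! i) r) \<le> enat (a + d)"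
    proof (cases "a = i")
      case True
      then show ?thesis using own_complete[OF i l rl] d by (auto intro: min.coboundedI1)
    next
      case False
      have "Q (P ! i) r \<le> leave_value (K (P ! a)) (r - (i - a))"
        using Q(2)[OF V(1) P_walk[OF a(1) i]] False a r by simp
      also have "\<dots> \<le> enat (a + d)"
      proof (rule own_complete[OF _ l])
        show "leave_lm (K (P ! a)) a (r - (i - a)) = l"
          using shift[OF V(2,1), of "i - a" i r] a r rl by simp
      qed (use i a d in auto)
      finally show ?thesis by (rule min.coboundedI2)
    qed
    moreover have "?leave (P ! i) l \<le> min (leave_value (K (P ! i)) r) (Q (P ! i) r)"
      using collect_le[of "K (P ! i)" i r leave_lm l "\<lambda>r. min (leave_value (K (P ! i)) r) (Q (P ! i) r)"]
        fields(1,6)[OF K3 V(1)] i r rl by simp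
    ultimately show ?thesis by (rule order_trans[rotated])
  qed
  have "inv8 (\<lambda>u. (K u)\<lparr>leave := ?leave u\<rparr>)"
    using K sound complete
    by (simp add: inv8_def inv7_def inv6_def inv5_def inv3_def inv1_def base_def)
  then show ?thesis using Q(1) by blast
qed

lemma phase8: "inv8 K \<Longrightarrow> \<exists>K'. computes_here phase8 K (z + m) K' \<and> inv9 K'"
proof -
  assume K: "inv8 K"
  have K3: "inv3 K" and b: "base K" using K by (simp_all add: inv8_def inv7_def inv6_def inv5_def inv3_def inv1_def)
  have dists: "lm_dists Eo u (from_lm (K u))" if "u \<in> V" for u using K that by (simp add: inv8_def inv7_def inv6_def)
  have sel: "rejoin_lm (K u) i r = lm_list ! ((i + r) mod card L)" if "u \<in> V" for u i r
    using fields[OF K3 that] length_lm_list by (simp add: rejoin_lm_def)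
  have own_sound: "\<exists>i d. i \<le> len \<and> u = P ! i \<and> x = d + (len - i) \<and> (rejoin_lm (K u) i r, u) \<in> Eo ^^ d \<and> d \<le> z + m"
    if u: "u \<in> V" and x: "rejoin_value (K u) r = enat x" for u r x
  proof -
    obtain i where i: "idx u = Some i" "lm_dist (from_lm (K u)) (rejoin_lm (K u) i r) + enat (len - i) = enat x"
      using x fields(1,2)[OF K3 u] by (cases "idx u") (auto simp: rejoin_value_def)
    then obtain d where d: "lm_dist (from_lm (K u)) (rejoin_lm (K u) i r) = enat d" "x = d + (len - i)"
      by (cases "lm_dist (from_lm (K u)) (rejoin_lm (K u) i r)") auto
    show ?thesis using idx_SomeD[OF i(1)] d(2) lm_dists_sound[OF dists[OF u] d(1)] by blast
  qed
  have own_complete: "rejoin_value (K (P ! a)) r \<le> enat (d + (len - a))"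
    if "a \<le> len" "l \<in> L" "rejoin_lm (K (P ! a)) a r = l" "(l, P ! a) \<in> Eo ^^ d" "d \<le> z" for a r d l
  proof -
    have "lm_dist (from_lm (K (P ! a))) l \<le> enat d"
      using lm_dists_complete[OF dists[OF P_V[OF that(1)]] that(2)] that(4,5) by blast
    then have "lm_dist (from_lm (K (P ! a))) l + enat (len - a) \<le> enat d + enat (len - a)" by (rule add_right_mono)
    then show ?thesis using fields(1,2)[OF K3 P_V[OF that(1)]] that(1,3) by (simp add: rejoin_value_def)
  qed
  let ?upd = "\<lambda>k Q. k\<lparr>rejoin := collect k rejoin_lm (\<lambda>r. min (rejoin_value k r) (Q r)),
          rejoin_after := collect k rejoin_lm Q\<rparr>"
  interpret F: wavefront "nbrs E" V msgs K horizon against_path rejoin_value ?upd "Ep\<inverse>" "z + m"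
  proof
    show "[a] \<in> msgs" if "u \<in> V" "r < z + m" "rejoin_value (K u) r = enat a" for u r a
    proof -
      have "a < B" using own_sound[OF that(1,3)] len_less B_large by auto
      then show ?thesis by (simp add: msg_set_def)
    qed
  qed (use nbrs_V filters(2)[OF b] fields(6)[OF K3] in auto)
  from F.wave_correct obtain Q where Q:
    "computes_here phase8 K (z + m) (\<lambda>u. ?upd (K u) (Q u))"
    "\<And>u w k r. u \<in> V \<Longrightarrow> (w, u) \<in> (Ep\<inverse>) ^^ k \<Longrightarrow> 0 < k \<Longrightarrow> k \<le> r \<Longrightarrow> r \<le> z + m \<Longrightarrow> Q u r \<le> rejoin_value (K w) (r - k)"
    "\<And>u r a. u \<in> V \<Longrightarrow> r \<le> z + m \<Longrightarrow> Q u r = enat a \<Longrightarrow>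
      \<exists>w k. w \<in> V \<and> (w, u) \<in> (Ep\<inverse>) ^^ k \<and> 0 < k \<and> k \<le> r \<and> rejoin_value (K w) (r - k) = enat a"
    unfolding phase8_def by blast
  let ?rejoin = "\<lambda>u. collect (K u) rejoin_lm (\<lambda>r. min (rejoin_value (K u) r) (Q u r))"
  let ?after = "\<lambda>u. collect (K u) rejoin_lm (Q u)"
  have shift: "rejoin_lm (K w) (i + k) (r - k) = rejoin_lm (K u) i r"
    if "w \<in> V" "u \<in> V" "k \<le> r" for w u i k r
    using that by (simp add: sel)
  \<comment> \<open>Values in \<open>Q\<close> have crossed at least one edge, so they come from a
    position strictly beyond \<open>i\<close>; this is what separates \<open>rejoin_after\<close>
    from \<open>rejoin\<close>.\<close>
  have Q_sound: "\<exists>b d. i < b \<and> b \<le> len \<and> x = d + (len - b) \<and> (l, P ! b) \<in> Eo ^^ d \<and> d \<le> z + m"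
    if i: "i \<le> len" and r: "r \<le> z + m" "rejoin_lm (K (P ! i)) i r = l" "Q (P ! i) r = enat x" for i l r x
  proof -
    from Q(3)[OF P_V[OF i] r(1,3)] obtain w k where w: "w \<in> V" "(w, P ! i) \<in> (Ep\<inverse>) ^^ k" "0 < k" "k \<le> r"
        "rejoin_value (K w) (r - k) = enat x"
      by blast
    from own_sound[OF w(1,5)] obtain j d where j: "j \<le> len" "w = P ! j" "x = d + (len - j)"
        "(rejoin_lm (K w) j (r - k), w) \<in> Eo ^^ d" "d \<le> z + m" by blast
    have "i + k \<le> len \<and> w = P ! (i + k)" using Ep_walk_from[OF i, of w k] w(2) unfolding relpow_converse_iff by blast
    then have ji: "j = i + k" using P_inj[of j "i + k"] j by auto
    have "rejoin_lm (K w) j (r - k) = l" using shift[OF w(1) P_V[OF i] w(4), of i] ji r(2) by simp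
    then show ?thesis using j ji w(3) by (intro exI[of _ j] exI[of _ d]) auto
  qed
  have sound: "\<exists>i b d. u = P ! i \<and> i \<le> b \<and> b \<le> len \<and> y = d + (len - b) \<and> (l, P ! b) \<in> Eo ^^ d \<and> d \<le> z + m"
    if u: "u \<in> V" and x: "?rejoin u l = enat y" for u l y
  proof -
    from collect_attained[OF x] obtain i r where r: "idx u = Some i" "r \<le> z + m" "rejoin_lm (K u) i r = l"
        "min (rejoin_value (K u) r) (Q u r) = enat y"
      using fields(1,6)[OF K3 u] by auto
    have i: "i \<le> len" "u = P ! i" using idx_SomeD[OF r(1)] by auto
    from min_eq_enat[OF r(4)] show ?thesis
    proof
      assume "rejoin_value (K u) r = enat y"
      from own_sound[OF u this] obtain j d where j: "j \<le> len" "u = P ! j" "y = d + (len - j)"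
        "(rejoin_lm (K u) j r, u) \<in> Eo ^^ d" "d \<le> z + m" by blast
      then have "j = i" using P_inj i by blast
      then show ?thesis using i j r(3) by (intro exI[of _ i] exI[of _ i] exI[of _ d]) auto
    next
      assume "Q u r = enat y"
      then obtain b d where "i < b" "b \<le> len" "y = d + (len - b)" "(l, P ! b) \<in> Eo ^^ d" "d \<le> z + m"
        using Q_sound[OF i(1) r(2), of l y] r(3) i(2) by blast
      then show ?thesis using i by (intro exI[of _ i] exI[of _ b] exI[of _ d]) auto
    qed
  qed
  have sound_after: "\<exists>b d. i < b \<and> b \<le> len \<and> y = d + (len - b) \<and> (l, P ! b) \<in> Eo ^^ d"
    if i: "i \<le> len" and x: "?after (P ! i) l = enat y" for i l y
  proof -
    from collect_attained[OF x] obtain r where r: "r \<le> z + m" "rejoin_lm (K (P ! i)) i r = l" "Q (P ! i) r = enat y"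
      using fields(1,6)[OF K3 P_V[OF i]] i by auto
    then show ?thesis using Q_sound[OF i r] by blast
  qed
  have select: "\<exists>r. z \<le> r \<and> r \<le> z + m \<and> rejoin_lm (K (P ! i)) i r = l" if i: "i \<le> len" and l: "l \<in> L" for i l
  proof -
    obtain j where j: "j < card L" "lm_list ! ((i + z + j) mod card L) = l" using lm_list_nth[OF l] by blast
    then show ?thesis using sel[OF P_V[OF i]] card_L by (intro exI[of _ "z + j"]) (simp add: add.assoc)
  qed
  have Q_complete: "Q (P ! i) r \<le> enat (d + (len - b))"
    if l: "l \<in> L" and b: "i < b" "b \<le> i + z" "b \<le> len" and d: "d \<le> z" "(l, P ! b) \<in> Eo ^^ d"
      and r: "z \<le> r" "r \<le> z + m" "rejoin_lm (K (P ! i)) i r = l" for i b l d r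
  proof -
    have V: "P ! i \<in> V" "P ! b \<in> V" using P_V b by auto
    have "(P ! b, P ! i) \<in> (Ep\<inverse>) ^^ (b - i)" unfolding relpow_converse_iff using P_walk[of i b] b by simp
    then have "Q (P ! i) r \<le> rejoin_value (K (P ! b)) (r - (b - i))"
      using Q(2)[OF V(1), of "P ! b" "b - i" r] b r by simp
    also have "\<dots> \<le> enat (d + (len - b))"
    proof (rule own_complete[OF _ l])
      show "rejoin_lm (K (P ! b)) b (r - (b - i)) = l"
        using shift[OF V(2,1), of "b - i" r i] b r by simp
    qed (use b d in auto)
    finally show ?thesis .
  qed
  have complete_after: "?after (P ! i) l \<le> enat (d + (len - b))"
    if l: "l \<in> L" and b: "i < b" "b \<le> i + z" "b \<le> len" and d: "d \<le> z" "(l, P ! b) \<in> Eo ^^ d" for i b l d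
  proof -
    have i: "i \<le> len" using b by simp
    obtain r where r: "z \<le> r" "r \<le> z + m" "rejoin_lm (K (P ! i)) i r = l" using select[OF i l] by blast
    have "?after (P ! i) l \<le> Q (P ! i) r"
      using collect_le[of "K (P ! i)" i r rejoin_lm l "Q (P ! i)"] fields(1,6)[OF K3 P_V[OF i]] i r by simp
    then show ?thesis using Q_complete[OF l b d r] by (rule order_trans)
  qed
  have complete: "?rejoin (P ! i) l \<le> enat (d + (len - b))"
    if l: "l \<in> L" and b: "i \<le> b" "b \<le> i + z" "b \<le> len" and d: "d \<le> z" "(l, P ! b) \<in> Eo ^^ d" for i b l d
  proof -
    have i: "i \<le> len" using b by simp
    obtain r where r: "z \<le> r" "r \<le> z + m" "rejoin_lm (K (P ! i)) i r = l" using select[OF i l] by blast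
    have 1: "?rejoin (P ! i) l \<le> min (rejoin_value (K (P ! i)) r) (Q (P ! i) r)"
      using collect_le[of "K (P ! i)" i r rejoin_lm l "\<lambda>r. min (rejoin_value (K (P ! i)) r) (Q (P ! i) r)"]
        fields(1,6)[OF K3 P_V[OF i]] i r by simp
    have "min (rejoin_value (K (P ! i)) r) (Q (P ! i) r) \<le> enat (d + (len - b))"
    proof (cases "b = i")
      case True
      then show ?thesis using own_complete[OF i l r(3)] d by (auto intro: min.coboundedI1)
    next
      case False
      then show ?thesis using Q_complete[OF l _ b(2,3) d r] b by (auto intro: min.coboundedI2)
    qed
    then show ?thesis by (rule order_trans[OF 1])
  qed
  have "inv9 (\<lambda>u. ?upd (K u) (Q u))"
    using K sound complete sound_after complete_after
    by (simp add: inv9_def inv8_def inv7_def inv6_def inv5_def inv3_def inv1_def base_def)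
  then show ?thesis using Q(1) by blast
qed

lemma detour_tokens_iff:
  assumes K: "inv9 K"
  shows "list_encode [0, l, p, x] \<in> (\<Union>u\<in>V. detour_tokens (K u)) \<longleftrightarrow> p \<in> L \<and> lm_dist (from_lm (K p)) l = enat x"
    and "list_encode [1, l, p, x] \<in> (\<Union>u\<in>V. detour_tokens (K u)) \<longleftrightarrow> p \<in> L \<and> l \<in> L \<and> leave (K p) l = enat x"
    and "list_encode [2, l, p, x] \<in> (\<Union>u\<in>V. detour_tokens (K u)) \<longleftrightarrow> p \<in> L \<and> l \<in> L \<and> rejoin (K p) l = enat x"
proof -
  have K3: "inv3 K" using K by (simp add: inv9_def inv8_def inv7_def inv6_def inv5_def)
  have f: "me (K u) = u" "mark (K u) = (u \<in> L)" "set (lms (K u)) = L" if "u \<in> V" for u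
    using fields[OF K3 that] finL by auto
  show "list_encode [0, l, p, x] \<in> (\<Union>u\<in>V. detour_tokens (K u)) \<longleftrightarrow> p \<in> L \<and> lm_dist (from_lm (K p)) l = enat x"
    and "list_encode [1, l, p, x] \<in> (\<Union>u\<in>V. detour_tokens (K u)) \<longleftrightarrow> p \<in> L \<and> l \<in> L \<and> leave (K p) l = enat x"
    and "list_encode [2, l, p, x] \<in> (\<Union>u\<in>V. detour_tokens (K u)) \<longleftrightarrow> p \<in> L \<and> l \<in> L \<and> rejoin (K p) l = enat x"
    using f L_V by (auto simp: detour_tokens_def split: if_splits)
qed

text \<open>Soundness: the parts of a combination are walks in \<open>Eo\<close> that concatenate to
  a detour around the edge. Completeness: a shortest detour longer than \<open>z\<close> is cut at a
  landmark among its first \<open>z\<close> steps, at landmarks in between, and at a last landmark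
  at most \<open>z\<close> steps from its end.\<close>

lemma answer_correct:
  assumes K: "inv9 K" and i: "i < len"
  shows "answer (K (P ! i)) (\<Union>u\<in>V. detour_tokens (K u)) = repl_dist E s t (P ! i, P ! Suc i)"
proof -
  let ?X = "\<Union>u\<in>V. detour_tokens (K u)"
  let ?k = "K (P ! i)"
  define W where "W = {(l, l', d). list_encode [0, l, l', d] \<in> ?X}"
  define exits where "exits x l \<longleftrightarrow> leave ?k l = enat x \<or>
    (\<exists>p j. list_encode [1, l, p, x] \<in> ?X \<and> pos ?k p j \<and> j \<le> i)" for x l
  define enters where "enters y l \<longleftrightarrow> rejoin_after ?k l = enat y \<or>
    (\<exists>p j. list_encode [2, l, p, y] \<in> ?X \<and> pos ?k p j \<and> i < j)" for y l
  define Y where "Y = {(x, d, y). \<exists>l l'. overlay W l l' d \<and> exits x l \<and> enters y l'}"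
  note tok = detour_tokens_iff[OF K]
  have K3: "inv3 K" and K5: "inv5 K" and K6: "inv6 K" and K8: "inv8 K"
    using K by (simp_all add: inv9_def inv8_def inv7_def inv6_def inv5_def)
  have il: "i \<le> len" and iV: "P ! i \<in> V" using i P_V by auto
  have idx: "index ?k = Some i" using fields(1)[OF K3 iV] il by simp
  note pos = fields(10)[OF K3 iV]
  have dists: "lm_dists Eo u (from_lm (K u))" if "u \<in> V" for u using K6 that by (simp add: inv6_def)
  have ans: "answer ?k ?X = min (short ?k) (INF (x, d, y)\<in>Y. enat (x + d + y))"
    unfolding answer_def Let_def W_def[symmetric] Y_def exits_def enters_def idx option.sel ..
  have W_sound: "(l, l') \<in> Eo ^^ d" if "(l, l', d) \<in> W" for l l' d
    using that lm_dists_sound[OF dists] L_V unfolding W_def mem_Collect_eq case_prod_conv tok by blast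
  have W_complete: "(l, l', j) \<in> W" if "l \<in> L" "l' \<in> L" "at_distance Eo l l' j" "j \<le> z" for l l' j
  proof -
    have V: "l' \<in> V" using that L_V by auto
    have "lm_dist (from_lm (K l')) l \<le> enat j"
      using lm_dists_complete[OF dists[OF V] that(1) at_distanceD[OF that(3)] that(4)] .
    then obtain y where y: "lm_dist (from_lm (K l')) l = enat y" "y \<le> j"
      by (cases "lm_dist (from_lm (K l')) l") auto
    have "(l, l') \<in> Eo ^^ y" using lm_dists_sound[OF dists[OF V] y(1)] by blast
    \<comment> \<open>The entry is the length of some walk, hence not below the distance
      \<open>j\<close>; together with \<open>y \<le> j\<close> it is exact.\<close>
    then have "j \<le> y" by (rule at_distance_le[OF that(3)])
    then show ?thesis unfolding W_def mem_Collect_eq case_prod_conv tok using that y by simp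
  qed
  have exits_sound: "\<exists>a d. a \<le> i \<and> x = a + d \<and> (P ! a, l) \<in> Eo ^^ d" if ex: "exits x l" for x l
  proof -
    obtain u j where u: "u \<in> V" "leave (K u) l = enat x" "u = P ! j" "j \<le> i"
      using ex iV L_V unfolding exits_def tok pos by blast
    obtain i' a d where "i' \<le> len" "u = P ! i'" "a \<le> i'" "x = a + d" "(P ! a, l) \<in> Eo ^^ d"
      using K8 u(1,2) unfolding inv8_def by blast
    moreover have "i' = j" using P_inj[of i' j] calculation u il by simp
    ultimately show ?thesis using u(4) by (intro exI[of _ a] exI[of _ d]) simp
  qed
  have enters_sound: "\<exists>b d. i < b \<and> b \<le> len \<and> y = d + (len - b) \<and> (l, P ! b) \<in> Eo ^^ d" if en: "enters y l" for y l
  proof (cases "rejoin_after ?k l = enat y")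
    case True
    then show ?thesis using K il unfolding inv9_def by blast
  next
    case False
    then obtain p j where p: "p \<in> V" "rejoin (K p) l = enat y" "p = P ! j" "i < j" "j \<le> len"
      using en L_V unfolding enters_def tok pos by blast
    obtain i' b d where b: "p = P ! i'" "i' \<le> b" "b \<le> len" "y = d + (len - b)" "(l, P ! b) \<in> Eo ^^ d"
      using K p(1,2) unfolding inv9_def by blast
    have "i' = j" using P_inj[of i' j] b p by simp
    then show ?thesis using b p by (intro exI[of _ b] exI[of _ d]) simp
  qed
  have exits_complete: "\<exists>x\<le>a + d. exits x l" if "a \<le> i" "l \<in> L" "d \<le> z" "(P ! a, l) \<in> Eo ^^ d" for a l d
  proof -
    have cpl: "\<exists>x\<le>a + d. leave (K (P ! q)) l = enat x" if "a \<le> q" "q \<le> a + z" "q \<le> len" for q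
    proof -
      have "leave (K (P ! q)) l \<le> enat (a + d)"
        using K8 that \<open>l \<in> L\<close> \<open>d \<le> z\<close> \<open>(P ! a, l) \<in> Eo ^^ d\<close> unfolding inv8_def by blast
      then show ?thesis by (cases "leave (K (P ! q)) l") auto
    qed
    show ?thesis
    proof (cases "i \<le> a + z")
      case True
      then show ?thesis using cpl[of i] that(1) il unfolding exits_def by blast
    next
      case False
      \<comment> \<open>Position \<open>i\<close> is beyond the window of \<open>a\<close>. A
        landmark of \<open>P\<close> at most \<open>z\<close> positions after \<open>a\<close> has
        the value in its own table and has broadcast it, and it still lies before
        \<open>i\<close>.\<close>
      have "at_distance Ep (P ! a) (P ! (a + z)) z"
        using at_distance_Ep P_walk[of a "a + z"] False il by simp
      then obtain p j where p: "p \<in> L" "1 \<le> j" "j \<le> z" "at_distance Ep (P ! a) p j"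
        using hit_path unfolding hitting_def by blast
      have pj: "a + j \<le> len" "p = P ! (a + j)"
        using Ep_walk_from[of a p j] at_distanceD[OF p(4)] that(1) il by auto
      obtain x where x: "x \<le> a + d" "leave (K p) l = enat x" using cpl[of "a + j"] p pj by auto
      have "exits x l" unfolding exits_def tok pos
        using p pj x(2) that(2) False by (intro disjI2 exI[of _ p] exI[of _ "a + j"]) auto
      then show ?thesis using x(1) by blast
    qed
  qed
  have enters_complete: "\<exists>y\<le>d + (len - b). enters y l"
    if "i < b" "b \<le> len" "l \<in> L" "d \<le> z" "(l, P ! b) \<in> Eo ^^ d" for b l d
  proof (cases "b \<le> i + z")
    case True
    have "rejoin_after ?k l \<le> enat (d + (len - b))" using K True that unfolding inv9_def by blast
    then show ?thesis unfolding enters_def by (cases "rejoin_after ?k l") auto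
  next
    case False
    \<comment> \<open>The mirror image: \<open>hitting\<close> looks forward, so it is applied from
      \<open>z\<close> positions before \<open>b\<close>. The landmark found lies at
      \<open>b\<close> or earlier and, because \<open>i < q\<close>, after \<open>i\<close>.\<close>
    define q where "q = b - z"
    have q: "q + z = b" "i < q" using False by (auto simp: q_def)
    have "at_distance Ep (P ! q) (P ! b) z"
      using at_distance_Ep P_walk[of q b] q that(2) by (metis add_diff_cancel_left' le_add1)
    then obtain p j where p: "p \<in> L" "1 \<le> j" "j \<le> z" "at_distance Ep (P ! q) p j"
      using hit_path unfolding hitting_def by blast
    have pj: "q + j \<le> len" "p = P ! (q + j)"
      using Ep_walk_from[of q p j] at_distanceD[OF p(4)] q that(2) by auto
    have "q + j \<le> b" "b \<le> q + j + z" using p q by auto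
    then have "rejoin (K (P ! (q + j))) l \<le> enat (d + (len - b))" using K that unfolding inv9_def by blast
    then obtain y where y: "y \<le> d + (len - b)" "rejoin (K p) l = enat y"
      using pj by (cases "rejoin (K p) l") auto
    have "enters y l" unfolding enters_def tok pos
      using p pj y(2) that(3) q by (intro disjI2 exI[of _ p] exI[of _ "q + j"]) auto
    then show ?thesis using y(1) by blast
  qed
  have short_sound: "\<exists>(a, b, d)\<in>detours i. enat (a + d + (len - b)) = enat x" if "short ?k = enat x" for x
    using K5 i that unfolding inv5_def by blast
  have "answer ?k ?X = (INF (a, b, d)\<in>detours i. enat (a + d + (len - b)))"
  proof (rule antisym)
    show "answer ?k ?X \<le> (INF (a, b, d)\<in>detours i. enat (a + d + (len - b)))"
    proof (rule INF_greatest, clarify)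
      fix a b d assume abd: "(a, b, d) \<in> detours i"
      then have ab: "a \<le> i" "i < b" "b \<le> len" "(P ! a, P ! b) \<in> Eo ^^ d" by (auto simp: detours_def)
      \<comment> \<open>The given walk is replaced by a shortest one between the same positions, as
        \<open>hitting\<close> speaks about these only.\<close>
      from ex_at_distance[OF ab(4)] obtain d0 where d0: "d0 \<le> d" "at_distance Eo (P ! a) (P ! b) d0" by blast
      show "answer ?k ?X \<le> enat (a + d + (len - b))"
      proof (cases "d0 \<le> z")
        case True
        have "(a, b, d0) \<in> detours i" using ab at_distanceD[OF d0(2)] by (simp add: detours_def)
        then have "short ?k \<le> enat (a + d0 + (len - b))" using K5 i True unfolding inv5_def by blast
        also have "\<dots> \<le> enat (a + d + (len - b))" using d0 by simp
        finally show ?thesis unfolding ans by (rule min.coboundedI1)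
      next
        case False
        then obtain l j where l: "l \<in> L" "j \<le> z" "j \<le> d0" "at_distance Eo (P ! a) l j" "at_distance Eo l (P ! b) (d0 - j)"
          using hit_detour d0(2) unfolding hitting_def by (metis le_trans nat_le_linear)
        from overlay_complete[OF hit_detour W_complete l(1,5)] obtain l' p q where
          l': "l' \<in> L" "overlay W l l' p" "at_distance Eo l' (P ! b) q" "q \<le> z" "d0 - j = p + q" by blast
        obtain x where x: "x \<le> a + j" "exits x l" using exits_complete[OF ab(1) l(1,2) at_distanceD[OF l(4)]] by blast
        obtain y where y: "y \<le> q + (len - b)" "enters y l'"
          using enters_complete[OF ab(2,3) l'(1,4) at_distanceD[OF l'(3)]] by blast
        have "(x, p, y) \<in> Y" unfolding Y_def using x y l' by blast
        then have "(INF (x, d, y)\<in>Y. enat (x + d + y)) \<le> enat (x + p + y)"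
          by (rule INF_lower2) simp
        also have "\<dots> \<le> enat (a + d + (len - b))" using x(1) y(1) l'(5) l(3) d0(1) by simp
        finally show ?thesis unfolding ans by (rule min.coboundedI2)
      qed
    qed
  next
    show "(INF (a, b, d)\<in>detours i. enat (a + d + (len - b))) \<le> answer ?k ?X"
      unfolding ans
    proof (rule min.boundedI)
      show "(INF (a, b, d)\<in>detours i. enat (a + d + (len - b))) \<le> short ?k"
      proof (cases "short ?k")
        case (enat x)
        then obtain a b d where "(a, b, d) \<in> detours i" "enat (a + d + (len - b)) = short ?k"
          using short_sound by fastforce
        then show ?thesis by (metis (mono_tags, lifting) INF_lower case_prod_conv)
      qed simp
      show "(INF (a, b, d)\<in>detours i. enat (a + d + (len - b))) \<le> (INF (x, d, y)\<in>Y. enat (x + d + y))"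
      proof (rule INF_greatest, clarify)
        fix x d y assume "(x, d, y) \<in> Y"
        then obtain l l' where l: "overlay W l l' d" "exits x l" "enters y l'" unfolding Y_def by blast
        obtain a d1 where a: "a \<le> i" "x = a + d1" "(P ! a, l) \<in> Eo ^^ d1" using exits_sound[OF l(2)] by blast
        obtain b d2 where b: "i < b" "b \<le> len" "y = d2 + (len - b)" "(l', P ! b) \<in> Eo ^^ d2"
          using enters_sound[OF l(3)] by blast
        have "(l, l') \<in> Eo ^^ d" using overlay_sound[OF l(1), of Eo] W_sound by simp
        then have "(P ! a, P ! b) \<in> Eo ^^ (d1 + d + d2)" using relpow_trans'[OF relpow_trans'[OF a(3)] b(4)] by simp
        then have "(a, b, d1 + d + d2) \<in> detours i" using a b by (simp add: detours_def)
        then show "(INF (a, b, d)\<in>detours i. enat (a + d + (len - b))) \<le> enat (x + d + y)"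
          using a b by (intro INF_lower2) auto
      qed
    qed
  qed
  then show ?thesis using repl_dist_eq_detours[OF i] by simp
qed

lemma phase9: "inv9 K \<Longrightarrow> computes_here phase9 K (2 * ecc_s + 3 * (m * m))
  (\<lambda>u. answer (K u) (\<Union>u\<in>V. detour_tokens (K u)))"
proof -
  assume K: "inv9 K"
  have K3: "inv3 K" and K6: "inv6 K" and K8: "inv8 K" and b: "base K"
    using K by (simp_all add: inv9_def inv8_def inv7_def inv6_def inv5_def inv3_def inv1_def)
  note f = fields[OF K3]
  have v0: "l \<in> L \<and> d \<le> z + m" if "u \<in> V" "lm_dist (from_lm (K u)) l = enat d" for u l d
    using K6 lm_dists_sound[OF _ that(2), of Eo u] that(1) by (simp add: inv6_def)
  have v1: "x < B" if *: "u \<in> V" "leave (K u) l = enat x" for u l x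
  proof -
    obtain i a d where "i \<le> len" "a \<le> i" "x = a + d" "d \<le> z + m"
      using K8 * unfolding inv8_def by blast
    then show ?thesis using len_less B_large by simp
  qed
  have v2: "x < B" if *: "u \<in> V" "rejoin (K u) l = enat x" for u l x
  proof -
    obtain b d where "x = d + (len - b)" "d \<le> z + m"
      using K * unfolding inv9_def by blast
    then show ?thesis using len_less B_large by simp
  qed
  \<comment> \<open>Each table assigns one value to a landmark, so a token is determined by its tag
    and two landmarks.\<close>
  let ?f0 = "\<lambda>(l, u). list_encode [0, l, u, the_enat (lm_dist (from_lm (K u)) l)]"
  let ?f1 = "\<lambda>(l, u). list_encode [1, l, u, the_enat (leave (K u) l)]"
  let ?f2 = "\<lambda>(l, u). list_encode [2, l, u, the_enat (rejoin (K u) l)]"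
  let ?S = "?f0 ` (L \<times> L) \<union> ?f1 ` (L \<times> L) \<union> ?f2 ` (L \<times> L)"
  have cases: "u \<in> L \<and> ((\<exists>l d. l \<in> L \<and> e = list_encode [0, l, u, d] \<and> lm_dist (from_lm (K u)) l = enat d) \<or>
     (\<exists>l d. l \<in> L \<and> e = list_encode [1, l, u, d] \<and> leave (K u) l = enat d) \<or>
     (\<exists>l d. l \<in> L \<and> e = list_encode [2, l, u, d] \<and> rejoin (K u) l = enat d))"
    if "u \<in> V" "e \<in> detour_tokens (K u)" for u e
    using that(2) f[OF that(1)] v0[OF that(1)] finL by (auto simp: detour_tokens_def split: if_splits)
  have sub: "(\<Union>u\<in>V. detour_tokens (K u)) \<subseteq> ?S"
  proof
    fix e assume "e \<in> (\<Union>u\<in>V. detour_tokens (K u))"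
    then obtain u where u: "u \<in> V" "e \<in> detour_tokens (K u)" by blast
    from cases[OF u] show "e \<in> ?S"
    proof (elim conjE disjE exE)
      fix l d assume "u \<in> L" "l \<in> L" "e = list_encode [0, l, u, d]" "lm_dist (from_lm (K u)) l = enat d"
      then have "e = ?f0 (l, u)" "(l, u) \<in> L \<times> L" by simp_all
      then show ?thesis by blast
    next
      fix l d assume "u \<in> L" "l \<in> L" "e = list_encode [1, l, u, d]" "leave (K u) l = enat d"
      then have "e = ?f1 (l, u)" "(l, u) \<in> L \<times> L" by simp_all
      then show ?thesis by blast
    next
      fix l d assume "u \<in> L" "l \<in> L" "e = list_encode [2, l, u, d]" "rejoin (K u) l = enat d"
      then have "e = ?f2 (l, u)" "(l, u) \<in> L \<times> L" by simp_all
      then show ?thesis by blast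
    qed
  qed
  have finLL: "finite (L \<times> L)" using finL by simp
  have fin: "finite ?S" using finLL by simp
  have cLL: "card (L \<times> L) \<le> m * m" using card_L by (simp add: card_cartesian_product mult_le_mono)
  have ci: "card (g ` (L \<times> L)) \<le> m * m" for g :: "nat \<times> nat \<Rightarrow> nat"
    using card_image_le[OF finLL, of g] cLL by simp
  have "card ?S \<le> card (?f0 ` (L \<times> L)) + card (?f1 ` (L \<times> L)) + card (?f2 ` (L \<times> L))"
    by (rule order_trans[OF card_Un_le add_right_mono[OF card_Un_le]])
  also have "\<dots> \<le> 3 * (m * m)" using ci[of ?f0] ci[of ?f1] ci[of ?f2] by linarith
  finally have card: "card (\<Union>u\<in>V. detour_tokens (K u)) \<le> 3 * (m * m)"
    using card_mono[OF fin sub] by simp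
  have msg: "d # list_decode e \<in> msgs" if u: "u \<in> V" and e: "e \<in> detour_tokens (K u)" and d: "d \<le> 2 * ecc_s + 3 * (m * m)" for u d e
  proof -
    have B: "d < B" "u < B" "0 < B" "1 < B" "2 < B" using d ecc_s_less[OF b] B_large B_V[OF u] by auto
    have lB: "l < B" if "l \<in> L" for l using that L_V B_V by blast
    have v0': "x < B" if "lm_dist (from_lm (K u)) l = enat x" for l x using v0[OF u that] B_large by simp
    show ?thesis using cases[OF u e] B lB v0' v1[OF u] v2[OF u]
      by (elim conjE disjE exE) (simp_all add: msg_set_def)
  qed
  show ?thesis unfolding phase9_def
    by (rule gossip[OF b f(9) finite_subset[OF sub fin] card _ msg]) (auto simp: f)
qed

definition total_time :: nat where
  "total_time = (4 * ecc_s + 4) + ((z + m) + ((2 * ecc_s + (m * m + 2)) + (z + (z + ((z + m) + ((z + m) +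
     ((z + m) + ((z + m) + (2 * ecc_s + 3 * (m * m))))))))))"

theorem rpaths_machine_correct:
  assumes "base K"
  shows "\<exists>K'. computes_here rpaths_machine K total_time K' \<and>
    (\<forall>i<len. K' (P ! i) = repl_dist E s t (P ! i, P ! Suc i))"
proof -
  obtain K1 where 1: "computes_here phase0 K (4 * ecc_s + 4) K1" "inv1 K1" using phase0[OF assms] by blast
  obtain K2 where 2: "computes_here phase1 K1 (z + m) K2" "inv2 K2" using phase1[OF 1(2)] by blast
  obtain K3 where 3: "computes_here phase2 K2 (2 * ecc_s + (m * m + 2)) K3" "inv3 K3" using phase2[OF 2(2)] by blast
  obtain K4 where 4: "computes_here phase3 K3 z K4" "inv4 K4" using phase3[OF 3(2)] by blast
  obtain K5 where 5: "computes_here phase4 K4 z K5" "inv5 K5" using phase4[OF 4(2)] by blast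
  obtain K6 where 6: "computes_here phase5 K5 (z + m) K6" "inv6 K6" using phase5[OF 5(2)] by blast
  obtain K7 where 7: "computes_here phase6 K6 (z + m) K7" "inv7 K7" using phase6[OF 6(2)] by blast
  obtain K8 where 8: "computes_here phase7 K7 (z + m) K8" "inv8 K8" using phase7[OF 7(2)] by blast
  obtain K9 where 9: "computes_here phase8 K8 (z + m) K9" "inv9 K9" using phase8[OF 8(2)] by blast
  note C = computes_seq_comp[OF nbrs_V]
  have "computes_here rpaths_machine K total_time (\<lambda>u. answer (K9 u) (\<Union>u\<in>V. detour_tokens (K9 u)))"
    unfolding rpaths_machine_def total_time_def
    by (rule C[OF 1(1) C[OF 2(1) C[OF 3(1) C[OF 4(1) C[OF 5(1) C[OF 6(1) C[OF 7(1) C[OF 8(1) C[OF 9(1) phase9[OF 9(2)]]]]]]]]]])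
  then show ?thesis using answer_correct[OF 9(2)] by blast
qed

end

subsection \<open>Sampling\<close>

text \<open>Fair coins suggest rates that are powers of 1/2: \<open>J\<close> heads in a row have
  probability \<open>(1/2) ^ J\<close>.\<close>

definition heads :: "nat \<Rightarrow> tape \<Rightarrow> bool" where
  "heads J w \<longleftrightarrow> (\<forall>j<J. w j)"

definition sampled :: "nat set \<Rightarrow> nat \<Rightarrow> (nat \<Rightarrow> tape) \<Rightarrow> nat set" where
  "sampled V J \<omega> = {u \<in> V. heads J (\<omega> u)}"

abbreviation tape_space :: "tape measure" where
  "tape_space \<equiv> PiM UNIV (\<lambda>_::nat. measure_pmf (bernoulli_pmf (1/2)))"

interpretation tapes: product_prob_space "\<lambda>_::nat. measure_pmf (bernoulli_pmf (1/2))" UNIV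
  by unfold_locales

interpretation coins: product_prob_space "\<lambda>_::nat. tape_space" V for V
  by unfold_locales

lemma heads_sets: "{w. heads J w} \<in> sets tape_space"
  and measure_heads: "measure tape_space {w. heads J w} = (1/2) ^ J"
proof -
  have eq: "{w. heads J w} = prod_emb UNIV (\<lambda>_. measure_pmf (bernoulli_pmf (1/2))) {..<J} (PiE {..<J} (\<lambda>_. {True}))"
  proof -
    have "heads J w \<longleftrightarrow> restrict w {..<J} \<in> PiE {..<J} (\<lambda>_. {True})" for w
      unfolding PiE_iff heads_def by auto
    then show ?thesis unfolding prod_emb_def by auto
  qed
  show "{w. heads J w} \<in> sets tape_space" unfolding eq by (intro sets_PiM_I) auto
  have "measure tape_space {w. heads J w} = (\<Prod>i\<in>{..<J}. measure (measure_pmf (bernoulli_pmf (1/2))) {True})"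
    unfolding eq by (rule tapes.measure_PiM_emb) auto
  also have "\<dots> = (1/2) ^ J" by (simp add: measure_pmf_single)
  finally show "measure tape_space {w. heads J w} = (1/2) ^ J" .
qed

section \<open>The distribution of the sample as a finite sum\<close>

text \<open>The probability that independent choices with rate \<open>p\<close> select exactly the
  subset \<open>S\<close> of \<open>V\<close>.\<close>

definition weight :: "real \<Rightarrow> 'a set \<Rightarrow> 'a set \<Rightarrow> real" where
  "weight p V S = p ^ card S * (1 - p) ^ card (V - S)"

lemma sampled_eq:
  assumes V: "finite V" and S: "S \<subseteq> V"
  shows "{\<omega> \<in> space (coin_space V). sampled V J \<omega> = S} \<in> sets (coin_space V)"
    and "measure (coin_space V) {\<omega> \<in> space (coin_space V). sampled V J \<omega> = S} = weight ((1/2) ^ J) V S"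
proof -
  let ?A = "\<lambda>u. if u \<in> S then {w. heads J w} else - {w. heads J w}"
  have A: "?A u \<in> sets tape_space" for u
    using heads_sets[of J] sets.compl_sets[OF heads_sets[of J]] by (auto simp: space_PiM PiE_UNIV_domain Compl_eq_Diff_UNIV)
  have compl: "measure tape_space (- {w. heads J w}) = 1 - (1/2) ^ J"
    using tapes.prob_compl[OF heads_sets[of J]] measure_heads[of J]
    by (simp add: space_PiM PiE_UNIV_domain Compl_eq_Diff_UNIV)
  have eq: "{\<omega> \<in> space (coin_space V). sampled V J \<omega> = S} = prod_emb V (\<lambda>_. tape_space) V (PiE V ?A)"
  proof -
    have "sampled V J \<omega> = S \<longleftrightarrow> restrict \<omega> V \<in> PiE V ?A" for \<omega>
      using S by (auto simp: sampled_def PiE_iff split: if_splits)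
    then show ?thesis unfolding coin_space_def prod_emb_def space_PiM by blast
  qed
  show "{\<omega> \<in> space (coin_space V). sampled V J \<omega> = S} \<in> sets (coin_space V)"
    unfolding eq unfolding coin_space_def by (rule sets_PiM_I) (use V A in auto)
  have "measure (coin_space V) {\<omega> \<in> space (coin_space V). sampled V J \<omega> = S} = (\<Prod>u\<in>V. measure tape_space (?A u))"
    unfolding eq unfolding coin_space_def by (rule coins.measure_PiM_emb) (use V A in auto)
  also have "\<dots> = (\<Prod>u\<in>V. if u \<in> S then (1/2) ^ J else 1 - (1/2) ^ J)"
    by (intro prod.cong) (auto simp: measure_heads compl)
  also have "\<dots> = (\<Prod>u\<in>V \<inter> {u. u \<in> S}. (1/2) ^ J) * (\<Prod>u\<in>V \<inter> - {u. u \<in> S}. 1 - (1/2) ^ J)"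
    by (rule prod.If_cases[OF V])
  also have "V \<inter> {u. u \<in> S} = S" using S by auto
  also have "V \<inter> - {u. u \<in> S} = V - S" by auto
  finally show "measure (coin_space V) {\<omega> \<in> space (coin_space V). sampled V J \<omega> = S} = weight ((1/2) ^ J) V S"
    by (simp add: weight_def)
qed

text \<open>Probabilities of events that depend on the sample alone become finite sums, so the
  estimates below can do without the infinite tapes.\<close>

lemma measure_sampled:
  assumes V: "finite V"
  shows "measure (coin_space V) {\<omega> \<in> space (coin_space V). Q (sampled V J \<omega>)}
    = (\<Sum>S\<in>{S \<in> Pow V. Q S}. weight ((1/2) ^ J) V S)"
proof -
  let ?ev = "\<lambda>S. {\<omega> \<in> space (coin_space V). sampled V J \<omega> = S}"
  interpret prob_space "coin_space V" unfolding coin_space_def by (rule coins.prob_space_axioms)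
  have eq: "{\<omega> \<in> space (coin_space V). Q (sampled V J \<omega>)} = (\<Union>S\<in>{S \<in> Pow V. Q S}. ?ev S)"
    by (auto simp: sampled_def)
  have "measure (coin_space V) (\<Union>S\<in>{S \<in> Pow V. Q S}. ?ev S) = (\<Sum>S\<in>{S \<in> Pow V. Q S}. measure (coin_space V) (?ev S))"
  proof (rule finite_measure_finite_Union)
    show "finite {S \<in> Pow V. Q S}" using V by simp
    show "?ev ` {S \<in> Pow V. Q S} \<subseteq> sets (coin_space V)" 
    proof
      fix A assume "A \<in> ?ev ` {S \<in> Pow V. Q S}"
      then obtain S where "A = ?ev S" "S \<subseteq> V" by auto
      then show "A \<in> sets (coin_space V)" using sampled_eq(1)[OF V, of S J] by simp
    qed
    show "disjoint_family_on ?ev {S \<in> Pow V. Q S}" unfolding disjoint_family_on_def by blast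
  qed
  also have "\<dots> = (\<Sum>S\<in>{S \<in> Pow V. Q S}. weight ((1/2) ^ J) V S)"
    using sampled_eq(2)[OF V] by (intro sum.cong) auto
  finally show ?thesis unfolding eq .
qed

lemma sum_union_bound:
  fixes f :: "'a \<Rightarrow> real"
  assumes "finite A" "finite B" "\<And>x. 0 \<le> f x"
  shows "sum f (A \<union> B) \<le> sum f A + sum f B"
  using sum.union_inter[OF assms(1,2), of f] sum_nonneg[of "A \<inter> B" f] assms(3) by simp

lemma sum_UNION_bound:
  fixes f :: "'a \<Rightarrow> real"
  assumes "finite I" "\<And>i. i \<in> I \<Longrightarrow> finite (A i)" "\<And>x. 0 \<le> f x"
  shows "sum f (\<Union>i\<in>I. A i) \<le> (\<Sum>i\<in>I. sum f (A i))"
  using assms(1,2)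
proof (induction I rule: finite_induct)
  case (insert i I)
  then show ?case using sum_union_bound[of "A i" "\<Union>i\<in>I. A i" f] assms(3) by fastforce
qed simp

context
  fixes V :: "'a set" and p :: real
  assumes V: "finite V" and p: "0 \<le> p" "p \<le> 1"
begin

lemma weight_nonneg: "0 \<le> weight p V S"
  using p by (simp add: weight_def)

lemma sum_weight: "(\<Sum>S\<in>Pow V. weight p V S) = 1"
  using prod_add[OF V, of "\<lambda>_. p" "\<lambda>_. 1 - p"] by (simp add: weight_def)

text \<open>Giving the choice of an element of \<open>C\<close> the factor 0 discards the sets that
  meet \<open>C\<close>, and the sum over all subsets is then the expansion of a product.\<close>

lemma sum_weight_avoiding:
  assumes C: "C \<subseteq> V"
  shows "(\<Sum>S\<in>{S \<in> Pow V. C \<inter> S = {}}. weight p V S) = (1 - p) ^ card C"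
proof -
  have "(\<Sum>S\<in>{S \<in> Pow V. C \<inter> S = {}}. weight p V S)
     = (\<Sum>S\<in>Pow V. (\<Prod>x\<in>S. if x \<in> C then 0 else p) * (\<Prod>x\<in>V - S. 1 - p))"
  proof (rule sum.mono_neutral_cong_left)
    show "\<forall>S\<in>Pow V - {S \<in> Pow V. C \<inter> S = {}}. (\<Prod>x\<in>S. if x \<in> C then 0 else p) * (\<Prod>x\<in>V - S. 1 - p) = 0"
    proof
      fix S assume S: "S \<in> Pow V - {S \<in> Pow V. C \<inter> S = {}}"
      then have "finite S" "\<exists>x\<in>S. x \<in> C" using V finite_subset by auto
      then have "(\<Prod>x\<in>S. if x \<in> C then 0 else p) = 0" by (auto intro: prod_zero)
      then show "(\<Prod>x\<in>S. if x \<in> C then 0 else p) * (\<Prod>x\<in>V - S. 1 - p) = 0" by simp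
    qed
    fix S assume "S \<in> {S \<in> Pow V. C \<inter> S = {}}"
    then have "(\<Prod>x\<in>S. if x \<in> C then 0 else p) = (\<Prod>x\<in>S. p)" by (intro prod.cong) auto
    then show "weight p V S = (\<Prod>x\<in>S. if x \<in> C then 0 else p) * (\<Prod>x\<in>V - S. 1 - p)"
      by (simp add: weight_def)
  qed (use V in auto)
  also have "\<dots> = (\<Prod>x\<in>V. (if x \<in> C then 0 else p) + (1 - p))"
    by (rule prod_add[OF V, symmetric])
  also have "\<dots> = (\<Prod>x\<in>V. if x \<in> C then 1 - p else 1)" by (intro prod.cong) auto
  also have "\<dots> = (1 - p) ^ card C"
    using C V by (simp add: prod.If_cases Int_absorb1)
  finally show ?thesis .
qed

text \<open>Exponential Markov inequality: sets with more than \<open>m\<close> elements have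
  \<open>2 ^ card S / 2 ^ m \<ge> 1\<close>, and the expectation of \<open>2 ^ card S\<close> is
  \<open>(1 + p) ^ card V\<close>, again by expanding a product.\<close>

lemma sum_weight_large: "(\<Sum>S\<in>{S \<in> Pow V. m < card S}. weight p V S) \<le> (1 + p) ^ card V / 2 ^ m"
proof -
  have "(\<Sum>S\<in>{S \<in> Pow V. m < card S}. weight p V S) \<le> (\<Sum>S\<in>{S \<in> Pow V. m < card S}. 2 ^ card S / 2 ^ m * weight p V S)"
  proof (rule sum_mono)
    fix S assume S: "S \<in> {S \<in> Pow V. m < card S}"
    have "(2::real) ^ m \<le> 2 ^ card S" using S by (intro power_increasing) auto
    then have "1 \<le> (2::real) ^ card S / 2 ^ m" by simp
    then show "weight p V S \<le> 2 ^ card S / 2 ^ m * weight p V S"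
      using mult_right_mono[of 1 "2 ^ card S / 2 ^ m" "weight p V S"] weight_nonneg[of S] by simp
  qed
  also have "\<dots> \<le> (\<Sum>S\<in>Pow V. 2 ^ card S / 2 ^ m * weight p V S)"
    using V weight_nonneg by (intro sum_mono2) auto
  also have "\<dots> = (\<Sum>S\<in>Pow V. (\<Prod>x\<in>S. 2 * p) * (\<Prod>x\<in>V - S. 1 - p)) / 2 ^ m"
    unfolding sum_divide_distrib by (intro sum.cong) (auto simp: weight_def power_mult_distrib)
  also have "(\<Sum>S\<in>Pow V. (\<Prod>x\<in>S. 2 * p) * (\<Prod>x\<in>V - S. 1 - p)) = (\<Prod>x\<in>V. 2 * p + (1 - p))"
    by (rule prod_add[OF V, symmetric])
  finally show ?thesis by (simp add: algebra_simps)
qed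

text \<open>Union bound over the missed sets and the event that the sample is too large.\<close>

lemma sum_weight_good:
  assumes F: "finite F" "\<And>i. i \<in> F \<Longrightarrow> C i \<subseteq> V \<and> card (C i) = z"
    and Q: "\<And>S. S \<subseteq> V \<Longrightarrow> (\<And>i. i \<in> F \<Longrightarrow> C i \<inter> S \<noteq> {}) \<Longrightarrow> card S \<le> m \<Longrightarrow> Q S"
  shows "(\<Sum>S\<in>{S \<in> Pow V. Q S}. weight p V S) \<ge> 1 - real (card F) * (1 - p) ^ z - (1 + p) ^ card V / 2 ^ m"
proof -
  let ?bad = "(\<Union>i\<in>F. {S \<in> Pow V. C i \<inter> S = {}}) \<union> {S \<in> Pow V. m < card S}"
  have fin: "finite (Pow V)" using V by simp
  have "1 = (\<Sum>S\<in>Pow V. weight p V S)" by (simp add: sum_weight)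
  also have "\<dots> \<le> (\<Sum>S\<in>{S \<in> Pow V. Q S} \<union> ?bad. weight p V S)"
  proof (rule sum_mono2)
    show "Pow V \<subseteq> {S \<in> Pow V. Q S} \<union> ?bad"
    proof
      fix S assume S: "S \<in> Pow V"
      show "S \<in> {S \<in> Pow V. Q S} \<union> ?bad"
      proof (cases "(\<forall>i\<in>F. C i \<inter> S \<noteq> {}) \<and> card S \<le> m")
        case True
        then show ?thesis using Q[of S] S by blast
      next
        case False
        then show ?thesis using S by (auto simp: not_le)
      qed
    qed
    show "finite ({S \<in> Pow V. Q S} \<union> ?bad)" using fin F(1) by auto
  qed (rule weight_nonneg)
  also have "\<dots> \<le> (\<Sum>S\<in>{S \<in> Pow V. Q S}. weight p V S) + (\<Sum>S\<in>?bad. weight p V S)"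
    using fin F(1) weight_nonneg by (intro sum_union_bound) auto
  also have "(\<Sum>S\<in>?bad. weight p V S) \<le> (\<Sum>S\<in>(\<Union>i\<in>F. {S \<in> Pow V. C i \<inter> S = {}}). weight p V S)
     + (\<Sum>S\<in>{S \<in> Pow V. m < card S}. weight p V S)"
    using fin F(1) weight_nonneg by (intro sum_union_bound) auto
  also have "(\<Sum>S\<in>(\<Union>i\<in>F. {S \<in> Pow V. C i \<inter> S = {}}). weight p V S)
      \<le> (\<Sum>i\<in>F. \<Sum>S\<in>{S \<in> Pow V. C i \<inter> S = {}}. weight p V S)"
    using fin F(1) weight_nonneg by (intro sum_UNION_bound) auto
  also have "\<dots> = (\<Sum>i\<in>F. (1 - p) ^ z)"
  proof (rule sum.cong[OF refl])
    fix i assume "i \<in> F"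
    from F(2)[OF this] show "(\<Sum>S\<in>{S \<in> Pow V. C i \<inter> S = {}}. weight p V S) = (1 - p) ^ z"
      using sum_weight_avoiding[of "C i"] by simp
  qed
  also have "\<dots> = real (card F) * (1 - p) ^ z" by simp
  finally show ?thesis using sum_weight_large[of m] by simp
qed

end

subsection \<open>Parameters and running time\<close>

definition clog :: "real \<Rightarrow> nat" where
  "clog x = nat \<lceil>log 2 x\<rceil>"

lemma clog:
  assumes "1 \<le> x"
  shows "x \<le> 2 ^ clog x" "2 ^ clog x \<le> 2 * x" "real (clog x) \<le> log 2 x + 1"
proof -
  have log: "0 \<le> log 2 x" using assms by simp
  then have le: "log 2 x \<le> real (clog x)" and ge: "real (clog x) \<le> log 2 x + 1"
    unfolding clog_def by linarith+
  show "real (clog x) \<le> log 2 x + 1" by (rule ge)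
  have "2 powr log 2 x \<le> 2 powr real (clog x)" using le by (intro powr_mono) auto
  then show "x \<le> 2 ^ clog x" using assms by (simp add: powr_realpow)
  have "2 powr real (clog x) \<le> 2 powr (log 2 x + 1)" using ge by (intro powr_mono) auto
  then show "2 ^ clog x \<le> 2 * x" using assms by (simp add: powr_realpow powr_add)
qed

definition lgn :: "nat \<Rightarrow> nat" where "lgn n = clog (real n + 1)"
definition rate :: "nat \<Rightarrow> nat" where "rate n = clog (real n powr (2/3))"
text \<open>At a rate of about n^(-2/3), a block of \<open>2 ^ rate n\<close> vertices is missed
  with probability at most 1/2. The \<open>(c + 4) * lgn n\<close> blocks bring this down to
  n^(-(c+4)), which leaves room for a union bound over 2 n^2 pairs.\<close>

definition window :: "nat \<Rightarrow> nat \<Rightarrow> nat" where "window c n = (c + 4) * lgn n * 2 ^ rate n"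
text \<open>In the tail bound \<open>(1 + p) ^ n / 2 ^ m\<close> the numerator is at most e^(pn),
  hence at most 4 to the power of the rounded-up cube root of n; the first summand cancels it and
  the second leaves n^(-(c+1)).\<close>

definition sample_cap :: "nat \<Rightarrow> nat \<Rightarrow> nat" where
  "sample_cap c n = 2 * nat \<lceil>real n powr (1/3)\<rceil> + (c + 1) * lgn n"
text \<open>The parenthesised constant C is such that all parameters add up to at most C n^2, and C
  < 2^C \<le> (n + 1)^C trades the factor for an exponent. The 2 accounts for n^2 and
  \<open>cid\<close> for the identifiers.\<close>

definition poly_deg :: "nat \<Rightarrow> nat \<Rightarrow> nat" where
  "poly_deg cid c = (3 + 2 * (c + 4) + (c + 5) + 3 * ((c + 5) * (c + 5)) + 5) + 2 + cid"

lemma lgn_ge: "n + 1 \<le> 2 ^ lgn n"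
proof -
  have "real (n + 1) \<le> real (2 ^ lgn n)" using clog(1)[of "real n + 1"] by (simp add: lgn_def add.commute)
  then show ?thesis by (simp only: of_nat_le_iff)
qed

lemma log_ge_1: "1 \<le> n \<Longrightarrow> 1 \<le> log 2 (real n + 1)"
  by simp

lemma lgn_le: "1 \<le> n \<Longrightarrow> real (lgn n) \<le> 2 * log 2 (real n + 1)"
  using clog(3)[of "real n + 1"] log_ge_1[of n] unfolding lgn_def by linarith

lemma lgn_pos: "1 \<le> n \<Longrightarrow> 1 \<le> lgn n"
  using lgn_ge[of n] by (cases "lgn n") auto

lemma lgn_le_n: "lgn n \<le> n"
proof -
  have "n < 2 ^ n" by (rule less_exp)
  then have "real (n + 1) \<le> real (2 ^ n)" by (simp only: of_nat_le_iff)
  then have "real n + 1 \<le> 2 ^ n" by simp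
  then have "log 2 (real n + 1) \<le> log 2 (2 ^ n)" by (intro log_mono) auto
  also have "\<dots> = real n" by simp
  finally show ?thesis unfolding lgn_def clog_def by linarith
qed

lemma rate_bounds:
  assumes "1 \<le> n"
  shows "real n powr (2/3) \<le> 2 ^ rate n" "2 ^ rate n \<le> 2 * real n powr (2/3)"
  using clog[of "real n powr (2/3)"] assms by (auto simp: rate_def ge_one_powr_ge_zero)

lemma rate_le_n: "1 \<le> n \<Longrightarrow> 2 ^ rate n \<le> 2 * n"
proof -
  assume n: "1 \<le> n"
  have "real n powr (2/3) \<le> real n powr 1" using n by (intro powr_mono) auto
  then have "real (2 ^ rate n) \<le> real (2 * n)" using rate_bounds(2)[OF n] n by simp
  then show ?thesis by (simp only: of_nat_le_iff)
qed

lemma root_le_n: "1 \<le> n \<Longrightarrow> nat \<lceil>real n powr (1/3)\<rceil> \<le> n"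
proof -
  assume n: "1 \<le> n"
  have "real n powr (1/3) \<le> real n powr 1" using n by (intro powr_mono) auto
  then have "real n powr (1/3) \<le> real n" using n by simp
  then show ?thesis by linarith
qed

lemma poly_deg_large:
  assumes "1 \<le> n"
  shows "3 * n + window c n + (sample_cap c n + 2) + 3 * ((sample_cap c n + 2) * (sample_cap c n + 2)) + 5
    < (n + 1) ^ poly_deg cid c"
proof -
  let ?C = "3 + 2 * (c + 4) + (c + 5) + 3 * ((c + 5) * (c + 5)) + 5"
  have "window c n \<le> (c + 4) * n * (2 * n)"
    unfolding window_def using lgn_le_n rate_le_n[OF assms] by (intro mult_le_mono) auto
  then have w: "window c n \<le> 2 * (c + 4) * (n * n)" by (simp add: ac_simps)
  have "sample_cap c n + 2 \<le> 2 * n + (c + 1) * n + 2 * n"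
    unfolding sample_cap_def using lgn_le_n root_le_n[OF assms] assms
    by (intro add_mono mult_le_mono) auto
  then have s: "sample_cap c n + 2 \<le> (c + 5) * n" by (simp add: algebra_simps)
  have nn: "n \<le> n * n" "1 \<le> n * n" using assms by auto
  have s1: "sample_cap c n + 2 \<le> (c + 5) * (n * n)" using s nn(1) by (meson le_trans mult_le_mono2)
  have s2: "(sample_cap c n + 2) * (sample_cap c n + 2) \<le> ((c + 5) * (c + 5)) * (n * n)"
    using mult_le_mono[OF s s] by (simp add: ac_simps)
  have "3 * n + window c n + (sample_cap c n + 2) + 3 * ((sample_cap c n + 2) * (sample_cap c n + 2)) + 5
    \<le> 3 * (n * n) + 2 * (c + 4) * (n * n) + (c + 5) * (n * n) + 3 * (((c + 5) * (c + 5)) * (n * n)) + 5 * (n * n)"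
    using w s1 s2 nn by (intro add_mono mult_le_mono2) auto
  also have "\<dots> = ?C * (n * n)" by (simp only: add_mult_distrib mult.assoc)
  also have "\<dots> < 2 ^ ?C * ((n + 1) * (n + 1))"
    by (intro mult_less_le_imp_less less_exp mult_le_mono) (use assms in auto)
  also have "\<dots> \<le> (n + 1) ^ ?C * ((n + 1) * (n + 1))"
    using assms by (intro mult_le_mono1 power_mono) auto
  also have "\<dots> = (n + 1) ^ (?C + 2)" by (simp only: power_add power2_eq_square)
  also have "\<dots> \<le> (n + 1) ^ poly_deg cid c"
    unfolding poly_deg_def by (intro power_increasing) auto
  finally show ?thesis .
qed

text \<open>Five entries below \<open>(n + 1) ^ q\<close>; 3 further bits cover the six possible
  lengths 0 to 5.\<close>

definition msg_bits :: "nat \<Rightarrow> nat \<Rightarrow> nat" where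
  "msg_bits q n = 5 * (q * lgn n) + 3"

lemma msg_set_card:
  shows "finite (msg_set ((n + 1) ^ q))" "card (msg_set ((n + 1) ^ q)) \<le> 2 ^ msg_bits q n"
proof -
  let ?B = "(n + 1) ^ q"
  have eq: "msg_set ?B = {xs. set xs \<subseteq> {..<?B} \<and> length xs \<le> 5}" by (auto simp: msg_set_def)
  show "finite (msg_set ?B)" unfolding eq by (rule finite_lists_length_le) simp
  have "card (msg_set ?B) = (\<Sum>i\<le>5. ?B ^ i)" unfolding eq by (subst card_lists_length_le) auto
  also have "\<dots> \<le> (\<Sum>i\<le>(5::nat). ?B ^ 5)" by (intro sum_mono power_increasing) auto
  also have "\<dots> \<le> 8 * ?B ^ 5" by simp
  also have "?B ^ 5 = (n + 1) ^ (5 * q)" by (simp add: power_mult[symmetric] mult.commute)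
  also have "8 * (n + 1) ^ (5 * q) \<le> 8 * (2 ^ lgn n) ^ (5 * q)"
    using lgn_ge by (intro mult_le_mono2 power_mono) auto
  also have "\<dots> = 2 ^ msg_bits q n"
    by (simp add: msg_bits_def power_add power_mult[symmetric] ac_simps)
  finally show "card (msg_set ?B) \<le> 2 ^ msg_bits q n" .
qed

lemma msg_bits_le: "1 \<le> n \<Longrightarrow> real (msg_bits q n) \<le> real (10 * q + 3) * log 2 (real n + 1)"
proof -
  assume n: "1 \<le> n"
  have "real (msg_bits q n) = 5 * (real q * real (lgn n)) + 3" by (simp add: msg_bits_def)
  also have "\<dots> \<le> 5 * (real q * (2 * log 2 (real n + 1))) + 3 * log 2 (real n + 1)"
    using lgn_le[OF n] log_ge_1[OF n] by (intro add_mono mult_left_mono) auto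
  finally show ?thesis by (simp add: algebra_simps)
qed

lemma miss_probability:
  assumes "1 \<le> n"
  shows "(1 - (1/2) ^ rate n :: real) ^ window c n \<le> 1 / real n ^ (c + 4)"
proof -
  let ?p = "(1/2) ^ rate n :: real"
  have p: "0 < ?p" "?p \<le> 1" by (auto simp: power_le_one)
  have "(1 - ?p) ^ (2 ^ rate n) \<le> exp (- ?p) ^ (2 ^ rate n)"
    using p exp_ge_add_one_self[of "- ?p"] by (intro power_mono) auto
  also have "\<dots> = exp (- 1)" by (simp add: exp_of_nat_mult[symmetric] power_one_over)
  also have "\<dots> \<le> 1/2" using exp_ge_add_one_self[of 1] by (simp add: exp_minus field_simps)
  finally have half: "(1 - ?p) ^ (2 ^ rate n) \<le> 1/2" .
  have "(1 - ?p) ^ window c n = ((1 - ?p) ^ (2 ^ rate n)) ^ (lgn n * (c + 4))"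
    by (simp add: window_def power_mult[symmetric] ac_simps)
  also have "\<dots> \<le> (1/2) ^ (lgn n * (c + 4))" using half p by (intro power_mono) auto
  also have "\<dots> = 1 / real (2 ^ lgn n) ^ (c + 4)" by (simp add: power_mult power_one_over)
  also have "\<dots> \<le> 1 / real n ^ (c + 4)"
  proof -
    have "real n \<le> real (2 ^ lgn n)" using lgn_ge[of n] by (simp only: of_nat_le_iff)
    then show ?thesis using assms by (intro divide_left_mono power_mono mult_pos_pos) auto
  qed
  finally show ?thesis .
qed

lemma overflow_probability:
  assumes "1 \<le> n"
  shows "(1 + (1/2) ^ rate n :: real) ^ n / 2 ^ sample_cap c n \<le> 1 / real n ^ (c + 1)"
proof -
  let ?p = "(1/2) ^ rate n :: real"
  let ?r = "nat \<lceil>real n powr (1/3)\<rceil>"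
  have n: "0 < real n" using assms by simp
  have "?p \<le> 1 / real n powr (2/3)"
    using rate_bounds(1)[OF assms] n by (simp add: power_one_over frac_le)
  then have "?p * real n \<le> real n / real n powr (2/3)" using n by (simp add: field_simps)
  also have "\<dots> = real n powr (1/3)"
    using powr_diff[of "real n" 1 "2/3"] n by simp
  also have "\<dots> \<le> real ?r" by linarith
  finally have pn: "?p * real n \<le> real ?r" .
  have "(1 + ?p) ^ n \<le> exp ?p ^ n"
    using exp_ge_add_one_self[of ?p] by (intro power_mono) (auto simp: add_nonneg_nonneg)
  also have "\<dots> = exp (?p * real n)" by (simp add: exp_of_nat_mult[symmetric] mult.commute)
  also have "\<dots> \<le> exp (real ?r)" using pn by simp
  also have "\<dots> = exp 1 ^ ?r" by (simp add: exp_of_nat_mult[symmetric])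
  also have "\<dots> \<le> 4 ^ ?r" using exp_le by (intro power_mono) auto
  also have "\<dots> = 2 ^ (2 * ?r)" by (simp add: power_mult)
  finally have "(1 + ?p) ^ n / 2 ^ sample_cap c n \<le> 2 ^ (2 * ?r) / 2 ^ sample_cap c n"
    by (intro divide_right_mono) auto
  also have "\<dots> = 1 / real (2 ^ lgn n) ^ (c + 1)"
    by (simp add: sample_cap_def power_add power_mult[symmetric] ac_simps)
  also have "\<dots> \<le> 1 / real n ^ (c + 1)"
  proof -
    have "real n \<le> real (2 ^ lgn n)" using lgn_ge[of n] by (simp only: of_nat_le_iff)
    then show ?thesis using assms by (intro divide_left_mono power_mono mult_pos_pos) auto
  qed
  finally show ?thesis .
qed

lemma success_probability:
  assumes n: "2 \<le> n" and F: "F \<le> 2 * (n * n)"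
  shows "1 - 1 / real n ^ c
    \<le> 1 - real F * (1 - (1/2) ^ rate n) ^ window c n - (1 + (1/2) ^ rate n) ^ n / 2 ^ sample_cap c n"
proof -
  have n1: "1 \<le> n" using n by simp
  have nn: "2 \<le> real n" using n by simp
  have FF: "real F \<le> real (2 * (n * n))" using F by (simp only: of_nat_le_iff)
  have "real F * (1 - (1/2) ^ rate n) ^ window c n \<le> real (2 * (n * n)) * (1 / real n ^ (c + 4))"
    using FF miss_probability[OF n1, of c]
    by (intro mult_mono) (auto simp: power_le_one)
  also have "\<dots> = 2 / real n ^ (c + 2)" using nn by (simp add: power_add field_simps power2_eq_square eval_nat_numeral)
  also have "\<dots> \<le> real n / real n ^ (c + 2)" using nn by (intro divide_right_mono) auto
  also have "\<dots> = 1 / real n ^ (c + 1)" using nn by (simp add: field_simps)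
  finally have 1: "real F * (1 - (1/2) ^ rate n) ^ window c n \<le> 1 / real n ^ (c + 1)" .
  have "1 / real n ^ (c + 1) + 1 / real n ^ (c + 1) = 2 / real n ^ (c + 1)" by simp
  also have "\<dots> \<le> real n / real n ^ (c + 1)" using nn by (intro divide_right_mono) auto
  also have "\<dots> = 1 / real n ^ c" using nn by (simp add: field_simps)
  finally show ?thesis using 1 overflow_probability[OF n1, of c] by linarith
qed

text \<open>With l the logarithm and Y the cube root of n, the landmark capacity is at most (2c + 8)
  l Y, and its square is responsible for the factor l^2 in the running time. The coefficient 9 is 5
  + 4, after bounding the capacity by its square; 14 is 6 + 8, so that the coefficient 8 of the
  diameter is covered too.\<close>

definition time_const :: "nat \<Rightarrow> real" where
  "time_const c = real (14 + 28 * (c + 4) + 9 * (2 * c + 8) ^ 2)"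

lemma time_bound:
  assumes n: "1 \<le> n" and e: "e \<le> D"
  shows "8 * e + 6 + 7 * window c n + 5 * (sample_cap c n + 2) + 4 * ((sample_cap c n + 2) * (sample_cap c n + 2))
    \<le> nat \<lfloor>time_const c * (real n powr (2/3) + real D) * (log 2 (real n + 1)) ^ 2\<rfloor>"
proof -
  define X where "X = real n powr (2/3)"
  define Y where "Y = real n powr (1/3)"
  define l where "l = log 2 (real n + 1)"
  define M where "M = real (sample_cap c n + 2)"
  have l: "1 \<le> l" unfolding l_def by (rule log_ge_1[OF n])
  have Y: "1 \<le> Y" unfolding Y_def using n by (simp add: ge_one_powr_ge_zero)
  have XY: "X = Y * Y" unfolding X_def Y_def by (simp add: powr_add[symmetric])
  have X: "1 \<le> X" unfolding X_def using n by (simp add: ge_one_powr_ge_zero)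
  have ll: "l \<le> l ^ 2" "1 \<le> l ^ 2" using l self_le_power[of l 2] by auto
  have "real (window c n) = real (c + 4) * real (lgn n) * 2 ^ rate n" by (simp add: window_def)
  also have "\<dots> \<le> real (c + 4) * (2 * l) * (2 * X)"
    using lgn_le[OF n] rate_bounds(2)[OF n] l unfolding l_def X_def by (intro mult_mono) auto
  also have "\<dots> = 4 * real (c + 4) * X * l" by simp
  also have "\<dots> \<le> 4 * real (c + 4) * X * l ^ 2" using ll X by (intro mult_left_mono) auto
  finally have W: "real (window c n) \<le> 4 * real (c + 4) * X * l ^ 2" .
  have r: "real (nat \<lceil>Y\<rceil>) \<le> 2 * Y" using Y by linarith
  have "M = 2 * real (nat \<lceil>Y\<rceil>) + real (c + 1) * real (lgn n) + 2"
    by (simp add: M_def sample_cap_def Y_def algebra_simps)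
  also have "\<dots> \<le> 2 * (2 * Y) + real (c + 1) * (2 * l) + 2"
    using r lgn_le[OF n] unfolding l_def by (intro add_mono mult_left_mono) auto
  also have "\<dots> \<le> 4 * (l * Y) + real (c + 1) * (2 * (l * Y)) + 2 * (l * Y)"
  proof -
    have "Y \<le> l * Y" "l \<le> l * Y" "1 \<le> l * Y" using l Y mult_mono[of 1 l 1 Y] by auto
    then show ?thesis by (intro add_mono mult_left_mono) auto
  qed
  also have "\<dots> = real (2 * c + 8) * (l * Y)" by (simp add: algebra_simps)
  finally have M: "M \<le> real (2 * c + 8) * (l * Y)" .
  have M1: "1 \<le> M" by (simp add: M_def)
  have "M * M \<le> (real (2 * c + 8) * (l * Y)) * (real (2 * c + 8) * (l * Y))"
    using M M1 by (intro mult_mono) auto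
  also have "\<dots> = real (2 * c + 8) ^ 2 * X * l ^ 2" unfolding XY power2_eq_square by simp
  finally have MM: "M * M \<le> real (2 * c + 8) ^ 2 * X * l ^ 2" .
  have M_MM: "M \<le> M * M" using M1 by simp
  have D: "real e \<le> real D * l ^ 2" using e mult_left_mono[OF ll(2), of "real D"] by simp
  have XL: "1 \<le> X * l ^ 2" using X ll mult_mono[of 1 X 1 "l ^ 2"] by simp
  have "real (8 * e + 6 + 7 * window c n + 5 * (sample_cap c n + 2) + 4 * ((sample_cap c n + 2) * (sample_cap c n + 2)))
    = 8 * real e + 6 + 7 * real (window c n) + 5 * M + 4 * (M * M)"
    by (simp only: of_nat_add of_nat_mult of_nat_numeral M_def)
  also have "\<dots> \<le> 8 * (real D * l ^ 2) + 6 * (X * l ^ 2) + 7 * (4 * real (c + 4) * X * l ^ 2)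
      + 9 * (real (2 * c + 8) ^ 2 * X * l ^ 2)"
    using D XL W MM M_MM by linarith
  also have "\<dots> = (8 * real D + (6 + 28 * real (c + 4) + 9 * real (2 * c + 8) ^ 2) * X) * l ^ 2"
    by (simp add: algebra_simps)
  also have "\<dots> \<le> (time_const c * real D + time_const c * X) * l ^ 2"
    unfolding time_const_def using X by (intro mult_right_mono add_mono) auto
  also have "\<dots> = time_const c * (X + real D) * l ^ 2" by (simp add: algebra_simps)
  finally show ?thesis unfolding X_def l_def by linarith
qed

section \<open>The algorithm on random tapes and its success probability\<close>

definition know0 :: "nat \<Rightarrow> linput \<Rightarrow> tape \<Rightarrow> know" where
  "know0 c i w = initial (window c (fst (snd i))) (sample_cap c (fst (snd i)) + 2) (heads (rate (fst (snd i))) w) i"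

definition rpaths_msgs :: "nat \<Rightarrow> nat \<Rightarrow> linput \<Rightarrow> msg set" where
  "rpaths_msgs cid c i = msg_set ((fst (snd i) + 1) ^ poly_deg cid c)"

definition rpaths_bits :: "nat \<Rightarrow> nat \<Rightarrow> linput \<Rightarrow> nat" where
  "rpaths_bits cid c i = msg_bits (poly_deg cid c) (fst (snd i))"

definition rpaths_send :: "nat \<Rightarrow> nat \<Rightarrow> send_fun" where
  "rpaths_send cid c = machine_send rpaths_machine (rpaths_msgs cid c) (rpaths_bits cid c) (know0 c)"

definition rpaths_out :: "nat \<Rightarrow> nat \<Rightarrow> out_fun" where
  "rpaths_out cid c = machine_out rpaths_machine (rpaths_msgs cid c) (rpaths_bits cid c) (know0 c)"

lemma hist_cong:
  assumes NV: "\<forall>u\<in>V. N u \<subseteq> V" and s: "\<And>u h v. u \<in> V \<Longrightarrow> sendf (I u) (\<omega> u) h v = sendf (I u) (\<omega>' u) h v"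
    and "u \<in> V"
  shows "hist sendf I N \<omega> r u = hist sendf I N \<omega>' r u"
  using assms(3)
proof (induction r arbitrary: u)
  case (Suc r)
  have "(if w \<in> N u then sendf (I w) (\<omega> w) (hist sendf I N \<omega> r w) u else None)
     = (if w \<in> N u then sendf (I w) (\<omega>' w) (hist sendf I N \<omega>' r w) u else None)" for w
  proof (cases "w \<in> N u")
    case True
    then have w: "w \<in> V" using NV Suc.prems by blast
    show ?thesis unfolding Suc.IH[OF w] using s[OF w] by simp
  qed simp
  then show ?case unfolding hist.simps Suc.IH[OF Suc.prems] by simp
qed simp

context rpaths_instance
begin

abbreviation "input \<equiv> local_input V E s t P"

lemma input_n: "fst (snd (input u)) = card V"
  by (simp add: local_input_def)

lemma rpaths_run_decides:
  assumes V: "V \<subseteq> {..< card V ^ cid}" and n: "2 \<le> card V"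
    and S: "S = sampled V (rate (card V)) \<omega>" "card S \<le> sample_cap c (card V)"
    and hit: "hitting Ep S (window c (card V))" "hitting Eo S (window c (card V))"
    and i: "i < len"
  shows "decides (rpaths_send cid c) (rpaths_out cid c) input (nbrs E) \<omega> (P ! i)
    (nat \<lfloor>time_const c * (real (card V) powr (2/3) + real (udiam V E)) * (log 2 (real (card V) + 1)) ^ 2\<rfloor>)
    (repl_dist E s t (P ! i, P ! Suc i))"
proof -
  let ?n = "card V"
  \<comment> \<open>Adding the ends of \<open>P\<close> costs 2 in the capacity and preserves
    hitting, which is monotone in the landmark set.\<close>
  let ?L = "S \<union> {s, t}"
  let ?B = "(?n + 1) ^ poly_deg cid c"
  have n1: "1 \<le> ?n" using n by simp
  have SV: "S \<subseteq> V" unfolding S(1) sampled_def by blast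
  have hit_mono: "hitting H ?L z" if "hitting H S z" for H z
    using that unfolding hitting_def by blast
  interpret R: rpaths_run V E s t P ?L "window c ?n" "sample_cap c ?n + 2" ?B
  proof
    show "card ?L \<le> sample_cap c ?n + 2"
    proof -
      have "card ?L \<le> card S + card {s, t}" by (rule card_Un_le)
      also have "card {s, t} \<le> 2" by (simp add: card_insert_if)
      finally show ?thesis using S(2) by simp
    qed
    show "0 < window c ?n" using lgn_pos[OF n1] by (simp add: window_def)
    show "v < ?B" if "v \<in> V" for v
    proof -
      have "v < ?n ^ cid" using that V by auto
      also have "\<dots> \<le> (?n + 1) ^ cid" by (intro power_mono) auto
      also have "\<dots> \<le> ?B" unfolding poly_deg_def by (intro power_increasing) auto
      finally show ?thesis .
    qed
    show "3 * ?n + window c ?n + (sample_cap c ?n + 2) + 3 * ((sample_cap c ?n + 2) * (sample_cap c ?n + 2)) + 5 < ?B"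
      by (rule poly_deg_large[OF n1])
  qed (use SV sV tV hit hit_mono in auto)
  define K where "K u = know0 c (input u) (\<omega> u)" for u
  have "R.base K"
    unfolding R.base_def
    by (auto simp: K_def know0_def initial_def local_input_def S(1) sampled_def)
  from R.rpaths_machine_correct[OF this] obtain K' where K':
    "computes (nbrs E) V (msg_set ?B) rpaths_machine K R.total_time K'"
    "\<And>i. i < len \<Longrightarrow> K' (P ! i) = repl_dist E s t (P ! i, P ! Suc i)" by blast
  have "R.total_time = 8 * R.ecc_s + 6 + 7 * window c ?n + 5 * (sample_cap c ?n + 2)
      + 4 * ((sample_cap c ?n + 2) * (sample_cap c ?n + 2))"
    unfolding R.total_time_def by simp
  then have T: "R.total_time \<le> nat \<lfloor>time_const c * (real ?n powr (2/3) + real (udiam V E)) * (log 2 (real ?n + 1)) ^ 2\<rfloor>"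
    using time_bound[OF n1 R.ecc_s_le, of c] by simp
  have "decides (rpaths_send cid c) (rpaths_out cid c) input (nbrs E) \<omega> (P ! i)
    (nat \<lfloor>time_const c * (real ?n powr (2/3) + real (udiam V E)) * (log 2 (real ?n + 1)) ^ 2\<rfloor>) (K' (P ! i))"
    unfolding rpaths_send_def rpaths_out_def
  proof (rule decides_machine[OF _ _ _ nbrs_V K'(1) _ T])
    show "finite (rpaths_msgs cid c i)" "card (rpaths_msgs cid c i) \<le> 2 ^ rpaths_bits cid c i" for i
      unfolding rpaths_msgs_def rpaths_bits_def by (rule msg_set_card)+
    show "rpaths_msgs cid c (input u) = msg_set ?B \<and> rpaths_bits cid c (input u) = msg_bits (poly_deg cid c) ?n" for u
      unfolding rpaths_msgs_def rpaths_bits_def input_n by simp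
    show "K u = know0 c (input u) (\<omega> u)" for u by (simp add: K_def)
    show "P ! i \<in> V" using P_V i by simp
  qed
  then show ?thesis using K'(2)[OF i] by simp
qed

text \<open>A tape enters only through the outcome of its initial tosses, so success depends on the
  sample alone. The success event thus takes the form required by
  \<open>measure_sampled\<close>.\<close>

lemma decides_cong:
  assumes "sampled V (rate (card V)) \<omega> = sampled V (rate (card V)) \<omega>'" and u: "u \<in> V"
  shows "decides (rpaths_send cid c) (rpaths_out cid c) input (nbrs E) \<omega> u T x
    \<longleftrightarrow> decides (rpaths_send cid c) (rpaths_out cid c) input (nbrs E) \<omega>' u T x"
proof -
  have k: "know0 c (input u) (\<omega> u) = know0 c (input u) (\<omega>' u)" if "u \<in> V" for u
  proof -
    have "u \<in> sampled V (rate (card V)) \<omega> \<longleftrightarrow> u \<in> sampled V (rate (card V)) \<omega>'" using assms(1) by simp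
    then have "heads (rate (card V)) (\<omega> u) \<longleftrightarrow> heads (rate (card V)) (\<omega>' u)" using that by (simp add: sampled_def)
    then show ?thesis unfolding know0_def input_n by simp
  qed
  have h: "hist (rpaths_send cid c) input (nbrs E) \<omega> r u = hist (rpaths_send cid c) input (nbrs E) \<omega>' r u" for r
    by (rule hist_cong[OF nbrs_V _ u]) (simp add: rpaths_send_def machine_send_def k)
  show ?thesis unfolding decides_def h rpaths_out_def machine_out_def k[OF u] ..
qed

lemma rpaths_success:
  assumes V: "V \<subseteq> {..< card V ^ cid}" and n: "2 \<le> card V"
  shows "1 - 1 / real (card V) ^ c \<le> measure (coin_space V) {\<omega> \<in> space (coin_space V). \<forall>i<length P - 1.
    decides (rpaths_send cid c) (rpaths_out cid c) input (nbrs E) \<omega> (P ! i)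
      (nat \<lfloor>time_const c * (real (card V) powr (2/3) + real (udiam V E)) * (log 2 (real (card V) + 1)) ^ 2\<rfloor>)
      (repl_dist E s t (P ! i, P ! Suc i))}"
proof -
  let ?n = "card V" and ?J = "rate (card V)" and ?z = "window c (card V)"
  let ?p = "(1/2) ^ ?J :: real"
  define ok where "ok \<omega> \<longleftrightarrow> (\<forall>i<len. decides (rpaths_send cid c) (rpaths_out cid c) input (nbrs E) \<omega> (P ! i)
      (nat \<lfloor>time_const c * (real ?n powr (2/3) + real (udiam V E)) * (log 2 (real ?n + 1)) ^ 2\<rfloor>)
      (repl_dist E s t (P ! i, P ! Suc i)))" for \<omega>
  define Q where "Q S \<longleftrightarrow> (\<exists>\<omega>. sampled V ?J \<omega> = S \<and> ok \<omega>)" for S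
  have "ok \<omega> \<longleftrightarrow> ok \<omega>'" if "sampled V ?J \<omega> = sampled V ?J \<omega>'" for \<omega> \<omega>'
    unfolding ok_def using decides_cong[OF that] P_V by (metis less_imp_le)
  then have ok_Q: "ok \<omega> \<longleftrightarrow> Q (sampled V ?J \<omega>)" for \<omega> unfolding Q_def by metis
  have z: "0 < ?z" using lgn_pos[of ?n] n by (simp add: window_def)
  have Ep_V: "Ep \<subseteq> V \<times> V" and Eo_V: "Eo \<subseteq> V \<times> V" using Ep_E E_V by (auto simp: Eo_def)
  from hitting_family[OF Ep_V z] obtain Cp where Cp:
    "\<And>x y. at_distance Ep x y ?z \<Longrightarrow> Cp x y \<subseteq> V \<and> card (Cp x y) = ?z"
    "\<And>L. (\<And>x y. x \<in> V \<Longrightarrow> y \<in> V \<Longrightarrow> at_distance Ep x y ?z \<Longrightarrow> Cp x y \<inter> L \<noteq> {}) \<Longrightarrow> hitting Ep L ?z" by blast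
  from hitting_family[OF Eo_V z] obtain Co where Co:
    "\<And>x y. at_distance Eo x y ?z \<Longrightarrow> Co x y \<subseteq> V \<and> card (Co x y) = ?z"
    "\<And>L. (\<And>x y. x \<in> V \<Longrightarrow> y \<in> V \<Longrightarrow> at_distance Eo x y ?z \<Longrightarrow> Co x y \<inter> L \<noteq> {}) \<Longrightarrow> hitting Eo L ?z" by blast
  define C where "C = (\<lambda>(b, x, y). if b then Cp x y else Co x y)"
  \<comment> \<open>The Boolean tells which relation a pair belongs to; the two families together
    contribute at most 2 n^2 sets to the union bound.\<close>
  define F where "F = {(b, x, y). x \<in> V \<and> y \<in> V \<and> at_distance (if b then Ep else Eo) x y ?z}"
  have F_sub: "F \<subseteq> UNIV \<times> V \<times> V" by (auto simp: F_def)
  have finF: "finite (UNIV \<times> V \<times> V :: (bool \<times> nat \<times> nat) set)" using finV by simp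
  have F: "finite F" using F_sub finF by (rule finite_subset)
  have cardF: "card F \<le> 2 * (?n * ?n)"
    using card_mono[OF finF F_sub] by (simp add: card_cartesian_product)
  have C: "C i \<subseteq> V \<and> card (C i) = ?z" if "i \<in> F" for i
  proof -
    obtain b x y where i: "i = (b, x, y)" by (cases i)
    then have "at_distance (if b then Ep else Eo) x y ?z" using that by (simp add: F_def)
    then show ?thesis using Cp(1)[of x y] Co(1)[of x y] by (cases b) (simp_all add: i C_def)
  qed
  have Q: "Q S" if "S \<subseteq> V" "\<And>i. i \<in> F \<Longrightarrow> C i \<inter> S \<noteq> {}" "card S \<le> sample_cap c ?n" for S
  proof -
    \<comment> \<open>Constant tapes realise any prescribed sample, provided that at least one coin
      is tossed; this is the case because n \<ge> 2 makes n^(2/3) exceed 1.\<close>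
    define \<omega> :: "nat \<Rightarrow> tape" where "\<omega> u j = (u \<in> S)" for u j
    show ?thesis
    proof (cases "?J = 0")
      case True
      then have "2 ^ ?J = (1::real)" by simp
      then have "real ?n powr (2/3) \<le> 1" using rate_bounds(1)[of ?n] n by simp
      moreover have "1 < real ?n powr (2/3)" using n by (intro gr_one_powr) auto
      ultimately show ?thesis by simp
    next
      case False
      have S: "S = sampled V ?J \<omega>" using that(1) False by (auto simp: sampled_def heads_def \<omega>_def)
      have hp: "hitting Ep S ?z"
      proof (rule Cp(2))
        fix x y assume "x \<in> V" "y \<in> V" "at_distance Ep x y ?z"
        then have "(True, x, y) \<in> F" by (simp add: F_def)
        from that(2)[OF this] show "Cp x y \<inter> S \<noteq> {}" by (simp add: C_def)
      qed
      have ho: "hitting Eo S ?z"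
      proof (rule Co(2))
        fix x y assume "x \<in> V" "y \<in> V" "at_distance Eo x y ?z"
        then have "(False, x, y) \<in> F" by (simp add: F_def)
        from that(2)[OF this] show "Co x y \<inter> S \<noteq> {}" by (simp add: C_def)
      qed
      have "ok \<omega>" unfolding ok_def using rpaths_run_decides[OF V n S that(3) hp ho] by blast
      then show ?thesis unfolding Q_def using S by blast
    qed
  qed
  have p: "0 \<le> ?p" "?p \<le> 1" by (auto simp: power_le_one)
  have "1 - 1 / real ?n ^ c \<le> 1 - real (card F) * (1 - ?p) ^ ?z - (1 + ?p) ^ ?n / 2 ^ sample_cap c ?n"
    by (rule success_probability[OF n cardF])
  also have "\<dots> \<le> (\<Sum>S\<in>{S \<in> Pow V. Q S}. weight ?p V S)"
    by (rule sum_weight_good[OF finV p F C Q])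
  also have "\<dots> = measure (coin_space V) {\<omega> \<in> space (coin_space V). Q (sampled V ?J \<omega>)}"
    by (rule measure_sampled[OF finV, symmetric])
  finally show ?thesis unfolding ok_Q[symmetric] unfolding ok_def len_def .
qed

end

theorem theorem1p1:
  "\<forall>(cid::nat) (c::nat). \<exists>(sendf::send_fun) (outp::out_fun) (B::real) (C::real) (k::nat).
     \<forall>(V::nat set) (E::(nat \<times> nat) set) (s::nat) (t::nat) (P::nat list).
       finite V \<and> V \<noteq> {} \<and> V \<subseteq> {..< card V ^ cid} \<and> E \<subseteq> V \<times> V \<and> uconnected V E \<and>
       s \<in> V \<and> t \<in> V \<and> is_shortest_path E s t P \<longrightarrow>
       (let n = card V; D = udiam V E; I = local_input V E s t P; N = nbrs E;
            T = nat \<lfloor>C * (real n powr (2/3) + real D) * (log 2 (real n + 1)) ^ k\<rfloor>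
        in (\<forall>\<omega> r u v. u \<in> V \<longrightarrow> v \<in> N u \<longrightarrow>
              (case sendf (I u) (\<omega> u) (hist sendf I N \<omega> r u) v of
                 None \<Rightarrow> True
               | Some m \<Rightarrow> real (length m) \<le> B * log 2 (real n + 1)))
         \<and> measure (coin_space V)
             {\<omega> \<in> space (coin_space V). \<forall>i < length P - 1.
                decides sendf outp I N \<omega> (P ! i) T (repl_dist E s t (P ! i, P ! Suc i))}
           \<ge> 1 - 1 / real n ^ c)"
proof (intro allI, goal_cases)
  case (1 cid c)
  let ?B = "real (10 * poly_deg cid c + 3)" and ?C = "time_const c"
  show ?case
    unfolding Let_def
  proof (rule exI[of _ "rpaths_send cid c"], rule exI[of _ "rpaths_out cid c"], rule exI[of _ ?B], rule exI[of _ ?C],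
      rule exI[of _ 2], intro allI impI, elim conjE)
    fix V :: "nat set" and E :: "(nat \<times> nat) set" and s t :: nat and P :: "nat list"
    assume V: "finite V" "V \<noteq> {}" "V \<subseteq> {..< card V ^ cid}" and G: "E \<subseteq> V \<times> V" "uconnected V E"
      "s \<in> V" "t \<in> V" "is_shortest_path E s t P"
    interpret rpaths_instance V E s t P using V(1) G by unfold_locales
    have n1: "1 \<le> card V" using V(1,2) by (simp add: Suc_le_eq card_gt_0_iff)
    have msg: "case rpaths_send cid c (input u) (\<omega> u) h v of None \<Rightarrow> True
       | Some m \<Rightarrow> real (length m) \<le> ?B * log 2 (real (card V) + 1)" for \<omega> u v h
    proof (cases "rpaths_send cid c (input u) (\<omega> u) h v")
      case (Some m)
      have "length m = rpaths_bits cid c (input u)"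
        using Some unfolding rpaths_send_def
        by (rule machine_send_length[rotated 2]) (unfold rpaths_msgs_def rpaths_bits_def, (rule msg_set_card)+)
      then show ?thesis using Some msg_bits_le[OF n1, of "poly_deg cid c"] unfolding rpaths_bits_def input_n by simp
    qed simp
    have prob: "1 - 1 / real (card V) ^ c \<le> measure (coin_space V) {\<omega> \<in> space (coin_space V). \<forall>i<length P - 1.
      decides (rpaths_send cid c) (rpaths_out cid c) input (nbrs E) \<omega> (P ! i)
        (nat \<lfloor>?C * (real (card V) powr (2/3) + real (udiam V E)) * (log 2 (real (card V) + 1)) ^ 2\<rfloor>)
        (repl_dist E s t (P ! i, P ! Suc i))}"
    \<comment> \<open>For a single vertex the claimed lower bound on the probability is 0.\<close>
    proof (cases "card V = 1")
      case True
      then show ?thesis by simp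
    next
      case False
      then show ?thesis using rpaths_success[OF V(3)] n1 by simp
    qed
    show "(\<forall>\<omega> r u v. u \<in> V \<longrightarrow> v \<in> nbrs E u \<longrightarrow>
       (case rpaths_send cid c (input u) (\<omega> u) (hist (rpaths_send cid c) input (nbrs E) \<omega> r u) v of
          None \<Rightarrow> True | Some m \<Rightarrow> real (length m) \<le> ?B * log 2 (real (card V) + 1))) \<and>
      1 - 1 / real (card V) ^ c \<le> measure (coin_space V) {\<omega> \<in> space (coin_space V). \<forall>i<length P - 1.
        decides (rpaths_send cid c) (rpaths_out cid c) input (nbrs E) \<omega> (P ! i)
          (nat \<lfloor>?C * (real (card V) powr (2/3) + real (udiam V E)) * (log 2 (real (card V) + 1)) ^ 2\<rfloor>)
          (repl_dist E s t (P ! i, P ! Suc i))}"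
      using msg prob by blast
  qed
qed

end
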